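(* Let $J$ be a signature operator in a separable Hilbert space $H$ and let $T$ be a $J$-self-adjoint operator such that $T_{\min}:=T \cap T^*$ is a simple densely defined symmetric operator in $H$ with deficiency indices (2,2). Then there exist nondecreasing scalar functions $\Sigma_+$, $\Sigma_-$ satisfying \[ \int_\mathbb R \frac{d\Sigma_\pm (t)}{1+t^2} < \infty ,\quad \int_\mathbb R d\Sigma_\pm (t) = \infty,\quad \Sigma_\pm (t) = \tfrac 12 (\Sigma_\pm(t-0) + \Sigma_\pm (t+0)),\quad \Sigma_\pm (0) = 0, \] and real constants $C_+$, $C_-$ such that $T$ is unitarily equivalent to the operator $\widehat A \, \{ \Sigma_+ , C_+ , \Sigma_- , C_- \}$.
   Context: A signature operator is $J=J^*=J^{-1}$; $T$ is $J$-self-adjoint if $JT$ is self-adjoint. A closed symmetric operator is simple if it has no nontrivial reducing subspace on which it is self-adjoint. For a nondecreasing $\Sigma$ satisfying the four conditions above, $Q_\Sigma$ is multiplication by $t$ in $L^2(\mathbb R,d\Sigma)$ on its natural domain $\operatorname{dom}(Q_\Sigma)=\{f: \int |tf|^2 d\Sigma<\infty\}$; $T_\Sigma$ is the restriction of $Q_\Sigma$ to $\{f\in\operatorname{dom}(Q_\Sigma): \int_\mathbb R f\, d\Sigma=0\}$; its adjoint has $\operatorname{dom}(T_\Sigma^* )=\{f=f_Q+\mathfrak c\, t(t^2+1)^{-1}: f_Q\in\operatorname{dom}(Q_\Sigma),\ \mathfrak c\in\mathbb C\}$, $T_\Sigma^* f = tf_Q-\mathfrak c (t^2+1)^{-1}$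 ($\mathfrak c$ is uniquely determined). For real $C$ put $\Gamma_0^{\Sigma} f=\mathfrak c$, $\Gamma_1^{\Sigma,C} f=\mathfrak c\, C+\int_\mathbb R f_Q\, d\Sigma$. Then $\widehat A\{\Sigma_+,C_+,\Sigma_-,C_-\}$ is the operator in $L^2(\mathbb R,d\Sigma_+)\oplus L^2(\mathbb R,d\Sigma_-)$ given as the restriction of $T_{\Sigma_+}^*\oplus T_{\Sigma_-}^*$ to $\{f_++f_-: f_\pm\in\operatorname{dom}(T^*_{\Sigma_\pm}),\ \Gamma_0^{\Sigma_+}f_+=\Gamma_0^{\Sigma_-}f_-,\ \Gamma_1^{\Sigma_+,C_+}f_+=\Gamma_1^{\Sigma_-,C_-}f_-\}$. *)

theory Defs
  imports "HOL-Analysis.Analysis"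
begin

text \<open>A complex Hilbert space H is represented by a real Hilbert space (type of class
  real_inner and complete_space) together with an orthogonal complex structure I
  (multiplication by the imaginary unit).\<close>

definition complex_structure :: "('h::real_inner \<Rightarrow> 'h) \<Rightarrow> bool" where
  "complex_structure I \<longleftrightarrow> linear I \<and> (\<forall>x. I (I x) = - x) \<and> (\<forall>x y. inner (I x) (I y) = inner x y)"

definition cscale :: "('h::real_vector \<Rightarrow> 'h) \<Rightarrow> complex \<Rightarrow> 'h \<Rightarrow> 'h" where
  "cscale I z x = Re z *\<^sub>R x + Im z *\<^sub>R I x"

text \<open>complex inner product: linear in the first, conjugate linear in the second argument\<close>
definition cinner :: "('h::real_inner \<Rightarrow> 'h) \<Rightarrow> 'h \<Rightarrow> 'h \<Rightarrow> complex" where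
  "cinner I x y = Complex (inner x y) (inner x (I y))"

definition csubspace :: "('h::real_vector \<Rightarrow> 'h) \<Rightarrow> 'h set \<Rightarrow> bool" where
  "csubspace I M \<longleftrightarrow> subspace M \<and> (\<forall>x\<in>M. I x \<in> M)"

definition cindep :: "('h::real_vector \<Rightarrow> 'h) \<Rightarrow> 'h set \<Rightarrow> bool" where
  "cindep I B \<longleftrightarrow> (\<forall>c. (\<Sum>b\<in>B. cscale I (c b) b) = 0 \<longrightarrow> (\<forall>b\<in>B. c b = 0))"

definition cspan :: "('h::real_vector \<Rightarrow> 'h) \<Rightarrow> 'h set \<Rightarrow> 'h set" where
  "cspan I B = {(\<Sum>b\<in>B. cscale I (c b) b) | c. True}"

definition cdim_eq :: "('h::real_vector \<Rightarrow> 'h) \<Rightarrow> 'h set \<Rightarrow> nat \<Rightarrow> bool" where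
  "cdim_eq I V n \<longleftrightarrow> (\<exists>B. B \<subseteq> V \<and> finite B \<and> card B = n \<and> cindep I B \<and> cspan I B = V)"

definition is_operator :: "('h::real_vector \<Rightarrow> 'h) \<Rightarrow> ('h \<times> 'h) set \<Rightarrow> bool" where
  "is_operator I G \<longleftrightarrow> subspace G \<and> (\<forall>(x,y)\<in>G. (I x, I y) \<in> G) \<and> (\<forall>y. (0, y) \<in> G \<longrightarrow> y = 0)"

definition op_dom :: "('h \<times> 'h) set \<Rightarrow> 'h set" where
  "op_dom G = fst ` G"

definition adjoint :: "('h::real_inner \<Rightarrow> 'h) \<Rightarrow> ('h \<times> 'h) set \<Rightarrow> ('h \<times> 'h) set" where
  "adjoint I G = {(y, z). \<forall>(x, w)\<in>G. cinner I w y = cinner I x z}"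

definition densely_defined :: "('h::real_inner \<times> 'h) set \<Rightarrow> bool" where
  "densely_defined G \<longleftrightarrow> closure (op_dom G) = UNIV"

definition symmetric_op :: "('h::real_inner \<Rightarrow> 'h) \<Rightarrow> ('h \<times> 'h) set \<Rightarrow> bool" where
  "symmetric_op I G \<longleftrightarrow> is_operator I G \<and> densely_defined G \<and> G \<subseteq> adjoint I G"

definition self_adjoint_op :: "('h::real_inner \<Rightarrow> 'h) \<Rightarrow> ('h \<times> 'h) set \<Rightarrow> bool" where
  "self_adjoint_op I G \<longleftrightarrow> is_operator I G \<and> adjoint I G = G"

definition defect_space :: "('h::real_inner \<Rightarrow> 'h) \<Rightarrow> ('h \<times> 'h) set \<Rightarrow> complex \<Rightarrow> 'h set" where
  "defect_space I G z = {y. (y, cscale I z y) \<in> adjoint I G}"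

definition deficiency_indices :: "('h::real_inner \<Rightarrow> 'h) \<Rightarrow> ('h \<times> 'h) set \<Rightarrow> nat \<Rightarrow> nat \<Rightarrow> bool" where
  "deficiency_indices I G m n \<longleftrightarrow>
     cdim_eq I (defect_space I G \<i>) m \<and> cdim_eq I (defect_space I G (- \<i>)) n"

text \<open>M reduces the operator with graph G: M is a closed subspace and (P x, P y) lies in G
  whenever (x,y) does, P being the orthogonal projection onto M (expressed through
  orthogonal decompositions).\<close>
definition reducing :: "('h::real_inner \<Rightarrow> 'h) \<Rightarrow> ('h \<times> 'h) set \<Rightarrow> 'h set \<Rightarrow> bool" where
  "reducing I G M \<longleftrightarrow> csubspace I M \<and> closed M \<and>
     (\<forall>(x, y)\<in>G. \<forall>x1 x2 y1 y2.
        x = x1 + x2 \<and> x1 \<in> M \<and> (\<forall>m\<in>M. inner x2 m = 0) \<and>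
        y = y1 + y2 \<and> y1 \<in> M \<and> (\<forall>m\<in>M. inner y2 m = 0) \<longrightarrow> (x1, y1) \<in> G)"

definition self_adjoint_part :: "('h::real_inner \<Rightarrow> 'h) \<Rightarrow> ('h \<times> 'h) set \<Rightarrow> 'h set \<Rightarrow> bool" where
  "self_adjoint_part I G M \<longleftrightarrow>
     {(y, z). y \<in> M \<and> z \<in> M \<and> (\<forall>(x, w)\<in>G \<inter> (M \<times> M). cinner I w y = cinner I x z)} = G \<inter> (M \<times> M)"

definition simple_symmetric :: "('h::real_inner \<Rightarrow> 'h) \<Rightarrow> ('h \<times> 'h) set \<Rightarrow> bool" where
  "simple_symmetric I G \<longleftrightarrow> symmetric_op I G \<and> closed G \<and>
     \<not> (\<exists>M. M \<noteq> {0} \<and> reducing I G M \<and> self_adjoint_part I G M)"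

definition signature_op :: "('h::real_inner \<Rightarrow> 'h) \<Rightarrow> ('h \<Rightarrow> 'h) \<Rightarrow> bool" where
  "signature_op I J \<longleftrightarrow> bounded_linear J \<and> (\<forall>x. J (I x) = I (J x)) \<and> (\<forall>x. J (J x) = x) \<and>
     (\<forall>x y. cinner I (J x) y = cinner I x (J y))"

definition comp_graph :: "('h \<Rightarrow> 'h) \<Rightarrow> ('h \<times> 'h) set \<Rightarrow> ('h \<times> 'h) set" where
  "comp_graph J G = {(x, J y) | x y. (x, y) \<in> G}"

definition J_self_adjoint :: "('h::real_inner \<Rightarrow> 'h) \<Rightarrow> ('h \<Rightarrow> 'h) \<Rightarrow> ('h \<times> 'h) set \<Rightarrow> bool" where
  "J_self_adjoint I J G \<longleftrightarrow> is_operator I G \<and> self_adjoint_op I (comp_graph J G)"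

definition right_lim :: "(real \<Rightarrow> real) \<Rightarrow> real \<Rightarrow> real" where
  "right_lim S t = Lim (at_right t) S"

definition left_lim :: "(real \<Rightarrow> real) \<Rightarrow> real \<Rightarrow> real" where
  "left_lim S t = Lim (at_left t) S"

definition LS_measure :: "(real \<Rightarrow> real) \<Rightarrow> real measure" where
  "LS_measure S = interval_measure (right_lim S)"

definition admissible_Sigma :: "(real \<Rightarrow> real) \<Rightarrow> bool" where
  "admissible_Sigma S \<longleftrightarrow> mono S \<and>
     (\<integral>\<^sup>+ t. ennreal (1 / (1 + t\<^sup>2)) \<partial>LS_measure S) < \<infinity> \<and>
     emeasure (LS_measure S) UNIV = \<infinity> \<and>
     (\<forall>t. S t = (left_lim S t + right_lim S t) / 2) \<and>
     S 0 = 0"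

definition L2 :: "(real \<Rightarrow> real) \<Rightarrow> (real \<Rightarrow> complex) \<Rightarrow> bool" where
  "L2 S f \<longleftrightarrow> f \<in> borel_measurable (LS_measure S) \<and> integrable (LS_measure S) (\<lambda>t. (cmod (f t))\<^sup>2)"

definition L2_inner :: "(real \<Rightarrow> real) \<Rightarrow> (real \<Rightarrow> complex) \<Rightarrow> (real \<Rightarrow> complex) \<Rightarrow> complex" where
  "L2_inner S f g = (\<integral>t. f t * cnj (g t) \<partial>LS_measure S)"

definition domQ :: "(real \<Rightarrow> real) \<Rightarrow> (real \<Rightarrow> complex) \<Rightarrow> bool" where
  "domQ S f \<longleftrightarrow> L2 S f \<and> L2 S (\<lambda>t. complex_of_real t * f t)"

text \<open>graph of Ahat{S+,C+,S-,C-} in L2(dS+) (+) L2(dS-); elements of L2 are represented by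
  functions, equalities holding almost everywhere\<close>
definition Ahat :: "(real \<Rightarrow> real) \<Rightarrow> real \<Rightarrow> (real \<Rightarrow> real) \<Rightarrow> real \<Rightarrow>
    (((real \<Rightarrow> complex) \<times> (real \<Rightarrow> complex)) \<times> ((real \<Rightarrow> complex) \<times> (real \<Rightarrow> complex))) set" where
  "Ahat Sp Cp Sm Cm = {((fp, fm), (gp, gm)). \<exists>fQp fQm (c::complex).
      domQ Sp fQp \<and> domQ Sm fQm \<and>
      (AE t in LS_measure Sp. fp t = fQp t + c * complex_of_real (t / (t\<^sup>2 + 1))) \<and>
      (AE t in LS_measure Sm. fm t = fQm t + c * complex_of_real (t / (t\<^sup>2 + 1))) \<and>
      (AE t in LS_measure Sp. gp t = complex_of_real t * fQp t - c * complex_of_real (1 / (t\<^sup>2 + 1))) \<and>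
      (AE t in LS_measure Sm. gm t = complex_of_real t * fQm t - c * complex_of_real (1 / (t\<^sup>2 + 1))) \<and>
      c * complex_of_real Cp + (\<integral>t. fQp t \<partial>LS_measure Sp) = c * complex_of_real Cm + (\<integral>t. fQm t \<partial>LS_measure Sm)}"

text \<open>U is a unitary operator from H onto L2(dS+) (+) L2(dS-) (functions representing
  classes): it preserves inner products and is onto modulo a.e. equality\<close>
definition unitary_to_L2 :: "('h::real_inner \<Rightarrow> 'h) \<Rightarrow> (real \<Rightarrow> real) \<Rightarrow> (real \<Rightarrow> real) \<Rightarrow>
    ('h \<Rightarrow> (real \<Rightarrow> complex) \<times> (real \<Rightarrow> complex)) \<Rightarrow> bool" where
  "unitary_to_L2 I Sp Sm U \<longleftrightarrow>
     (\<forall>x. L2 Sp (fst (U x)) \<and> L2 Sm (snd (U x))) \<and>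
     (\<forall>x y. cinner I x y = L2_inner Sp (fst (U x)) (fst (U y)) + L2_inner Sm (snd (U x)) (snd (U y))) \<and>
     (\<forall>fp fm. L2 Sp fp \<and> L2 Sm fm \<longrightarrow>
        (\<exists>x. (AE t in LS_measure Sp. fst (U x) t = fp t) \<and> (AE t in LS_measure Sm. snd (U x) t = fm t)))"

definition unitarily_equivalent_to_Ahat :: "('h::real_inner \<Rightarrow> 'h) \<Rightarrow> ('h \<times> 'h) set \<Rightarrow>
    (real \<Rightarrow> real) \<Rightarrow> real \<Rightarrow> (real \<Rightarrow> real) \<Rightarrow> real \<Rightarrow> bool" where
  "unitarily_equivalent_to_Ahat I G Sp Cp Sm Cm \<longleftrightarrow>
     (\<exists>U. unitary_to_L2 I Sp Sm U \<and>
        (\<forall>x y. (x, y) \<in> G \<longleftrightarrow> (U x, U y) \<in> Ahat Sp Cp Sm Cm))"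

end

(*
  In the Cayley coordinates u = y + ix, v = y - ix, the graph of T becomes a relation sigma that is its own
  polar with respect to <u, J u'> - <v, J v'>, and the Cayley transform "core" of T_min is the J-invariant
  part of sigma. Each of the two defect spaces of T_min is spanned by one vector from either eigenspace of J.
  The values of sigma on the two defect vectors of the +1 eigenspace fill C^2, and the element of sigma with
  values (1, 1) there has nonzero values of equal modulus on the two defect vectors of the -1 eigenspace; so
  these can be scaled to be 1 as well. Let W be the unitary extension of core that maps the scaled vectors e, f
  of the first defect space to those of the second. It commutes with J, and sigma consists of the pairs
  (w - (c/2)(e + f), W(w + (c/2)(e + f))) with <w, f> - <w, e> = i C c for one real constant C. This is already the shape of the boundary conditions
  in the model operator.

  Simplicity of T_min says that e and f together are cyclic for W, so the space is the orthogonal sum of the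
  cyclic subspaces of e and of f. By Herglotz' theorem (Fejer densities and Helly selection) each of them is
  L^2(mu) with W acting as multiplication by zeta = (t - i)/(t + i); the point zeta = 1 carries no mass by the
  mean ergodic theorem. Dividing by t - i and putting dSigma = (1 + t^2) dmu turns e into 1/(t - i), and sigma
  into the graph of the model operator. The measure dSigma is infinite because the domain of T_min is dense.
*)
theory Submission
  imports Defs "HOL-Probability.Helly_Selection"
begin

text \<open>A \<open>J\<close>-self-adjoint operator may have no regular point at all, so
  \<open>T\<close> itself offers no resolvent and no spectral theorem. The spectral theory is done
  instead for \<open>W\<close>, the Cayley transform of a self-adjoint extension of T_min that
  commutes with \<open>J\<close>; in the model this extension is the direct sum of the two
  multiplication operators, which is why \<open>zeta\<close> has its form. Relative to it,
  \<open>T\<close> is only another choice of boundary condition. Both signs of \<open>J\<close>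
  occur in each defect space because a self-polar relation becomes, after an exchange of negative
  components, the graph of an isometry defined everywhere; dimension two then leaves one direction
  per sign. Rescaling \<open>f\<close> aligns the two boundary conditions: the pair with all four
  values 1 lies both in \<open>\<sigma>\<close> and in the graph of \<open>W\<close>, and it is an
  instance of the case c = 0.\<close>

section \<open>Orthogonal projections\<close>

text \<open>Orthogonality is real here; for subspaces closed under \<open>I\<close> it coincides
  with complex orthogonality. A minimising sequence is Cauchy by the parallelogram law.\<close>

lemma hilbert_projection:
  fixes S :: "'a::{real_inner, complete_space} set"
  assumes S: "subspace S" "closed S"
  obtains p where "p \<in> S" "\<And>s. s \<in> S \<Longrightarrow> inner (x - p) s = 0"
proof -
  define d where "d = Inf ((\<lambda>s. (norm (x - s))\<^sup>2) ` S)"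
  have S0: "0 \<in> S" using S subspace_0 by auto
  have bdd: "bdd_below ((\<lambda>s. (norm (x - s))\<^sup>2) ` S)" by (rule bdd_belowI[of _ 0]) auto
  have d_le: "d \<le> (norm (x - s))\<^sup>2" if "s \<in> S" for s
    unfolding d_def using bdd that by (auto intro: cInf_lower)
  have "\<exists>s\<in>S. (norm (x - s))\<^sup>2 < d + inverse (real (Suc n))" for n
  proof -
    have "d < d + inverse (real (Suc n))" by simp
    then have "\<exists>z\<in>(\<lambda>s. (norm (x - s))\<^sup>2) ` S. z < d + inverse (real (Suc n))"
      using cInf_lessD[of "(\<lambda>s. (norm (x - s))\<^sup>2) ` S"] S0 unfolding d_def by blast
    then show ?thesis by auto
  qed
  then obtain s where s: "\<And>n. s n \<in> S" "\<And>n. (norm (x - s n))\<^sup>2 < d + inverse (real (Suc n))"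
    by metis
  have par: "(norm (s m - s n))\<^sup>2 \<le> 2 * inverse (real (Suc m)) + 2 * inverse (real (Suc n))" for m n
  proof -
    have "(1/2) *\<^sub>R (s m + s n) \<in> S" using s S by (simp add: subspace_add subspace_scale)
    then have "d \<le> (norm (x - (1/2) *\<^sub>R (s m + s n)))\<^sup>2" by (rule d_le)
    moreover have "4 * (norm (x - (1/2) *\<^sub>R (s m + s n)))\<^sup>2 + (norm (s m - s n))\<^sup>2
        = 2 * (norm (x - s m))\<^sup>2 + 2 * (norm (x - s n))\<^sup>2"
      by (simp add: power2_norm_eq_inner inner_diff_left inner_diff_right inner_add_left inner_add_right
          inner_commute algebra_simps)
    ultimately show ?thesis using s(2)[of m] s(2)[of n] by linarith
  qed
  have inv: "(\<lambda>n. inverse (real (Suc n))) \<longlonglongrightarrow> 0" by (rule LIMSEQ_inverse_real_of_nat)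
  have "Cauchy s"
  proof (rule CauchyI)
    fix e :: real assume e: "e > 0"
    then have "e\<^sup>2 / 4 > 0" by simp
    then obtain N where N: "\<And>n. n \<ge> N \<Longrightarrow> inverse (real (Suc n)) < e\<^sup>2 / 4"
      using order_tendstoD(2)[OF inv] unfolding eventually_sequentially by blast
    show "\<exists>M. \<forall>m\<ge>M. \<forall>n\<ge>M. norm (s m - s n) < e"
    proof (intro exI[of _ N] allI impI)
      fix m n assume "m \<ge> N" "n \<ge> N"
      then have "(norm (s m - s n))\<^sup>2 < e\<^sup>2"
        using par[of m n] N[of m] N[of n] by linarith
      then show "norm (s m - s n) < e" using e by (simp add: power2_less_imp_less)
    qed
  qed
  then obtain p where p: "s \<longlonglongrightarrow> p" using Cauchy_convergent_iff convergent_def by blast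
  have pS: "p \<in> S" using S(2) closed_sequential_limits p s(1) by blast
  have "(\<lambda>n. (norm (x - s n))\<^sup>2) \<longlonglongrightarrow> (norm (x - p))\<^sup>2" by (intro tendsto_intros p)
  moreover have "(\<lambda>n. d + inverse (real (Suc n))) \<longlonglongrightarrow> d + 0" by (intro tendsto_intros inv)
  ultimately have pd: "(norm (x - p))\<^sup>2 \<le> d"
    using LIMSEQ_le[of _ "(norm (x - p))\<^sup>2" _ "d + 0"] s(2) by (force intro: less_imp_le)
  have "inner (x - p) t = 0" if t: "t \<in> S" for t
  proof (cases "t = 0")
    case False
    define q where "q = x - p"
    \<comment> \<open>The step that minimises the distance along \<open>t\<close>; minimality of
      \<open>p\<close> forces its gain to vanish.\<close>
    define a where "a = inner (x - p) t / inner t t"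
    have "p + a *\<^sub>R t \<in> S" using S pS t by (simp add: subspace_add subspace_scale)
    from order_trans[OF pd d_le[OF this]] have "(norm (x - p))\<^sup>2 \<le> (norm (q - a *\<^sub>R t))\<^sup>2"
      by (simp only: diff_diff_eq q_def)
    also have "\<dots> = (norm q)\<^sup>2 - 2 * a * inner q t + a * a * inner t t"
      by (simp add: power2_norm_eq_inner inner_diff_left inner_diff_right inner_commute)
    also have "\<dots> = (norm (x - p))\<^sup>2 - (inner (x - p) t)\<^sup>2 / inner t t"
      using False unfolding a_def q_def by (simp add: power2_eq_square field_simps)
    finally have "(inner (x - p) t)\<^sup>2 / inner t t \<le> 0" by simp
    then show ?thesis using False
      by (metis inner_gt_zero_iff divide_le_0_iff inner_ge_zero not_less power2_less_eq_zero_iff zero_le_power2)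
  qed simp
  with pS that show ?thesis by blast
qed

text \<open>A vector orthogonal to the kernel represents the functional up to a factor. It serves to
  show in \<open>R_onto\<close> that the spectral map is onto.\<close>

lemma riesz_representation:
  fixes f :: "'a::{real_inner, complete_space} \<Rightarrow> real"
  assumes "bounded_linear f"
  obtains z where "\<And>x. f x = inner x z"
proof (cases "\<forall>x. f x = 0")
  case True
  then show ?thesis using that[of 0] by simp
next
  case False
  interpret bounded_linear f by fact
  obtain a where a: "f a \<noteq> 0" using False by blast
  have sub: "subspace {x. f x = 0}" by (auto simp: subspace_def add scale)
  have cl: "closed {x. f x = 0}"
    by (intro closed_Collect_eq continuous_intros continuous_on)
  obtain p where p: "p \<in> {x. f x = 0}" "\<And>s. s \<in> {x. f x = 0} \<Longrightarrow> inner (a - p) s = 0"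
    using hilbert_projection[OF sub cl] by metis
  define b where "b = a - p"
  have fb: "f b \<noteq> 0" using p a by (simp add: b_def diff)
  then have b0: "inner b b \<noteq> 0" using zero by auto
  have "f x = inner x ((f b / inner b b) *\<^sub>R b)" for x
  proof -
    have "f (x - (f x / f b) *\<^sub>R b) = 0" using fb by (simp add: diff scale)
    then have "inner b (x - (f x / f b) *\<^sub>R b) = 0" using p(2) unfolding b_def by blast
    then show ?thesis using fb b0 by (simp add: inner_diff_right inner_commute field_simps)
  qed
  then show ?thesis using that by blast
qed

text \<open>Norms of differences agree in both coordinates, so convergent first components force
  Cauchy second components. For \<open>core\<close> this is closedness of the range of T_min +
  \<i>.\<close>

lemma closed_fst_isometric_relation:
  fixes \<rho> :: "('a::{real_inner, complete_space} \<times> 'a) set"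
  assumes sub: "subspace \<rho>" and cl: "closed \<rho>"
    and iso: "\<And>a b. (a, b) \<in> \<rho> \<Longrightarrow> norm b = norm a"
  shows "closed (fst ` \<rho>)"
  unfolding closed_sequential_limits
proof (intro allI impI, elim conjE)
  fix s l assume s: "\<forall>n. s n \<in> fst ` \<rho>" and l: "s \<longlonglongrightarrow> l"
  have "\<exists>t. (s n, t) \<in> \<rho>" for n using s by force
  then obtain t where t: "\<And>n. (s n, t n) \<in> \<rho>" by metis
  have eq: "dist (t m) (t n) = dist (s m) (s n)" for m n
    using iso[of "s m - s n" "t m - t n"] subspace_diff[OF sub t[of m] t[of n]] by (simp add: dist_norm)
  have "Cauchy s" using l by (rule LIMSEQ_imp_Cauchy)
  then have "Cauchy t" unfolding Cauchy_def eq .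
  then obtain r where "t \<longlonglongrightarrow> r" using Cauchy_convergent_iff convergent_def by blast
  then have "(\<lambda>n. (s n, t n)) \<longlonglongrightarrow> (l, r)" using l by (intro tendsto_Pair)
  then have "(l, r) \<in> \<rho>" using cl t unfolding closed_sequential_limits by (elim allE[of _ "\<lambda>n. (s n, t n)"]) blast
  then show "l \<in> fst ` \<rho>" by force
qed

lemma subspace_fst_image: "subspace \<rho> \<Longrightarrow> subspace (fst ` \<rho>)"
  by (rule linear_subspace_image) (simp_all add: linear_fst)

section \<open>Complex structures\<close>

locale cstruct =
  fixes I :: "'h::{real_inner, complete_space} \<Rightarrow> 'h"
  assumes complex_structure: "complex_structure I"
begin

abbreviation csc (infixr \<open>\<odot>\<close> 75) where "c \<odot> x \<equiv> cscale I c x"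
abbreviation cip (\<open>\<langle>_, _\<rangle>\<close>) where "\<langle>x, y\<rangle> \<equiv> cinner I x y"

lemma linear_I: "linear I" and II[simp]: "I (I x) = - x" and inner_II[simp]: "inner (I x) (I y) = inner x y"
  using complex_structure by (auto simp: complex_structure_def)

lemma I_add[simp]: "I (x + y) = I x + I y" and I_scale[simp]: "I (r *\<^sub>R x) = r *\<^sub>R I x"
  and I_minus[simp]: "I (- x) = - I x" and I_diff[simp]: "I (x - y) = I x - I y" and I_0[simp]: "I 0 = 0"
  using linear_I by (auto simp: linear_add linear_scale linear_neg linear_diff linear_0)

lemma inner_I_left: "inner (I x) y = - inner x (I y)"
  using inner_II[of x "I y"] by simp

lemma inner_I_self[simp]: "inner x (I x) = 0" "inner (I x) x = 0"
  using inner_I_left[of x x] by (auto simp: inner_commute)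

lemma norm_I[simp]: "norm (I x) = norm x"
  by (simp add: norm_eq_sqrt_inner)

sublocale vs: vector_space "cscale I"
  by unfold_locales (auto simp: cscale_def algebra_simps)

lemma csc_of_real: "of_real r \<odot> x = r *\<^sub>R x" and csc_i: "\<i> \<odot> x = I x"
  by (auto simp: cscale_def)

lemma I_csc[simp]: "I (c \<odot> x) = c \<odot> I x"
  by (simp add: cscale_def)

lemma cip_add_left: "\<langle>x + y, z\<rangle> = \<langle>x, z\<rangle> + \<langle>y, z\<rangle>" and cip_add_right: "\<langle>z, x + y\<rangle> = \<langle>z, x\<rangle> + \<langle>z, y\<rangle>"
  and cip_diff_left: "\<langle>x - y, z\<rangle> = \<langle>x, z\<rangle> - \<langle>y, z\<rangle>" and cip_diff_right: "\<langle>z, x - y\<rangle> = \<langle>z, x\<rangle> - \<langle>z, y\<rangle>"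
  and cip_minus_left: "\<langle>- x, z\<rangle> = - \<langle>x, z\<rangle>" and cip_minus_right: "\<langle>z, - x\<rangle> = - \<langle>z, x\<rangle>"
  and cip_0_left[simp]: "\<langle>0, z\<rangle> = 0" and cip_0_right[simp]: "\<langle>z, 0\<rangle> = 0"
  by (auto simp: cinner_def inner_add_left inner_add_right inner_diff_left inner_diff_right complex_eq_iff)

lemma cip_I_left: "\<langle>I x, y\<rangle> = \<i> * \<langle>x, y\<rangle>" and cip_I_right: "\<langle>x, I y\<rangle> = - \<i> * \<langle>x, y\<rangle>"
  by (auto simp: cinner_def complex_eq_iff inner_I_left)

lemma cip_scaleR_left: "\<langle>r *\<^sub>R x, y\<rangle> = of_real r * \<langle>x, y\<rangle>" and cip_scaleR_right: "\<langle>x, r *\<^sub>R y\<rangle> = of_real r * \<langle>x, y\<rangle>"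
  by (auto simp: cinner_def complex_eq_iff)

lemma cip_csc_left: "\<langle>c \<odot> x, y\<rangle> = c * \<langle>x, y\<rangle>" and cip_csc_right: "\<langle>x, c \<odot> y\<rangle> = cnj c * \<langle>x, y\<rangle>"
  by (auto simp: cscale_def cip_add_left cip_add_right cip_scaleR_left cip_scaleR_right
      cip_I_left cip_I_right complex_eq_iff)

lemmas cip_simps = cip_add_left cip_add_right cip_diff_left cip_diff_right cip_minus_left cip_minus_right
  cip_csc_left cip_csc_right

lemma cnj_cip: "cnj \<langle>x, y\<rangle> = \<langle>y, x\<rangle>"
  using inner_I_left[of x y] by (simp add: cinner_def complex_eq_iff inner_commute[of y])

lemma cip_self: "\<langle>x, x\<rangle> = of_real ((norm x)\<^sup>2)"
  by (simp add: cinner_def complex_eq_iff power2_norm_eq_inner)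

lemma cip_self_eq_0[simp]: "\<langle>x, x\<rangle> = 0 \<longleftrightarrow> x = 0"
  by (simp add: cip_self)

lemma cip_eq_0_commute: "\<langle>x, y\<rangle> = 0 \<longleftrightarrow> \<langle>y, x\<rangle> = 0"
  by (metis cnj_cip complex_cnj_zero_iff)

lemma Re_cip: "Re \<langle>x, y\<rangle> = inner x y"
  by (simp add: cinner_def)

lemma norm_cip_le: "cmod \<langle>x, y\<rangle> \<le> norm x * norm y"
proof (cases "\<langle>x, y\<rangle> = 0")
  case False
  \<comment> \<open>Rotating \<open>y\<close> by the phase of the product makes the product real and
    reduces the claim to the real Cauchy-Schwarz inequality.\<close>
  let ?c = "sgn \<langle>x, y\<rangle>"
  have "of_real (cmod \<langle>x, y\<rangle>) = \<langle>x, ?c \<odot> y\<rangle>"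
    using False by (simp add: cip_csc_right sgn_eq mult.commute complex_norm_square[symmetric]
        power2_eq_square)
  then have "cmod \<langle>x, y\<rangle> = inner x (?c \<odot> y)" by (metis Re_cip Re_complex_of_real)
  also have "\<dots> \<le> norm x * norm (?c \<odot> y)" by (rule norm_cauchy_schwarz)
  also have "(norm (?c \<odot> y))\<^sup>2 = (norm y)\<^sup>2"
  proof -
    have "cnj ?c * ?c = 1" using False
      using complex_norm_square[of ?c] by (simp add: norm_sgn mult.commute)
    then have "\<langle>?c \<odot> y, ?c \<odot> y\<rangle> = \<langle>y, y\<rangle>"
      by (simp only: cip_csc_left cip_csc_right mult.assoc[symmetric] mult_1)
    then show ?thesis by (metis cip_self of_real_eq_iff)
  qed
  then have "norm (?c \<odot> y) = norm y" by simp
  finally show ?thesis .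
qed simp

lemma bounded_linear_cip_left: "bounded_linear (\<lambda>x. \<langle>x, y\<rangle>)"
  by (rule bounded_linear_intro[of _ "norm y"])
    (auto simp: cip_add_left cip_scaleR_left norm_cip_le scaleR_conv_of_real)

lemma bounded_linear_cip_right: "bounded_linear (\<lambda>y. \<langle>x, y\<rangle>)"
  by (rule bounded_linear_intro[of _ "norm x"])
    (auto simp: cip_add_right cip_scaleR_right norm_cip_le scaleR_conv_of_real mult.commute[of "norm _" "norm x"]
      intro: order_trans[OF norm_cip_le])

lemma cip_eq_iff_inner: "(\<forall>x\<in>M. \<langle>x, y\<rangle> = 0) \<longleftrightarrow> (\<forall>x\<in>M. inner x y = 0)" if "\<And>x. x \<in> M \<Longrightarrow> I x \<in> M"
  using that by (auto simp: cinner_def complex_eq_iff) (metis inner_I_left neg_equal_zero add.inverse_neutral minus_minus)+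

text \<open>Were \<open>x\<close> outside the span of \<open>e\<close> and \<open>f\<close>, three
  independent vectors would lie in the span of two.\<close>

lemma cdim_2_basis:
  assumes d: "cdim_eq I V 2" and e: "e \<in> V" "f \<in> V" and ind: "\<And>a b. a \<odot> e + b \<odot> f = 0 \<Longrightarrow> a = 0 \<and> b = 0"
    and x: "x \<in> V"
  obtains a b where "x = a \<odot> e + b \<odot> f"
proof -
  obtain B where B: "B \<subseteq> V" "finite B" "card B = 2" "cindep I B" "cspan I B = V"
    using d by (auto simp: cdim_eq_def)
  have V: "V = vs.span B" using B(5) vs.span_finite[OF B(2)] by (auto simp: cspan_def)
  have ef: "e \<noteq> f" using ind[of 1 "-1"] by auto
  have indep: "vs.independent {e, f}"
  proof (rule vs.independent_if_scalars_zero)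
    fix h z assume s: "(\<Sum>x\<in>{e, f}. h x \<odot> x) = 0" and z: "z \<in> {e, f}"
    then have "h e \<odot> e + h f \<odot> f = 0" using ef by simp
    then show "h z = 0" using ind z by blast
  qed simp
  have "x \<in> vs.span {e, f}"
  proof (rule ccontr)
    assume n: "x \<notin> vs.span {e, f}"
    then have "vs.independent {x, e, f}" using indep vs.independent_insertI by blast
    moreover have "{x, e, f} \<subseteq> vs.span B" using e x V by auto
    ultimately have "card {x, e, f} \<le> 2" using vs.independent_span_bound[OF B(2)] B(3) by force
    moreover have "x \<noteq> e" "x \<noteq> f" using n vs.span_base by auto
    ultimately show False using ef by auto
  qed
  then obtain h where "x = (\<Sum>v\<in>{e, f}. h v \<odot> v)" using vs.span_finite[of "{e, f}"] by auto
  then show ?thesis using ef that by simp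
qed

end

lemma subspace_relation_iff:
  "subspace \<rho> \<longleftrightarrow> (0, 0) \<in> \<rho> \<and> (\<forall>a b c d. (a, b) \<in> \<rho> \<longrightarrow> (c, d) \<in> \<rho> \<longrightarrow> (a + c, b + d) \<in> \<rho>)
    \<and> (\<forall>r a b. (a, b) \<in> \<rho> \<longrightarrow> (r *\<^sub>R a, r *\<^sub>R b) \<in> \<rho>)"
  unfolding subspace_def zero_prod_def by (fastforce simp flip: add_Pair scaleR_Pair)

section \<open>Relations that are self-polar for an indefinite form\<close>

text \<open>In the Cayley coordinates \<open>u = y + \<i>x\<close>, \<open>v = y - \<i>x\<close> of a graph \<open>{(x, y)}\<close>, the \<open>J\<close>-self-adjointness
  of an operator becomes the self-polarity \<open>selfpolar\<close>, and \<open>core\<close> is the Cayley transform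
  of the intersection of the operator with its adjoint.\<close>

locale selfpolar_relation =
  fixes J :: "'h::{real_inner, complete_space} \<Rightarrow> 'h" and \<sigma> :: "('h \<times> 'h) set"
  assumes linear_J: "linear J" and JJ[simp]: "J (J x) = x" and J_sym: "inner (J x) y = inner x (J y)"
    and subspace_\<sigma>: "subspace \<sigma>"
    and selfpolar: "(u, v) \<in> \<sigma> \<longleftrightarrow> (\<forall>(u', v')\<in>\<sigma>. inner u (J u') = inner v (J v'))"
begin

definition core :: "('h \<times> 'h) set" where "core = {(u, v). (u, v) \<in> \<sigma> \<and> (J u, J v) \<in> \<sigma>}"

lemma J_add[simp]: "J (x + y) = J x + J y" and J_scale[simp]: "J (r *\<^sub>R x) = r *\<^sub>R J x"
  and J_minus[simp]: "J (- x) = - J x" and J_diff[simp]: "J (x - y) = J x - J y" and J_0[simp]: "J 0 = 0"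
  using linear_J by (auto simp: linear_add linear_scale linear_neg linear_diff linear_0)

lemma inner_JJ[simp]: "inner (J x) (J y) = inner x y"
  by (simp add: J_sym)

lemma norm_J[simp]: "norm (J x) = norm x"
  by (simp add: norm_eq_sqrt_inner)

lemma bounded_linear_J: "bounded_linear J"
  by (rule bounded_linear_intro[of _ 1]) auto

lemma \<sigma>_D: "(u, v) \<in> \<sigma> \<Longrightarrow> (u', v') \<in> \<sigma> \<Longrightarrow> inner u (J u') = inner v (J v')"
  using selfpolar by blast

lemma \<sigma>_I: "(\<And>u' v'. (u', v') \<in> \<sigma> \<Longrightarrow> inner u (J u') = inner v (J v')) \<Longrightarrow> (u, v) \<in> \<sigma>"
  using selfpolar by blast

lemma core_D: "(u, v) \<in> core \<Longrightarrow> (u, v) \<in> \<sigma>" and core_J: "(u, v) \<in> core \<Longrightarrow> (J u, J v) \<in> core"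
  and core_I: "(u, v) \<in> \<sigma> \<Longrightarrow> (J u, J v) \<in> \<sigma> \<Longrightarrow> (u, v) \<in> core"
  by (auto simp: core_def)

text \<open>Since (J u, J v) also lies in \<open>\<sigma>\<close>, the two factors \<open>J\<close>
  cancel and the indefinite identity becomes a definite one, even against elements of
  \<open>\<sigma>\<close> outside \<open>core\<close>.\<close>

lemma core_inner: "(u, v) \<in> core \<Longrightarrow> (u', v') \<in> \<sigma> \<Longrightarrow> inner u u' = inner v v'"
  using \<sigma>_D[of "J u" "J v" u' v'] by (auto simp: core_def)

lemma core_norm: "(u, v) \<in> core \<Longrightarrow> norm v = norm u"
  using core_inner[of u v u v] core_D by (auto simp: norm_eq_sqrt_inner)

lemma closed_\<sigma>: "closed \<sigma>"
proof -
  have "\<sigma> = (\<Inter>(u', v')\<in>\<sigma>. {p. inner (fst p) (J u') = inner (snd p) (J v')})"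
    by (intro equalityI subrelI; force intro: \<sigma>_I dest: \<sigma>_D)
  moreover have "closed \<dots>"
    by (intro closed_INT ballI) (auto intro!: closed_Collect_eq continuous_intros)
  ultimately show ?thesis by simp
qed

lemma subspace_core: "subspace core"
  using subspace_\<sigma> by (auto simp: subspace_relation_iff core_def)

lemma closed_core: "closed core"
proof -
  have "core = \<sigma> \<inter> (\<lambda>p. (J (fst p), J (snd p))) -` \<sigma>" by (auto simp: core_def)
  moreover have "closed ((\<lambda>p. (J (fst p), J (snd p))) -` \<sigma>)"
    by (intro continuous_closed_vimage closed_\<sigma>)
      (auto intro!: continuous_intros bounded_linear.continuous[OF bounded_linear_J])
  ultimately show ?thesis using closed_\<sigma> by auto
qed

text \<open>Changing the sign of \<open>J\<close> negates the form and keeps its polars; this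
  exchanges the two eigenspaces of \<open>J\<close>.\<close>

lemma selfpolar_uminus: "selfpolar_relation (\<lambda>x. - J x) \<sigma>"
  using subspace_\<sigma> J_sym selfpolar linear_J by unfold_locales (auto simp: linear_iff split_beta)

lemma selfpolar_converse: "selfpolar_relation J (\<sigma>\<inverse>)"
proof
  show "subspace (\<sigma>\<inverse>)" using subspace_\<sigma> by (auto simp: subspace_relation_iff)
  show "((u, v) \<in> \<sigma>\<inverse>) = (\<forall>(u', v')\<in>\<sigma>\<inverse>. inner u (J u') = inner v (J v'))" for u v
    unfolding converse_iff by (subst selfpolar) (auto, force+)
qed (use linear_J J_sym in auto)

text \<open>The Potapov--Ginzburg transform \<open>\<rho>\<close> turns the indefinite form into a definite one, so it is the
  graph of an isometry of the whole space.\<close>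

lemma defect_opposite_sign:
  assumes p: "J p = p" "p \<noteq> 0" "\<And>u v. (u, v) \<in> core \<Longrightarrow> inner u p = 0"
  obtains s where "s \<noteq> 0" "J s = - s" "\<And>u v. (u, v) \<in> core \<Longrightarrow> inner u s = 0"
proof -
  define P where "P x = (1/2) *\<^sub>R (x + J x)" for x
  define Q where "Q x = (1/2) *\<^sub>R (x - J x)" for x
  have P_lin: "P (x + y) = P x + P y" "P (r *\<^sub>R x) = r *\<^sub>R P x"
    and Q_lin: "Q (x + y) = Q x + Q y" "Q (r *\<^sub>R x) = r *\<^sub>R Q x" for x y r
    by (auto simp: P_def Q_def algebra_simps)
  have PQ: "x = P x + Q x" "J (P x) = P x" "J (Q x) = - Q x" "J x = P x - Q x" for x
    by (auto simp: P_def Q_def algebra_simps simp flip: scaleR_add_left)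
  have cont: "isCont P x" "isCont Q x" for x
    unfolding P_def Q_def by (auto intro!: continuous_intros bounded_linear.continuous[OF bounded_linear_J])
  have PQ0: "inner (P x) (Q y) = 0" "inner (Q y) (P x) = 0" for x y
    using J_sym[of "P x" "Q y"] by (auto simp: PQ(2,3) inner_commute)
  have PP: "P (P x) = P x" "Q (Q x) = Q x" "P (Q x) = 0" "Q (P x) = 0" for x
    using PQ(2,3) by (auto simp: P_def[of "P x"] Q_def[of "Q x"] P_def[of "Q x"] Q_def[of "P x"] simp flip: scaleR_2)
  \<comment> \<open>\<open>P\<close> and \<open>Q\<close> project onto the eigenspaces for 1 and -1.
    Exchanging the \<open>Q\<close>-parts of the two coordinates rearranges the signs of the form,
    so that self-polarity reads inner a a' = inner b b'.\<close>
  define \<rho> where "\<rho> = {(a, b). (P a + Q b, P b + Q a) \<in> \<sigma>}"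
  have inn: "inner x y = inner (P x) (P y) + inner (Q x) (Q y)" for x y
    using PQ(1)[of x] PQ(1)[of y] PQ0 by (metis add.right_neutral add.left_neutral inner_add_left inner_add_right)
  have \<rho>_iff: "(a, b) \<in> \<rho>" if "\<And>a' b'. (a', b') \<in> \<rho> \<Longrightarrow> inner a a' = inner b b'" for a b
    unfolding \<rho>_def mem_Collect_eq prod.case
  proof (rule \<sigma>_I)
    fix u' v' assume uv: "(u', v') \<in> \<sigma>"
    then have "(P u' + Q v', P v' + Q u') \<in> \<rho>"
      using PQ(1) by (simp add: \<rho>_def P_lin Q_lin PP)
    from that[OF this] show "inner (P a + Q b) (J u') = inner (P b + Q a) (J v')"
      by (simp add: inn[of a] inn[of b] PQ(4)[of u'] PQ(4)[of v'] inner_add_left inner_diff_right PQ0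
          P_lin Q_lin PP)
  qed
  have \<rho>_norm: "norm b = norm a" if "(a, b) \<in> \<rho>" for a b
  proof -
    have "inner (P a + Q b) (J (P a + Q b)) = inner (P b + Q a) (J (P b + Q a))"
      using that by (intro \<sigma>_D) (auto simp: \<rho>_def)
    then have "inner a a = inner b b"
      by (simp add: inn[of a] inn[of b] PQ(2,3) inner_add_left inner_add_right inner_diff_right PQ0)
    then show ?thesis by (simp add: norm_eq_sqrt_inner)
  qed
  have sub: "subspace \<rho>"
  proof (rule subspaceI)
    show "0 \<in> \<rho>" using subspace_0[OF subspace_\<sigma>] by (simp add: \<rho>_def P_def Q_def zero_prod_def)
    show "x + y \<in> \<rho>" if "x \<in> \<rho>" "y \<in> \<rho>" for x y
      using subspace_add[OF subspace_\<sigma>, of "(P (fst x) + Q (snd x), P (snd x) + Q (fst x))"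
        "(P (fst y) + Q (snd y), P (snd y) + Q (fst y))"] that
      by (cases x; cases y) (simp add: \<rho>_def P_lin Q_lin ac_simps)
    show "r *\<^sub>R x \<in> \<rho>" if "x \<in> \<rho>" for x r
      using subspace_scale[OF subspace_\<sigma>, of "(P (fst x) + Q (snd x), P (snd x) + Q (fst x))" r] that
      by (cases x) (simp add: \<rho>_def P_lin Q_lin scaleR_add_right)
  qed
  have "closed ((\<lambda>p. (P (fst p) + Q (snd p), P (snd p) + Q (fst p))) -` \<sigma>)"
    by (intro continuous_closed_vimage closed_\<sigma> continuous_intros isCont_o2[OF _ cont(1)] isCont_o2[OF _ cont(2)])
  moreover have "(\<lambda>p. (P (fst p) + Q (snd p), P (snd p) + Q (fst p))) -` \<sigma> = \<rho>" by (auto simp: \<rho>_def)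
  ultimately have cl: "closed \<rho>" by simp
  have cl_fst: "closed (fst ` \<rho>)" using closed_fst_isometric_relation[OF sub cl \<rho>_norm] by blast
  obtain a where a: "a \<in> fst ` \<rho>" "\<And>s. s \<in> fst ` \<rho> \<Longrightarrow> inner (p - a) s = 0"
    using hilbert_projection[OF subspace_fst_image[OF sub] cl_fst] by metis
  \<comment> \<open>The residual is orthogonal to the domain of \<open>\<rho>\<close>, so it is
    related to 0; an isometric relation allows this only for the zero vector.\<close>
  have "(p - a, 0) \<in> \<rho>" by (rule \<rho>_iff) (use a(2) in force)
  from \<rho>_norm[OF this] have "p = a" by simp
  then obtain b where b: "(p, b) \<in> \<rho>" using a by force
  \<comment> \<open>Undoing the exchange, \<open>p\<close> is the positive part of the first
    coordinate of an element of \<open>\<sigma>\<close>, and \<open>s\<close> is the negative part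
    that comes with it.\<close>
  define s where "s = Q b"
  have "P p = p" "Q p = 0" using p by (auto simp: P_def Q_def simp flip: scaleR_2)
  then have \<sigma>s: "(p + s, P b) \<in> \<sigma>" using b by (simp add: \<rho>_def s_def)
  have "s \<noteq> 0"
  proof
    assume "s = 0"
    then have "(p, P b) \<in> core" using \<sigma>s p by (intro core_I) (auto simp: PQ(2))
    then show False using p(3)[of p "P b"] p(2) by simp
  qed
  moreover have "J s = - s" by (simp add: s_def PQ(3))
  moreover have "inner u s = 0" if uv: "(u, v) \<in> core" for u v
  proof -
    \<comment> \<open>\<open>core\<close> is invariant under \<open>J\<close>, hence under
      \<open>Q\<close>. Pairing with the element above kills the second coordinate, since
      \<open>P b\<close> is orthogonal to \<open>Q v\<close>.\<close>
    have "(Q u, Q v) \<in> core"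
      using subspace_scale[OF subspace_core subspace_diff[OF subspace_core uv core_J[OF uv]], of "1/2"]
      by (simp add: Q_def)
    from core_inner[OF this \<sigma>s] have "inner (Q u) (p + s) = 0" by (simp add: PQ0)
    moreover have "inner (Q u) p = 0" using PQ0 \<open>P p = p\<close> by metis
    ultimately have "inner (Q u) s = 0" by (simp add: inner_add_right)
    moreover have "inner (P u) s = 0" by (simp add: s_def PQ0)
    ultimately show ?thesis using PQ(1)[of u] by (metis add.right_neutral inner_add_left)
  qed
  ultimately show ?thesis using that by blast
qed

text \<open>The vector n + J n belongs to the eigenvalue 1 unless it vanishes; in that case
  \<open>n\<close> itself belongs to -1, and the sign-reversed form supplies the other
  vector.\<close>

lemma defect_both_signs:
  assumes n: "n \<noteq> 0" "\<And>u v. (u, v) \<in> core \<Longrightarrow> inner u n = 0"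
  obtains e f where "e \<noteq> 0" "J e = e" "\<And>u v. (u, v) \<in> core \<Longrightarrow> inner u e = 0"
    "f \<noteq> 0" "J f = - f" "\<And>u v. (u, v) \<in> core \<Longrightarrow> inner u f = 0"
proof (cases "J n = - n")
  case True
  interpret neg: selfpolar_relation "\<lambda>x. - J x" \<sigma> by (rule selfpolar_uminus)
  have "neg.core = core"
    using subspace_neg[OF subspace_\<sigma>] by (fastforce simp: neg.core_def core_def)
  then obtain s where "s \<noteq> 0" "- J s = - s" "\<And>u v. (u, v) \<in> core \<Longrightarrow> inner u s = 0"
    using neg.defect_opposite_sign[of n] n True by auto
  then show ?thesis using True n that[of s n] by auto
next
  case False
  let ?e = "n + J n"
  have e: "?e \<noteq> 0" using False by (metis add.inverse_unique)
  have Jn: "inner u (J n) = 0" if "(u, v) \<in> core" for u v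
    using n(2)[OF core_J[OF that]] by (simp add: J_sym)
  have *: "J ?e = ?e" "inner u ?e = 0" if "(u, v) \<in> core" for u v
    using n Jn that by (auto simp: inner_add_right)
  obtain s where "s \<noteq> 0" "J s = - s" "\<And>u v. (u, v) \<in> core \<Longrightarrow> inner u s = 0"
    using defect_opposite_sign[of ?e] e n Jn by (auto simp: inner_add_right)
  then show ?thesis using e n Jn that[of ?e s] by (auto simp: inner_add_right add.commute)
qed

end

section \<open>The Cayley transform of a self-adjoint reference extension\<close>

text \<open>A first pair (a, b) is not annihilated by (1, 0), a second one is not annihilated by (b,
  - a). Their determinant is therefore nonzero, and Cramer's rule gives the coefficients.\<close>

lemma complex_pairs_full:
  fixes M :: "(complex \<times> complex) set"
  assumes add: "\<And>a b c d. (a, b) \<in> M \<Longrightarrow> (c, d) \<in> M \<Longrightarrow> (a + c, b + d) \<in> M"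
    and mult: "\<And>z a b. (a, b) \<in> M \<Longrightarrow> (z * a, z * b) \<in> M"
    and ann: "\<And>p q. (\<And>a b. (a, b) \<in> M \<Longrightarrow> a * p + b * q = 0) \<Longrightarrow> p = 0 \<and> q = 0"
  shows "(x, y) \<in> M"
proof -
  obtain a b where ab: "(a, b) \<in> M" "\<not> (a = 0 \<and> b = 0)" using ann[of 1 0] by auto
  obtain c d where cd: "(c, d) \<in> M" "c * b - d * a \<noteq> 0" using ann[of b "- a"] ab(2) by auto
  define D where "D = c * b - d * a"
  have D: "D \<noteq> 0" using cd by (simp add: D_def)
  have "x = (c * y - d * x) / D * a + (b * x - a * y) / D * c"
    "y = (c * y - d * x) / D * b + (b * x - a * y) / D * d"
    using D by (simp_all add: divide_simps) (simp_all add: D_def algebra_simps)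
  then show ?thesis
    using add[OF mult[OF ab(1), of "(c * y - d * x) / D"] mult[OF cd(1), of "(b * x - a * y) / D"]] by simp
qed

text \<open>Orthogonal nonzero vectors of a two-dimensional complement form a basis of it, so
  subtracting the two Fourier terms leaves the projection onto \<open>R\<close>.\<close>

lemma (in cstruct) orthogonal_decomposition:
  assumes R: "subspace R" "closed R" "\<And>x. x \<in> R \<Longrightarrow> I x \<in> R"
    and d: "cdim_eq I {n. \<forall>u\<in>R. inner u n = 0} 2"
    and e: "e \<noteq> 0" "\<And>u. u \<in> R \<Longrightarrow> inner u e = 0" and f: "f \<noteq> 0" "\<And>u. u \<in> R \<Longrightarrow> inner u f = 0"
    and ef: "\<langle>e, f\<rangle> = 0"
  shows "x - (\<langle>x, e\<rangle> / \<langle>e, e\<rangle>) \<odot> e - (\<langle>x, f\<rangle> / \<langle>f, f\<rangle>) \<odot> f \<in> R"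
proof -
  have fe: "\<langle>f, e\<rangle> = 0" using ef cip_eq_0_commute by blast
  obtain p where p: "p \<in> R" "\<And>s. s \<in> R \<Longrightarrow> inner (x - p) s = 0" using hilbert_projection[OF R(1,2)] by metis
  have xp: "x - p \<in> {n. \<forall>u\<in>R. inner u n = 0}" using p(2) by (auto simp: inner_commute)
  have ind: "a = 0 \<and> b = 0" if "a \<odot> e + b \<odot> f = 0" for a b
  proof -
    have "\<langle>a \<odot> e + b \<odot> f, e\<rangle> = 0" "\<langle>a \<odot> e + b \<odot> f, f\<rangle> = 0" using that by auto
    then show ?thesis using e f ef fe by (simp add: cip_simps)
  qed
  obtain a b where ab: "x - p = a \<odot> e + b \<odot> f"
    by (rule cdim_2_basis[OF d _ _ ind xp, of e f]) (use e f in auto)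
  have "\<langle>p, e\<rangle> = 0" "\<langle>p, f\<rangle> = 0"
    using e(2) f(2) p(1) R(3) cip_eq_iff_inner[OF R(3)] by blast+
  moreover have x: "x = p + a \<odot> e + b \<odot> f" using ab by (metis add.assoc diff_eq_eq add.commute)
  ultimately have "\<langle>x, e\<rangle> = a * \<langle>e, e\<rangle>" "\<langle>x, f\<rangle> = b * \<langle>f, f\<rangle>" by (simp_all add: cip_simps ef fe)
  then show ?thesis using p(1) e(1) f(1) x by simp
qed

text \<open>The two dimension assumptions are the deficiency indices. Real orthogonal complements
  express them because \<open>core\<close> is invariant under \<open>I\<close>.\<close>

locale krein = cstruct I + selfpolar_relation J \<sigma>
  for I J :: "'h::{real_inner, complete_space} \<Rightarrow> 'h" and \<sigma> +
  assumes JI: "J (I x) = I (J x)" and I_\<sigma>: "(u, v) \<in> \<sigma> \<Longrightarrow> (I u, I v) \<in> \<sigma>"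
    and defect_fst: "cdim_eq I {n. \<forall>u\<in>fst ` core. inner u n = 0} 2"
    and defect_snd: "cdim_eq I {n. \<forall>v\<in>snd ` core. inner v n = 0} 2"
begin

lemma J_csc[simp]: "J (c \<odot> x) = c \<odot> J x"
  by (simp add: cscale_def JI)

lemma cip_J: "\<langle>J x, y\<rangle> = \<langle>x, J y\<rangle>" and cip_JJ[simp]: "\<langle>J x, J y\<rangle> = \<langle>x, y\<rangle>"
  using J_sym[of x "I y"] by (simp_all add: cinner_def J_sym JI flip: JI)

lemma I_core: "(u, v) \<in> core \<Longrightarrow> (I u, I v) \<in> core"
  using I_\<sigma> by (auto simp: core_def JI)

lemma core_csc: "(u, v) \<in> core \<Longrightarrow> (c \<odot> u, c \<odot> v) \<in> core"
  using subspace_core I_core unfolding cscale_def subspace_relation_iff by blast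

lemma \<sigma>_csc: "(u, v) \<in> \<sigma> \<Longrightarrow> (c \<odot> u, c \<odot> v) \<in> \<sigma>"
  using subspace_\<sigma> I_\<sigma> unfolding cscale_def subspace_relation_iff by blast

lemma \<sigma>_add: "(u, v) \<in> \<sigma> \<Longrightarrow> (u', v') \<in> \<sigma> \<Longrightarrow> (u + u', v + v') \<in> \<sigma>"
  and core_add: "(u, v) \<in> core \<Longrightarrow> (u', v') \<in> core \<Longrightarrow> (u + u', v + v') \<in> core"
  using subspace_\<sigma> subspace_core by (auto simp: subspace_relation_iff)

lemma \<sigma>_diff: "(u, v) \<in> \<sigma> \<Longrightarrow> (u', v') \<in> \<sigma> \<Longrightarrow> (u - u', v - v') \<in> \<sigma>"
  using \<sigma>_add[of u v "(-1) \<odot> u'" "(-1) \<odot> v'"] \<sigma>_csc[of u' v' "-1"] by simp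

lemma core_diff: "(u, v) \<in> core \<Longrightarrow> (u', v') \<in> core \<Longrightarrow> (u - u', v - v') \<in> core"
  using core_add[of u v "(-1) \<odot> u'" "(-1) \<odot> v'"] core_csc[of u' v' "-1"] by simp

lemma core_cip: "(u, v) \<in> core \<Longrightarrow> (u', v') \<in> \<sigma> \<Longrightarrow> \<langle>u, u'\<rangle> = \<langle>v, v'\<rangle>"
  using core_inner[of u v u' v'] core_inner[of u v "I u'" "I v'"] I_\<sigma> by (auto simp: cinner_def)

lemma \<sigma>_cip: "(u, v) \<in> \<sigma> \<Longrightarrow> (u', v') \<in> \<sigma> \<Longrightarrow> \<langle>u, J u'\<rangle> = \<langle>v, J v'\<rangle>"
  using \<sigma>_D[of u v u' v'] \<sigma>_D[of u v "I u'" "I v'"] I_\<sigma> by (auto simp: cinner_def simp flip: JI)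

lemma closed_fst_core: "closed (fst ` core)"
  by (rule closed_fst_isometric_relation[OF subspace_core closed_core core_norm])

text \<open>Statements proved for the first coordinate carry over to the second one through this
  symmetry, which corresponds to exchanging \<i> and -\<i>.\<close>

lemma krein_converse: "krein I J (\<sigma>\<inverse>)" and core_converse: "selfpolar_relation.core J (\<sigma>\<inverse>) = core\<inverse>"
proof -
  interpret c: selfpolar_relation J "\<sigma>\<inverse>" by (rule selfpolar_converse)
  show cc: "c.core = core\<inverse>" by (auto simp: c.core_def core_def)
  have "fst ` core\<inverse> = snd ` core" "snd ` core\<inverse> = fst ` core" by force+
  then show "krein I J (\<sigma>\<inverse>)"
    by unfold_locales (use JI I_\<sigma> defect_fst defect_snd in \<open>simp_all add: cc\<close>)
qed

lemma defect_nontrivial: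
  assumes "cdim_eq I V 2"
  obtains n where "n \<in> V" "n \<noteq> 0"
proof -
  obtain B where B: "B \<subseteq> V" "finite B" "card B = 2" "cindep I B" using assms by (auto simp: cdim_eq_def)
  have "0 \<notin> B"
  proof
    assume "0 \<in> B"
    have "(\<Sum>b\<in>B. (if b = 0 then 1 else 0) \<odot> b) = 0" by (intro sum.neutral) auto
    then show False using B(4) \<open>0 \<in> B\<close> unfolding cindep_def
      by (elim allE[of _ "\<lambda>b. if b = 0 then 1 else 0"]) auto
  qed
  moreover have "B \<noteq> {}" using B(3) by auto
  ultimately show ?thesis using that B(1) by blast
qed

lemma defect_basis_exists:
  obtains e f where "norm e = 1" "J e = e" "\<And>u. u \<in> fst ` core \<Longrightarrow> inner u e = 0"
    "norm f = 1" "J f = - f" "\<And>u. u \<in> fst ` core \<Longrightarrow> inner u f = 0"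
proof -
  obtain n where "n \<in> {n. \<forall>u\<in>fst ` core. inner u n = 0}" "n \<noteq> 0"
    by (rule defect_nontrivial[OF defect_fst])
  then have n: "n \<noteq> 0" "\<And>u v. (u, v) \<in> core \<Longrightarrow> inner u n = 0" by force+
  show thesis
  proof (rule defect_both_signs[OF n(1)])
    show "inner u n = 0" if "(u, v) \<in> core" for u v using n(2) that .
  next
    fix e f assume "e \<noteq> 0" "J e = e" "\<And>u v. (u, v) \<in> core \<Longrightarrow> inner u e = 0"
      "f \<noteq> 0" "J f = - f" "\<And>u v. (u, v) \<in> core \<Longrightarrow> inner u f = 0"
    then show thesis by (intro that[of "e /\<^sub>R norm e" "f /\<^sub>R norm f"]) auto
  qed
qed

end

text \<open>\<open>f\<close> is not normalised: its length is spent later on making all boundary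
  values 1. Its length must agree with that of \<open>f'\<close>, since a unitary extension is to
  map one to the other.\<close>

locale krein_basis = krein +
  fixes e f e' f' :: 'a
  assumes Je: "J e = e" "J e' = e'" and Jf: "J f = - f" "J f' = - f'"
    and norms: "norm e = 1" "norm e' = 1" "f \<noteq> 0" "norm f' = norm f"
    and orth_fst: "u \<in> fst ` core \<Longrightarrow> inner u e = 0" "u \<in> fst ` core \<Longrightarrow> inner u f = 0"
    and orth_snd: "v \<in> snd ` core \<Longrightarrow> inner v e' = 0" "v \<in> snd ` core \<Longrightarrow> inner v f' = 0"
begin

lemma krein_basis_converse: "krein_basis I J (\<sigma>\<inverse>) e' f' e f"
proof -
  interpret c: krein I J "\<sigma>\<inverse>" by (rule krein_converse)
  have im: "fst ` core\<inverse> = snd ` core" "snd ` core\<inverse> = fst ` core" by force+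
  show ?thesis
    by unfold_locales (use Je Jf norms orth_fst orth_snd in \<open>auto simp: core_converse im simp del: image_iff\<close>)
qed

lemma cip_core: assumes "(r, s) \<in> core"
  shows "\<langle>r, e\<rangle> = 0" "\<langle>r, f\<rangle> = 0" "\<langle>s, e'\<rangle> = 0" "\<langle>s, f'\<rangle> = 0"
proof -
  have "r \<in> fst ` core" "I r \<in> fst ` core" "s \<in> snd ` core" "I s \<in> snd ` core"
    using assms I_core[OF assms] by force+
  then show "\<langle>r, e\<rangle> = 0" "\<langle>r, f\<rangle> = 0" "\<langle>s, e'\<rangle> = 0" "\<langle>s, f'\<rangle> = 0"
    using orth_fst[of r] orth_fst[of "I r"] orth_snd[of s] orth_snd[of "I s"]
    by (auto simp: cinner_def complex_eq_iff inner_I_left)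
qed

definition n where "n = \<langle>f, f\<rangle>"

lemma n: "n \<noteq> 0" "cnj n = n" "\<langle>f, f\<rangle> = n" "\<langle>f', f'\<rangle> = n" "\<langle>e, e\<rangle> = 1" "\<langle>e', e'\<rangle> = 1"
  using norms by (auto simp: n_def cip_self)

lemma ef: "\<langle>e, f\<rangle> = 0" "\<langle>f, e\<rangle> = 0" "\<langle>e', f'\<rangle> = 0" "\<langle>f', e'\<rangle> = 0"
proof -
  show "\<langle>e, f\<rangle> = 0" "\<langle>e', f'\<rangle> = 0"
    using cip_J[of e f] cip_J[of e' f'] Je Jf by (auto simp: cip_minus_right)
  then show "\<langle>f, e\<rangle> = 0" "\<langle>f', e'\<rangle> = 0" using cip_eq_0_commute by blast+
qed

text \<open>\<open>r\<close> and \<open>r'\<close> are the orthogonal projections onto the first and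
  the second coordinates of \<open>core\<close>; \<open>n\<close> is the squared norm of
  \<open>f\<close>, kept as a complex number for division.\<close>

definition r where "r x = x - \<langle>x, e\<rangle> \<odot> e - (\<langle>x, f\<rangle> / n) \<odot> f"
definition r' where "r' x = x - \<langle>x, e'\<rangle> \<odot> e' - (\<langle>x, f'\<rangle> / n) \<odot> f'"

lemma r_fst: "r x \<in> fst ` core"
  using orthogonal_decomposition[OF subspace_fst_image[OF subspace_core] closed_fst_core _ defect_fst, of e f x]
    I_core orth_fst norms ef n by (force simp: r_def)

lemma r'_snd: "r' x \<in> snd ` core"
proof -
  interpret c: krein_basis I J "\<sigma>\<inverse>" e' f' e f by (rule krein_basis_converse)
  have "c.r x = r' x" using n unfolding c.r_def r'_def c.n_def by simp
  moreover have "fst ` c.core = snd ` core" unfolding core_converse by force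
  ultimately show ?thesis using c.r_fst[of x] by metis
qed

lemma cip_r: "\<langle>r x, e\<rangle> = 0" "\<langle>r x, f\<rangle> = 0" "\<langle>r' x, e'\<rangle> = 0" "\<langle>r' x, f'\<rangle> = 0"
  using n ef by (auto simp: r_def r'_def cip_simps)

text \<open>Take elements of \<open>core\<close> with first coordinate \<open>r u\<close> and with
  second coordinate \<open>r' v\<close>. Their difference lies in \<open>core\<close>, so it can be
  paired both with (u, v) and with the former element; the two pairings show that its second
  coordinate has norm 0.\<close>

lemma \<sigma>_decomposition: assumes "(u, v) \<in> \<sigma>" shows "(r u, r' v) \<in> core"
proof -
  obtain s where s: "(r u, s) \<in> core" using r_fst by force
  obtain q where q: "(q, r' v) \<in> core" using r'_snd by force
  have d: "(q - r u, r' v - s) \<in> core" using s q core_diff by blast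
  have "\<langle>r' v - s, s\<rangle> = \<langle>q - r u, r u\<rangle>" using core_cip[OF d] s core_D by metis
  also have "\<dots> = \<langle>q - r u, u\<rangle>" using cip_core[OF d] by (simp add: r_def[of u] cip_simps)
  also have "\<dots> = \<langle>r' v - s, v\<rangle>" using core_cip[OF d assms] .
  also have "\<dots> = \<langle>r' v - s, r' v\<rangle>" using cip_core[OF d] by (simp add: r'_def[of v] cip_simps)
  finally have "\<langle>r' v - s, r' v - s\<rangle> = 0" by (simp add: cip_diff_right)
  then show ?thesis using s by simp
qed

text \<open>An abstract Green identity: splitting off the part in \<open>core\<close> leaves a form
  in the boundary values only. The minus signs come from \<open>f\<close> and \<open>f'\<close>
  belonging to the eigenvalue -1.\<close>

lemma \<sigma>_form:
  assumes 1: "(u, v) \<in> \<sigma>" and 2: "(u2, v2) \<in> \<sigma>"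
  shows "\<langle>u, e\<rangle> * cnj \<langle>u2, e\<rangle> - \<langle>u, f\<rangle> / n * cnj \<langle>u2, f\<rangle> = \<langle>v, e'\<rangle> * cnj \<langle>v2, e'\<rangle> - \<langle>v, f'\<rangle> / n * cnj \<langle>v2, f'\<rangle>"
proof -
  have "\<langle>J (r u), u2\<rangle> = \<langle>J (r' v), v2\<rangle>" using core_cip[OF core_J[OF \<sigma>_decomposition[OF 1]] 2] .
  then have "\<langle>r u, J u2\<rangle> = \<langle>r' v, J v2\<rangle>" by (simp add: cip_J)
  moreover have "\<langle>u, J u2\<rangle> = \<langle>v, J v2\<rangle>" using \<sigma>_cip[OF 1 2] .
  moreover have "\<langle>e, J u2\<rangle> = cnj \<langle>u2, e\<rangle>" "\<langle>e', J v2\<rangle> = cnj \<langle>v2, e'\<rangle>"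
    "\<langle>f, J u2\<rangle> = - cnj \<langle>u2, f\<rangle>" "\<langle>f', J v2\<rangle> = - cnj \<langle>v2, f'\<rangle>"
    by (simp_all add: cnj_cip Je Jf cip_minus_left flip: cip_J)
  ultimately have "\<langle>u, f\<rangle> / n * cnj \<langle>u2, f\<rangle> - \<langle>u, e\<rangle> * cnj \<langle>u2, e\<rangle> = \<langle>v, f'\<rangle> / n * cnj \<langle>v2, f'\<rangle> - \<langle>v, e'\<rangle> * cnj \<langle>v2, e'\<rangle>"
    by (simp add: r_def r'_def cip_simps)
  then show ?thesis by (metis minus_diff_eq)
qed

text \<open>Such a pair consists of eigenvectors of \<open>J\<close> for one eigenvalue, hence it
  lies in \<open>core\<close>; but it is also orthogonal to \<open>core\<close> in each
  coordinate.\<close>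

lemma core_fixed_e: "(a \<odot> e, b \<odot> e') \<in> \<sigma> \<Longrightarrow> a = 0 \<and> b = 0"
  and core_fixed_f: "(a \<odot> f, b \<odot> f') \<in> \<sigma> \<Longrightarrow> a = 0 \<and> b = 0"
proof -
  assume "(a \<odot> e, b \<odot> e') \<in> \<sigma>"
  then have "(a \<odot> e, b \<odot> e') \<in> core" by (intro core_I) (auto simp: Je)
  from cip_core[OF this] show "a = 0 \<and> b = 0" using n by (simp add: cip_csc_left)
next
  assume *: "(a \<odot> f, b \<odot> f') \<in> \<sigma>"
  then have "(a \<odot> f, b \<odot> f') \<in> core" using \<sigma>_csc[OF *, of "-1"]
    by (intro core_I) (auto simp: Jf)
  from cip_core[OF this] show "a = 0 \<and> b = 0" using n by (simp add: cip_csc_left)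
qed

lemma boundary_values_onto: "\<exists>u v. (u, v) \<in> \<sigma> \<and> \<langle>u, e\<rangle> = a \<and> \<langle>v, e'\<rangle> = b"
proof -
  have "(a, b) \<in> (\<lambda>(u, v). (\<langle>u, e\<rangle>, \<langle>v, e'\<rangle>)) ` \<sigma>"
  proof (rule complex_pairs_full)
    fix a b c d assume "(a, b) \<in> (\<lambda>(u, v). (\<langle>u, e\<rangle>, \<langle>v, e'\<rangle>)) ` \<sigma>" "(c, d) \<in> (\<lambda>(u, v). (\<langle>u, e\<rangle>, \<langle>v, e'\<rangle>)) ` \<sigma>"
    then show "(a + c, b + d) \<in> (\<lambda>(u, v). (\<langle>u, e\<rangle>, \<langle>v, e'\<rangle>)) ` \<sigma>"
      using \<sigma>_add by (auto simp: image_iff cip_add_left Bex_def) (metis cip_add_left)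
  next
    fix z a b assume "(a, b) \<in> (\<lambda>(u, v). (\<langle>u, e\<rangle>, \<langle>v, e'\<rangle>)) ` \<sigma>"
    then show "(z * a, z * b) \<in> (\<lambda>(u, v). (\<langle>u, e\<rangle>, \<langle>v, e'\<rangle>)) ` \<sigma>"
      using \<sigma>_csc by (auto simp: image_iff Bex_def) (metis cip_csc_left)
  next
    fix p q assume pq: "\<And>a b. (a, b) \<in> (\<lambda>(u, v). (\<langle>u, e\<rangle>, \<langle>v, e'\<rangle>)) ` \<sigma> \<Longrightarrow> a * p + b * q = 0"
    \<comment> \<open>An annihilator of all boundary values is a pair polar to
      \<open>\<sigma>\<close>, so it belongs to \<open>\<sigma>\<close> and vanishes by
      \<open>core_fixed_e\<close>.\<close>
    have "(cnj p \<odot> e, (- cnj q) \<odot> e') \<in> \<sigma>"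
    proof (rule \<sigma>_I)
      fix u v assume "(u, v) \<in> \<sigma>"
      then have "\<langle>u, e\<rangle> * p + \<langle>v, e'\<rangle> * q = 0" by (intro pq) force
      then have "\<langle>u, cnj p \<odot> e\<rangle> = \<langle>v, (- cnj q) \<odot> e'\<rangle>"
        by (simp add: cip_csc_right cip_minus_right eq_neg_iff_add_eq_0 mult.commute)
      then have "inner u (cnj p \<odot> e) = inner v ((- cnj q) \<odot> e')" by (metis Re_cip)
      then show "inner (cnj p \<odot> e) (J u) = inner ((- cnj q) \<odot> e') (J v)"
        by (simp add: Je flip: J_sym) (simp add: inner_commute)
    qed
    then show "p = 0 \<and> q = 0" using core_fixed_e by fastforce
  qed
  then show ?thesis by force
qed

text \<open>The moduli agree by the Green identity of the pair with itself. If the value at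
  \<open>f\<close> vanished, subtracting the part in \<open>core\<close> would leave (e, e') in
  \<open>\<sigma>\<close>.\<close>

lemma boundary_values_11:
  assumes h: "(h, k) \<in> \<sigma>" "\<langle>h, e\<rangle> = 1" "\<langle>k, e'\<rangle> = 1"
  shows "cmod \<langle>h, f\<rangle> = cmod \<langle>k, f'\<rangle>" "\<langle>h, f\<rangle> \<noteq> 0"
proof -
  have "\<langle>h, f\<rangle> / n * cnj \<langle>h, f\<rangle> = \<langle>k, f'\<rangle> / n * cnj \<langle>k, f'\<rangle>"
    using \<sigma>_form[OF h(1,1)] h by simp
  then have "(of_real ((cmod \<langle>h, f\<rangle>)\<^sup>2) :: complex) = of_real ((cmod \<langle>k, f'\<rangle>)\<^sup>2)"
    using n by (simp add: complex_norm_square del: of_real_power)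
  then show eq: "cmod \<langle>h, f\<rangle> = cmod \<langle>k, f'\<rangle>" by (metis of_real_eq_iff norm_ge_zero power2_eq_iff_nonneg)
  show "\<langle>h, f\<rangle> \<noteq> 0"
  proof
    assume "\<langle>h, f\<rangle> = 0"
    then have "(h - e, k - e') \<in> core" using \<sigma>_decomposition[OF h(1)] h eq by (simp add: r_def r'_def)
    from \<sigma>_diff[OF h(1) core_D[OF this]] show False using core_fixed_e[of 1 1] by simp
  qed
qed

end

locale cunitary = cstruct I for I :: "'h::{real_inner, complete_space} \<Rightarrow> 'h" +
  fixes W :: "'h \<Rightarrow> 'h"
  assumes W_add[simp]: "W (x + y) = W x + W y" and W_csc[simp]: "W (c \<odot> x) = c \<odot> W x"
    and cip_W[simp]: "\<langle>W x, W y\<rangle> = \<langle>x, y\<rangle>" and surj_W: "surj W"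

lemma (in cstruct) norm_csc: "norm (c \<odot> x) = cmod c * norm x"
proof -
  have "complex_of_real ((norm (c \<odot> x))\<^sup>2) = c * cnj c * complex_of_real ((norm x)\<^sup>2)"
    by (simp only: cip_csc_left cip_csc_right ac_simps flip: cip_self)
  also have "\<dots> = complex_of_real ((cmod c * norm x)\<^sup>2)"
    by (simp only: power_mult_distrib of_real_mult complex_norm_square)
  finally have "(norm (c \<odot> x))\<^sup>2 = (cmod c * norm x)\<^sup>2" by (simp only: of_real_eq_iff)
  then show ?thesis by (simp add: power2_eq_iff_nonneg)
qed

section \<open>The unitary extension of \<open>core\<close> and the boundary condition of
  \<open>\<sigma>\<close>\<close>

context krein_basis
begin

text \<open>The graph of the extension, obtained by matching boundary values. A relation treats both
  coordinates alike, so totality and surjectivity have parallel proofs before \<open>W\<close> is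
  extracted.\<close>

definition w where "w = {(u, v). (r u, r' v) \<in> core \<and> \<langle>u, e\<rangle> = \<langle>v, e'\<rangle> \<and> \<langle>u, f\<rangle> = \<langle>v, f'\<rangle>}"

lemma r_add: "r (x + y) = r x + r y" "r' (x + y) = r' x + r' y"
  and r_csc: "r (c \<odot> x) = c \<odot> r x" "r' (c \<odot> x) = c \<odot> r' x"
  and r_J: "r (J x) = J (r x)" "r' (J x) = J (r' x)"
  by (simp_all add: r_def r'_def cip_simps cip_J Je Jf add_divide_distrib vs.scale_left_distrib vs.scale_right_distrib
      vs.scale_right_diff_distrib)

lemma core_r: "(u, v) \<in> core \<Longrightarrow> r u = u" "(u, v) \<in> core \<Longrightarrow> r' v = v"
  using cip_core[of u v] by (auto simp: r_def r'_def)

lemma w_add: "(u, v) \<in> w \<Longrightarrow> (u2, v2) \<in> w \<Longrightarrow> (u + u2, v + v2) \<in> w"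
  and w_csc: "(u, v) \<in> w \<Longrightarrow> (c \<odot> u, c \<odot> v) \<in> w"
  and w_J: "(u, v) \<in> w \<Longrightarrow> (J u, J v) \<in> w"
  and w_ef: "(e, e') \<in> w" "(f, f') \<in> w"
  using subspace_0[OF subspace_core]
  by (auto simp: w_def r_add r_csc r_J core_add core_csc core_J cip_add_left cip_csc_left cip_J Je Jf cip_minus_right
      n ef, auto simp: r_def r'_def n ef zero_prod_def)

lemma w_core: "(u, v) \<in> core \<longleftrightarrow> (u, v) \<in> w \<and> \<langle>u, e\<rangle> = 0 \<and> \<langle>u, f\<rangle> = 0"
  using cip_core[of u v] core_r[of u v] by (auto simp: w_def) (auto simp: r_def r'_def)

lemma w_cip: assumes "(u, v) \<in> w" "(u2, v2) \<in> w" shows "\<langle>u, u2\<rangle> = \<langle>v, v2\<rangle>"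
proof -
  have "\<langle>r u, r u2\<rangle> = \<langle>r' v, r' v2\<rangle>" using assms core_cip core_D by (auto simp: w_def)
  then have "\<langle>r u, u2\<rangle> = \<langle>r' v, v2\<rangle>" by (simp add: r_def[of u2] r'_def[of v2] cip_diff_right cip_csc_right cip_r)
  moreover have "\<langle>e, u2\<rangle> = \<langle>e', v2\<rangle>" "\<langle>f, u2\<rangle> = \<langle>f', v2\<rangle>" "\<langle>u, e\<rangle> = \<langle>v, e'\<rangle>" "\<langle>u, f\<rangle> = \<langle>v, f'\<rangle>"
    using assms by (auto simp: w_def simp flip: cnj_cip[of u2] cnj_cip[of v2])
  ultimately show ?thesis by (simp add: r_def r'_def cip_diff_left cip_csc_left)
qed

lemma w_total: "\<exists>v. (u, v) \<in> w"
proof -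
  obtain s where s: "(r u, s) \<in> core" using r_fst by force
  have "(r u + (\<langle>u, e\<rangle> \<odot> e + (\<langle>u, f\<rangle> / n) \<odot> f), s + (\<langle>u, e\<rangle> \<odot> e' + (\<langle>u, f\<rangle> / n) \<odot> f')) \<in> w"
    using s w_core by (intro w_add w_csc w_ef) blast
  moreover have "r u + (\<langle>u, e\<rangle> \<odot> e + (\<langle>u, f\<rangle> / n) \<odot> f) = u" by (simp add: r_def)
  ultimately show ?thesis by auto
qed

lemma w_onto: "\<exists>u. (u, v) \<in> w"
proof -
  obtain s where s: "(s, r' v) \<in> core" using r'_snd by force
  have "(s + (\<langle>v, e'\<rangle> \<odot> e + (\<langle>v, f'\<rangle> / n) \<odot> f), r' v + (\<langle>v, e'\<rangle> \<odot> e' + (\<langle>v, f'\<rangle> / n) \<odot> f')) \<in> w"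
    using s w_core by (intro w_add w_csc w_ef) blast
  moreover have "r' v + (\<langle>v, e'\<rangle> \<odot> e' + (\<langle>v, f'\<rangle> / n) \<odot> f') = v" by (simp add: r'_def)
  ultimately show ?thesis by auto
qed

lemma w_unique: assumes "(u, v) \<in> w" "(u, v2) \<in> w" shows "v = v2"
proof -
  have "(u + (-1) \<odot> u, v + (-1) \<odot> v2) \<in> w" using assms by (intro w_add w_csc)
  from w_cip[OF this this] show ?thesis by simp
qed

definition W where "W u = (THE v. (u, v) \<in> w)"

lemma W_iff: "(u, v) \<in> w \<longleftrightarrow> v = W u"
proof -
  have "(u, W u) \<in> w" unfolding W_def using w_total w_unique by (metis theI)
  then show ?thesis using w_unique by blast
qed

lemma cunitary_W: "cunitary I W"
proof unfold_locales
  show "W (x + y) = W x + W y" "W (c \<odot> x) = c \<odot> W x" for x y c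
    using w_add[of x "W x" y "W y"] w_csc[of x "W x" c] by (simp_all add: W_iff)
  show "\<langle>W x, W y\<rangle> = \<langle>x, y\<rangle>" for x y using w_cip[of x "W x" y "W y"] by (simp add: W_iff)
  show "surj W" using w_onto W_iff by (metis surjI)
qed

sublocale cunitary I W by (rule cunitary_W)

lemma W_J: "W (J x) = J (W x)" and W_e: "W e = e'" and W_f: "W f = f'"
  using w_J[of x "W x"] w_ef by (simp_all add: W_iff)

lemma core_iff: "(u, v) \<in> core \<longleftrightarrow> v = W u \<and> \<langle>u, e\<rangle> = 0 \<and> \<langle>u, f\<rangle> = 0"
  by (simp add: w_core W_iff)

text \<open>By \<open>\<sigma>_decomposition\<close>, \<open>W\<close> maps \<open>r u\<close> to
  \<open>r' v\<close>; comparing the coefficients at \<open>e'\<close> and \<open>f'\<close> gives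
  the correction of the argument.\<close>

lemma \<sigma>_W:
  assumes "(u, v) \<in> \<sigma>"
  shows "v = W (u + (\<langle>v, e'\<rangle> - \<langle>u, e\<rangle>) \<odot> e + ((\<langle>v, f'\<rangle> - \<langle>u, f\<rangle>) / n) \<odot> f)" (is "v = W (u + ?a \<odot> e + ?b \<odot> f)")
proof -
  have "r' v = W (r u)" using \<sigma>_decomposition[OF assms] core_iff by blast
  moreover have "u + ?a \<odot> e + ?b \<odot> f = r u + \<langle>v, e'\<rangle> \<odot> e + (\<langle>v, f'\<rangle> / n) \<odot> f"
    by (simp add: r_def vs.scale_left_diff_distrib diff_divide_distrib)
  moreover have "v = r' v + \<langle>v, e'\<rangle> \<odot> e' + (\<langle>v, f'\<rangle> / n) \<odot> f'" by (simp add: r'_def)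
  ultimately show ?thesis by (simp add: W_e W_f)
qed

text \<open>When both values at \<open>e\<close> and \<open>e'\<close> vanish, what remains modulo
  \<open>core\<close> is a pair of multiples of \<open>f\<close> and \<open>f'\<close>, which
  \<open>core_fixed_f\<close> forces to be zero.\<close>

lemma \<sigma>_zero_values: assumes "(u, v) \<in> \<sigma>" "\<langle>u, e\<rangle> = 0" "\<langle>v, e'\<rangle> = 0" shows "(u, v) \<in> core"
proof -
  have rc: "(r u, r' v) \<in> core" using \<sigma>_decomposition[OF assms(1)] .
  have "(u - r u, v - r' v) \<in> \<sigma>" using \<sigma>_diff[OF assms(1) core_D[OF rc]] .
  then have "((\<langle>u, f\<rangle> / n) \<odot> f, (\<langle>v, f'\<rangle> / n) \<odot> f') \<in> \<sigma>" using assms by (simp add: r_def r'_def)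
  then show ?thesis using core_fixed_f n rc assms by (fastforce simp: r_def r'_def)
qed

text \<open>Modulo \<open>core\<close>, the relation is spanned by (h, k) and one more pair. The
  jump from the value at \<open>e\<close> to the value at \<open>e'\<close> and the mean of both
  serve as coordinates, and the form leaves a single real number undetermined.\<close>

lemma \<sigma>_characterization:
  assumes h: "(h, k) \<in> \<sigma>" "\<langle>h, e\<rangle> = 1" "\<langle>k, e'\<rangle> = 1" "\<langle>h, f\<rangle> = 1" "\<langle>k, f'\<rangle> = 1"
  obtains C :: real where "\<And>u v. (u, v) \<in> \<sigma> \<longleftrightarrow>
    (\<exists>x c. u = x - (c / 2) \<odot> (e + f) \<and> v = W (x + (c / 2) \<odot> (e + f)) \<and> \<langle>x, f\<rangle> - \<langle>x, e\<rangle> = \<i> * of_real C * c)"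
proof -
  have ab: "\<langle>u, e\<rangle> - \<langle>u, f\<rangle> / n = \<langle>v, e'\<rangle> - \<langle>v, f'\<rangle> / n" if "(u, v) \<in> \<sigma>" for u v
    using \<sigma>_form[OF that h(1)] h by simp
  \<comment> \<open>With opposite values the midpoint p + (e + f) / 2 is orthogonal to
    \<open>e\<close>, which produces the symmetric parametrisation.\<close>
  obtain p q where p: "(p, q) \<in> \<sigma>" "\<langle>p, e\<rangle> = - 1 / 2" "\<langle>q, e'\<rangle> = 1 / 2"
    using boundary_values_onto by blast
  define z where "z = \<langle>p, f\<rangle>"
  have "2 * \<langle>q, f'\<rangle> = 2 * (z + n)" using ab[OF p(1)] p n by (simp add: z_def field_simps)
  then have z: "\<langle>q, f'\<rangle> = z + n" by (simp only: mult_cancel_left) simp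
  \<comment> \<open>The form of (p, q) with itself fixes the real part of \<open>z\<close> as - n /
    2; the imaginary part is the free constant.\<close>
  have "z / n * cnj z = (z + n) / n * cnj (z + n)"
    using \<sigma>_form[OF p(1,1)] p z by (simp add: z_def)
  then have "z * cnj z = (z + n) * cnj (z + n)" using n by simp
  then have "(z + cnj z + n) * n = 0" using n by (simp add: algebra_simps)
  then have zn: "z + cnj z + n = 0" using n by simp
  have "Im n = 0" using n(2) by (simp add: complex_eq_iff)
  then have zC: "z = - n / 2 + \<i> * of_real (Im z)" using zn by (simp add: complex_eq_iff)
  have qW: "q = W (p + e + f)" using \<sigma>_W[OF p(1)] p z n by (simp add: z_def)
  have kW: "k = W h" using \<sigma>_W[OF h(1)] h by simp
  have main: "(u, v) \<in> \<sigma> \<longleftrightarrow> (\<exists>c. v = W (u + c \<odot> (e + f)) \<and> \<langle>u, f\<rangle> = \<langle>u, e\<rangle> + c / 2 + c * z)" for u v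
  proof
    assume uv: "(u, v) \<in> \<sigma>"
    define c where "c = \<langle>v, e'\<rangle> - \<langle>u, e\<rangle>"
    have b: "\<langle>v, f'\<rangle> - \<langle>u, f\<rangle> = c * n" using ab[OF uv] n by (simp add: c_def field_simps)
    have vW: "v = W (u + c \<odot> (e + f))"
      using \<sigma>_W[OF uv] b n by (simp add: c_def[symmetric] vs.scale_right_distrib add.assoc)
    \<comment> \<open>As \<open>c\<close> is the jump, this is the mean of the values at
      \<open>e\<close> and \<open>e'\<close>, hence the coefficient of (h, k).\<close>
    define t where "t = \<langle>u, e\<rangle> + c / 2"
    have "(u - t \<odot> h - c \<odot> p, v - t \<odot> k - c \<odot> q) \<in> \<sigma>"
      using uv h p by (intro \<sigma>_diff \<sigma>_csc)
    then have "(u - t \<odot> h - c \<odot> p, v - t \<odot> k - c \<odot> q) \<in> core"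
    proof (rule \<sigma>_zero_values)
      show "\<langle>u - t \<odot> h - c \<odot> p, e\<rangle> = 0" by (simp only: cip_simps h p) (simp add: t_def)
      show "\<langle>v - t \<odot> k - c \<odot> q, e'\<rangle> = 0"
        by (simp only: cip_simps h p) (simp add: t_def c_def field_simps)
    qed
    from cip_core(2)[OF this] have "\<langle>u, f\<rangle> = t + c * z" using h by (simp add: cip_simps z_def diff_eq_eq add.commute)
    then show "\<exists>c. v = W (u + c \<odot> (e + f)) \<and> \<langle>u, f\<rangle> = \<langle>u, e\<rangle> + c / 2 + c * z"
      using vW by (auto simp: t_def)
  next
    assume "\<exists>c. v = W (u + c \<odot> (e + f)) \<and> \<langle>u, f\<rangle> = \<langle>u, e\<rangle> + c / 2 + c * z"
    then obtain c where c: "v = W (u + c \<odot> (e + f))" "\<langle>u, f\<rangle> = \<langle>u, e\<rangle> + c / 2 + c * z" by blast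
    define t where "t = \<langle>u, e\<rangle> + c / 2"
    define u0 where "u0 = u - t \<odot> h - c \<odot> p"
    have u: "u = u0 + (t \<odot> h + c \<odot> p)" by (simp add: u0_def)
    have "\<langle>u0, e\<rangle> = 0" "\<langle>u0, f\<rangle> = 0"
      using h p c by (auto simp: u0_def t_def cip_simps z_def[symmetric] algebra_simps)
    then have "(u0, W u0) \<in> \<sigma>" using core_iff core_D by blast
    then have "(u0 + (t \<odot> h + c \<odot> p), W u0 + (t \<odot> k + c \<odot> q)) \<in> \<sigma>"
      using h p by (intro \<sigma>_add \<sigma>_csc)
    moreover have "W u0 + (t \<odot> k + c \<odot> q) = v"
      unfolding c(1) kW qW by (simp add: u vs.scale_right_distrib)
    ultimately show "(u, v) \<in> \<sigma>" using u by simp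
  qed
  show ?thesis
  \<comment> \<open>Passing to the midpoint x = u + (c / 2) \<odot> (e + f) cancels the real part of
    \<open>z\<close>.\<close>
  proof (rule that[of "Im z"])
    fix u v
    have eq: "\<langle>u, f\<rangle> = \<langle>u, e\<rangle> + c / 2 + c * z \<longleftrightarrow> \<langle>x, f\<rangle> - \<langle>x, e\<rangle> = \<i> * of_real (Im z) * c"
      if "x = u + (c / 2) \<odot> (e + f)" for x c
      unfolding that by (subst zC) (auto simp: cip_simps n ef field_simps)
    have half: "x + (c / 2) \<odot> y + (c / 2) \<odot> y = x + c \<odot> y" for x y c
      by (simp add: add.assoc flip: vs.scale_left_distrib)
    show "(u, v) \<in> \<sigma> \<longleftrightarrow> (\<exists>x c. u = x - (c / 2) \<odot> (e + f) \<and> v = W (x + (c / 2) \<odot> (e + f))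
      \<and> \<langle>x, f\<rangle> - \<langle>x, e\<rangle> = \<i> * of_real (Im z) * c)" (is "_ \<longleftrightarrow> ?R")
    proof
      assume "(u, v) \<in> \<sigma>"
      then obtain c where "v = W (u + c \<odot> (e + f))" "\<langle>u, f\<rangle> = \<langle>u, e\<rangle> + c / 2 + c * z" using main by blast
      then show ?R using eq[OF refl] half
        by (intro exI[of _ "u + (c / 2) \<odot> (e + f)"] exI[of _ c]) (simp only: add_diff_cancel)
    next
      assume ?R
      then obtain x c where x: "u = x - (c / 2) \<odot> (e + f)" "v = W (x + (c / 2) \<odot> (e + f))"
        "\<langle>x, f\<rangle> - \<langle>x, e\<rangle> = \<i> * of_real (Im z) * c" by blast
      have "x = u + (c / 2) \<odot> (e + f)" using x(1) by simp
      then show "(u, v) \<in> \<sigma>" using eq x(2,3) half unfolding main by metis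
    qed
  qed
qed

end

text \<open>There are two passes: unit vectors yield the pair (h, k), then \<open>f\<close> and
  \<open>f'\<close> are rescaled so that all its values become 1, and \<open>W\<close> is built from
  the rescaled basis.\<close>

lemma (in krein) reference_extension:
  obtains W e f and C :: real where "cunitary I W" "e \<noteq> 0" "f \<noteq> 0" "J e = e" "J f = - f" "\<And>x. W (J x) = J (W x)"
    "\<And>u v. (u, v) \<in> core \<longleftrightarrow> v = W u \<and> \<langle>u, e\<rangle> = 0 \<and> \<langle>u, f\<rangle> = 0"
    "\<And>u v. (u, v) \<in> \<sigma> \<longleftrightarrow>
    (\<exists>x c. u = x - (c / 2) \<odot> (e + f) \<and> v = W (x + (c / 2) \<odot> (e + f)) \<and> \<langle>x, f\<rangle> - \<langle>x, e\<rangle> = \<i> * of_real C * c)"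
proof -
  obtain e f where ef: "norm e = 1" "J e = e" "\<And>u. u \<in> fst ` core \<Longrightarrow> inner u e = 0"
    "norm f = 1" "J f = - f" "\<And>u. u \<in> fst ` core \<Longrightarrow> inner u f = 0" using defect_basis_exists by metis
  interpret c: krein I J "\<sigma>\<inverse>" by (rule krein_converse)
  have "fst ` c.core = snd ` core" unfolding core_converse by force
  then obtain e' f' where ef': "norm e' = 1" "J e' = e'" "\<And>u. u \<in> snd ` core \<Longrightarrow> inner u e' = 0"
    "norm f' = 1" "J f' = - f'" "\<And>u. u \<in> snd ` core \<Longrightarrow> inner u f' = 0" using c.defect_basis_exists by metis
  interpret b0: krein_basis I J \<sigma> e f e' f'
  proof unfold_locales
    show "f \<noteq> 0" "norm f' = norm f" using ef(4) ef'(4) by auto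
  qed (fact ef ef')+
  obtain h k where h: "(h, k) \<in> \<sigma>" "\<langle>h, e\<rangle> = 1" "\<langle>k, e'\<rangle> = 1" using b0.boundary_values_onto by blast
  \<comment> \<open>The conjugate compensates conjugate linearity in the second argument. Equal
    moduli of the two values keep the rescaled lengths equal.\<close>
  define p where "p = 1 / cnj \<langle>h, f\<rangle>"
  define q where "q = 1 / cnj \<langle>k, f'\<rangle>"
  have *: "cmod \<langle>h, f\<rangle> = cmod \<langle>k, f'\<rangle>" "\<langle>h, f\<rangle> \<noteq> 0" using b0.boundary_values_11[OF h] by auto
  have pq: "cmod p = cmod q" "p \<noteq> 0" "q \<noteq> 0" using * by (auto simp: p_def q_def norm_divide)
  have orth: "inner u (c \<odot> x) = 0" if "\<And>u. u \<in> M \<Longrightarrow> inner u x = 0" "u \<in> M" "\<And>u. u \<in> M \<Longrightarrow> I u \<in> M" for u c x M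
    using that(1)[of u] that(1)[of "I u"] that(2,3) inner_I_left[of u x]
    by (auto simp: cscale_def inner_add_right)
  interpret b: krein_basis I J \<sigma> e "p \<odot> f" e' "q \<odot> f'"
  proof unfold_locales
    show "J (p \<odot> f) = - (p \<odot> f)" "J (q \<odot> f') = - (q \<odot> f')" "norm (q \<odot> f') = norm (p \<odot> f)" "p \<odot> f \<noteq> 0"
      using ef(4,5) ef'(4,5) pq by (auto simp: norm_csc)
    show "inner u (p \<odot> f) = 0" if "u \<in> fst ` core" for u
      by (rule orth[OF ef(6) that]) (use I_core in force)+
    show "inner u (q \<odot> f') = 0" if "u \<in> snd ` core" for u
      by (rule orth[OF ef'(6) that]) (use I_core in force)+
  qed (use ef(1-3) ef'(1-3) in auto)
  have "\<langle>h, p \<odot> f\<rangle> = 1" "\<langle>k, q \<odot> f'\<rangle> = 1" using * by (auto simp: cip_csc_right p_def q_def)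
  then obtain C :: real where C: "\<And>u v. (u, v) \<in> \<sigma> \<longleftrightarrow>
    (\<exists>x c. u = x - (c / 2) \<odot> (e + p \<odot> f) \<and> v = b.W (x + (c / 2) \<odot> (e + p \<odot> f))
      \<and> \<langle>x, p \<odot> f\<rangle> - \<langle>x, e\<rangle> = \<i> * of_real C * c)"
    using b.\<sigma>_characterization[OF h] by metis
  show thesis
  proof (rule that[of b.W e "p \<odot> f" C])
    show "cunitary I b.W" by (rule b.cunitary_W)
    show "e \<noteq> 0" "p \<odot> f \<noteq> 0" using ef b.norms by auto
  qed (use b.Je b.Jf b.W_J b.core_iff C in auto)
qed

section \<open>The Cayley coordinates of a J-self-adjoint operator\<close>

locale signature_problem = cstruct I for I :: "'h::{real_inner, complete_space} \<Rightarrow> 'h" +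
  fixes J :: "'h \<Rightarrow> 'h" and T :: "('h \<times> 'h) set"
  assumes signature: "signature_op I J" and J_self_adjoint: "J_self_adjoint I J T"
    and simple: "simple_symmetric I (T \<inter> adjoint I T)"
    and deficiency: "deficiency_indices I (T \<inter> adjoint I T) 2 2"
begin

lemma linear_J: "linear J" and JI: "J (I x) = I (J x)" and JJ[simp]: "J (J x) = x"
  and J_sym: "inner (J x) y = inner x (J y)"
  using signature by (auto simp: signature_op_def bounded_linear.linear cinner_def)

lemma operator_T: "subspace T" "(x, y) \<in> T \<Longrightarrow> (I x, I y) \<in> T"
  using J_self_adjoint by (auto simp: J_self_adjoint_def is_operator_def)

text \<open>Replacing (x, w) by (I x, I w) recovers the imaginary part of the complex identity from
  the real one.\<close>

lemma adjoint_iff_inner: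
  assumes "\<And>x w. (x, w) \<in> G \<Longrightarrow> (I x, I w) \<in> G"
  shows "(y, z) \<in> adjoint I G \<longleftrightarrow> (\<forall>(x, w)\<in>G. inner w y = inner x z)"
proof
  assume *: "\<forall>(x, w)\<in>G. inner w y = inner x z"
  have "cinner I w y = cinner I x z" if "(x, w) \<in> G" for x w
    using bspec[OF * that] bspec[OF * assms[OF that]] by (simp add: cinner_def inner_I_left)
  then show "(y, z) \<in> adjoint I G" by (auto simp: adjoint_def)
qed (auto simp: adjoint_def cinner_def)

text \<open>Self-adjointness of JT with \<open>J\<close> moved across the inner product: the graph
  of \<open>T\<close> is its own polar for a twisted form.\<close>

lemma T_iff: "(x, y) \<in> T \<longleftrightarrow> (\<forall>(x', y')\<in>T. inner y (J x') = inner x (J y'))"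
proof -
  let ?A = "comp_graph J T"
  have A: "(a, b) \<in> ?A \<longleftrightarrow> (a, J b) \<in> T" for a b
    unfolding comp_graph_def using JJ by force
  have inv: "(I a, I b) \<in> ?A" if "(a, b) \<in> ?A" for a b
    using that operator_T(2) by (simp add: A JI)
  have "adjoint I ?A = ?A" using J_self_adjoint by (simp add: J_self_adjoint_def self_adjoint_op_def)
  then have "(x, J y) \<in> ?A \<longleftrightarrow> (\<forall>(a, b)\<in>?A. inner b x = inner a (J y))"
    using adjoint_iff_inner[OF inv] by blast
  also have "\<dots> \<longleftrightarrow> (\<forall>(a, b)\<in>T. inner (J b) x = inner a (J y))"
    by (force simp: comp_graph_def)
  finally show ?thesis unfolding A by (simp add: J_sym inner_commute split_beta) (metis J_sym inner_commute)
qed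

abbreviation "G \<equiv> T \<inter> adjoint I T"

text \<open>The adjoint of \<open>T\<close> is J T J, which makes T_min the
  \<open>J\<close>-invariant part of \<open>T\<close>.\<close>

lemma G_iff: "(x, y) \<in> G \<longleftrightarrow> (x, y) \<in> T \<and> (J x, J y) \<in> T"
proof -
  have "(x, y) \<in> adjoint I T \<longleftrightarrow> (\<forall>(a, b)\<in>T. inner b x = inner a y)"
    by (rule adjoint_iff_inner) (rule operator_T(2))
  also have "\<dots> \<longleftrightarrow> (J x, J y) \<in> T"
    unfolding T_iff[of "J x"] by (simp add: J_sym inner_commute split_beta eq_commute)
  finally have "(x, y) \<in> adjoint I T \<longleftrightarrow> (J x, J y) \<in> T" .
  then show ?thesis by auto
qed

lemma ball_I:
  assumes "\<And>x y. (x, y) \<in> R \<Longrightarrow> (I x, I y) \<in> R"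
  shows "(\<forall>(x, y)\<in>R. P (I x) (I y)) \<longleftrightarrow> (\<forall>(x, y)\<in>R. P x y)"
proof
  assume *: "\<forall>(x, y)\<in>R. P (I x) (I y)"
  have "P x y" if "(x, y) \<in> R" for x y
  proof -
    \<comment> \<open>The third power of \<open>I\<close> is its inverse, so \<open>I\<close> maps
      \<open>R\<close> onto itself.\<close>
    have "(I (I (I x)), I (I (I y))) \<in> R" using that assms by blast
    from bspec[OF * this] show ?thesis by simp
  qed
  then show "\<forall>(x, y)\<in>R. P x y" by blast
qed (use assms in blast)

definition \<sigma> where "\<sigma> = {(u, v). ((1 / 2) *\<^sub>R I (v - u), (1 / 2) *\<^sub>R (u + v)) \<in> T}"

lemma \<sigma>_Cayley: "(y + I x, y - I x) \<in> \<sigma> \<longleftrightarrow> (x, y) \<in> T"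
  by (simp add: \<sigma>_def)

lemma Cayley_exists: "\<exists>x y. u = y + I x \<and> v = y - I x"
  by (intro exI[of _ "(1 / 2) *\<^sub>R I (v - u)"] exI[of _ "(1 / 2) *\<^sub>R (u + v)"])
    (simp add: algebra_simps flip: scaleR_add_left)

lemma ball_\<sigma>: "(\<forall>(u, v)\<in>\<sigma>. P u v) \<longleftrightarrow> (\<forall>(x, y)\<in>T. P (y + I x) (y - I x))"
proof
  assume *: "\<forall>(x, y)\<in>T. P (y + I x) (y - I x)"
  have "P u v" if uv: "(u, v) \<in> \<sigma>" for u v
  proof -
    obtain x y where "u = y + I x" "v = y - I x" using Cayley_exists by blast
    then show ?thesis using * uv \<sigma>_Cayley by auto
  qed
  then show "\<forall>(u, v)\<in>\<sigma>. P u v" by blast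
qed (use \<sigma>_Cayley in auto)

lemma subspace_\<sigma>: "subspace \<sigma>"
proof -
  have T: "(0, 0) \<in> T" "\<And>a b c d. (a, b) \<in> T \<Longrightarrow> (c, d) \<in> T \<Longrightarrow> (a + c, b + d) \<in> T"
    "\<And>r a b. (a, b) \<in> T \<Longrightarrow> (r *\<^sub>R a, r *\<^sub>R b) \<in> T"
    using operator_T(1) unfolding subspace_relation_iff by blast+
  have "(u + u', v + v') \<in> \<sigma>" if "(u, v) \<in> \<sigma>" "(u', v') \<in> \<sigma>" for u v u' v'
    using T(2)[OF that[unfolded \<sigma>_def mem_Collect_eq prod.case]] by (simp add: \<sigma>_def algebra_simps)
  moreover have "(r *\<^sub>R u, r *\<^sub>R v) \<in> \<sigma>" if "(u, v) \<in> \<sigma>" for r u v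
    using T(3)[OF that[unfolded \<sigma>_def mem_Collect_eq prod.case], of r] by (simp add: \<sigma>_def algebra_simps)
  ultimately show ?thesis unfolding subspace_relation_iff using T(1) by (auto simp: \<sigma>_def)
qed

text \<open>Expanding both sides in Cayley coordinates leaves the identity of \<open>T_iff\<close>
  with an extra \<open>I\<close> on the second pair, and \<open>ball_I\<close> absorbs it.\<close>

lemma selfpolar_\<sigma>: "(u, v) \<in> \<sigma> \<longleftrightarrow> (\<forall>(u', v')\<in>\<sigma>. inner u (J u') = inner v (J v'))"
proof -
  obtain x y where xy: "u = y + I x" "v = y - I x" using Cayley_exists by blast
  have "inner (y + I x) (J (y' + I x')) = inner (y - I x) (J (y' - I x')) \<longleftrightarrow>
      inner y (J (I x')) = inner x (J (I y'))" for x' y'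
    using linear_J by (auto simp: linear_add linear_diff inner_add_left inner_add_right inner_diff_left inner_diff_right
        JI inner_I_left)
  then have "(\<forall>(u', v')\<in>\<sigma>. inner u (J u') = inner v (J v')) \<longleftrightarrow>
      (\<forall>(x', y')\<in>T. inner y (J (I x')) = inner x (J (I y')))"
    unfolding xy by (subst ball_\<sigma>) simp
  also have "\<dots> \<longleftrightarrow> (\<forall>(x', y')\<in>T. inner y (J x') = inner x (J y'))"
    by (rule ball_I[OF operator_T(2)])
  also have "\<dots> \<longleftrightarrow> (u, v) \<in> \<sigma>" unfolding xy \<sigma>_Cayley by (rule T_iff[symmetric])
  finally show ?thesis by blast
qed

sublocale selfpolar_relation J \<sigma>
proof (rule selfpolar_relation.intro)
  show "linear J" by (rule linear_J)
  show "J (J x) = x" for x by simp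
  show "inner (J x) y = inner x (J y)" for x y by (rule J_sym)
  show "subspace \<sigma>" by (rule subspace_\<sigma>)
  show "(u, v) \<in> \<sigma> \<longleftrightarrow> (\<forall>(u', v')\<in>\<sigma>. inner u (J u') = inner v (J v'))" for u v by (rule selfpolar_\<sigma>)
qed

lemma core_Cayley: "(y + I x, y - I x) \<in> core \<longleftrightarrow> (x, y) \<in> G"
  using \<sigma>_Cayley[of y x] \<sigma>_Cayley[of "J y" "J x"]
  unfolding core_def mem_Collect_eq prod.case G_iff by (simp add: JI)

lemma operator_G: "(x, y) \<in> G \<Longrightarrow> (I x, I y) \<in> G"
  unfolding G_iff JI using operator_T(2) by blast

lemma ball_core: "(\<forall>(u, v)\<in>core. P u v) \<longleftrightarrow> (\<forall>(x, y)\<in>G. P (y + I x) (y - I x))"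
proof
  assume *: "\<forall>(x, y)\<in>G. P (y + I x) (y - I x)"
  have "P u v" if uv: "(u, v) \<in> core" for u v
  proof -
    obtain x y where "u = y + I x" "v = y - I x" using Cayley_exists by blast
    then show ?thesis using * uv core_Cayley[of y x] by blast
  qed
  then show "\<forall>(u, v)\<in>core. P u v" by blast
next
  assume "\<forall>(u, v)\<in>core. P u v"
  then show "\<forall>(x, y)\<in>G. P (y + I x) (y - I x)" using core_Cayley by blast
qed

lemma adjoint_G_Cayley: "(x, y) \<in> adjoint I G \<longleftrightarrow> (\<forall>(u, v)\<in>core. inner u (y + I x) = inner v (y - I x))"
proof -
  have eq: "inner (y' + I x') (y + I x) = inner (y' - I x') (y - I x) \<longleftrightarrow> inner (I y') x = inner (I x') y" for x' y'
    by (auto simp: inner_add_left inner_add_right inner_diff_left inner_diff_right inner_I_left)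
  have "(\<forall>(u, v)\<in>core. inner u (y + I x) = inner v (y - I x)) \<longleftrightarrow> (\<forall>(x', y')\<in>G. inner (I y') x = inner (I x') y)"
    unfolding eq[symmetric] by (rule ball_core)
  also have "\<dots> \<longleftrightarrow> (\<forall>(x', y')\<in>G. inner y' x = inner x' y)"
    by (rule ball_I[OF operator_G])
  also have "\<dots> \<longleftrightarrow> (x, y) \<in> adjoint I G" using adjoint_iff_inner[OF operator_G] by simp
  finally show ?thesis by blast
qed

text \<open>For (n, I n) the Cayley coordinates are \<open>2 *\<^sub>R I n\<close> and 0, so
  membership in the adjoint only tests the first coordinates of \<open>core\<close>; for (n, - I n)
  it is the first coordinate that vanishes.\<close>

lemma defect_spaces:
  "defect_space I G \<i> = {n. \<forall>u\<in>fst ` core. inner u n = 0}"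
  "defect_space I G (- \<i>) = {n. \<forall>v\<in>snd ` core. inner v n = 0}"
proof -
  have I_core: "(I u, I v) \<in> core" if "(u, v) \<in> core" for u v
    using that operator_G core_Cayley[of "I _" "I _"] Cayley_exists[of u v] core_Cayley
    by (metis I_add I_diff)
  have *: "(\<forall>(u, v)\<in>core. inner u (I n) = 0) \<longleftrightarrow> (\<forall>u\<in>fst ` core. inner u n = 0)"
    "(\<forall>(u, v)\<in>core. inner v (I n) = 0) \<longleftrightarrow> (\<forall>v\<in>snd ` core. inner v n = 0)" for n
    using ball_I[OF I_core, of "\<lambda>u v. inner u n = 0"] ball_I[OF I_core, of "\<lambda>u v. inner v n = 0"]
    by (simp_all add: split_beta inner_I_left)
  show "defect_space I G \<i> = {n. \<forall>u\<in>fst ` core. inner u n = 0}"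
    unfolding defect_space_def adjoint_G_Cayley *[symmetric]
    by (simp add: csc_i flip: scaleR_2)
  have "cscale I (- \<i>) y = - I y" for y by (simp add: cscale_def)
  then show "defect_space I G (- \<i>) = {n. \<forall>v\<in>snd ` core. inner v n = 0}"
    unfolding defect_space_def adjoint_G_Cayley *[symmetric]
    by (auto simp: split_beta inner_diff_right)
qed

sublocale krein I J \<sigma>
proof unfold_locales
  show "(I u, I v) \<in> \<sigma>" if "(u, v) \<in> \<sigma>" for u v
    using that operator_T(2) \<sigma>_Cayley Cayley_exists[of u v] by (metis I_add I_diff)
qed (use JI deficiency in \<open>simp_all add: deficiency_indices_def defect_spaces\<close>)

text \<open>In Cayley coordinates u - v equals \<open>2 *\<^sub>R I x\<close>, so these differences
  are as dense as the domain of T_min. This feeds both the ergodic theorem and the infinite mass of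
  dSigma.\<close>

lemma dense_dom:
  assumes d: "\<And>u v. (u, v) \<in> core \<Longrightarrow> inner z (u - v) = 0"
  shows "z = 0"
proof -
  have cl: "closure (fst ` G) = UNIV"
    using simple by (simp add: simple_symmetric_def symmetric_op_def densely_defined_def op_dom_def)
  have "inner (I z) x = 0" if x: "x \<in> fst ` G" for x
  proof -
    obtain p where "p \<in> G" "x = fst p" using x by (rule imageE)
    then have "(x, snd p) \<in> G" by (simp del: Int_iff)
    then obtain y where "(x, y) \<in> G" by blast
    then have "inner z ((y + I x) - (y - I x)) = 0" using core_Cayley d by blast
    then show ?thesis by (simp add: inner_I_left inner_add_right flip: scaleR_2)
  qed
  then have "fst ` G \<subseteq> {x. inner (I z) x = 0}" by blast
  then have "closure (fst ` G) \<subseteq> {x. inner (I z) x = 0}"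
    by (rule closure_minimal) (auto intro!: closed_Collect_eq continuous_intros)
  then have "inner (I z) (I z) = 0" using cl by blast
  then show "z = 0" by simp
qed

text \<open>The hypotheses say that \<open>core\<close> restricts to a unitary map of
  \<open>M\<close> onto itself, the Cayley transform of a self-adjoint part of T_min; simplicity
  excludes this for nontrivial \<open>M\<close>.\<close>

lemma simple_core:
  assumes M: "csubspace I M" "closed M"
    and 1: "\<And>u. u \<in> M \<Longrightarrow> \<exists>v\<in>M. (u, v) \<in> core" and 2: "\<And>v. v \<in> M \<Longrightarrow> \<exists>u\<in>M. (u, v) \<in> core"
  shows "M = {0}"
proof -
  have sub: "subspace M" and IM: "\<And>x. x \<in> M \<Longrightarrow> I x \<in> M" using M by (auto simp: csubspace_def)
  have Cayley_M: "y + I x \<in> M" "y - I x \<in> M" if "x \<in> M" "y \<in> M" for x y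
    using that sub IM by (auto intro: subspace_add subspace_diff)
  have "reducing I G M"
    unfolding reducing_def
  proof (intro conjI M ballI, clarify)
    fix x y x1 x2 y1 y2
    assume xy: "(x1 + x2, y1 + y2) \<in> T" "(x1 + x2, y1 + y2) \<in> adjoint I T" and m: "x1 \<in> M" "\<forall>m\<in>M. inner x2 m = 0"
      "y1 \<in> M" "\<forall>m\<in>M. inner y2 m = 0"
    have g: "((y1 + y2) + I (x1 + x2), (y1 + y2) - I (x1 + x2)) \<in> core"
      by (rule core_Cayley[THEN iffD2]) (use xy in blast)
    obtain v' where v': "v' \<in> M" "(y1 + I x1, v') \<in> core" using 1[OF Cayley_M(1)[OF m(1,3)]] by blast
    \<comment> \<open>The amount by which (x1, y1) misses \<open>core\<close>. Its preimage
      \<open>u'\<close> in \<open>M\<close> is the test vector: the parts orthogonal to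
      \<open>M\<close> do not see it, so the isometry identity leaves only the norm of
      \<open>d\<close>.\<close>
    define d where "d = y1 - I x1 - v'"
    have dM: "d \<in> M" using v' m Cayley_M sub by (auto simp: d_def intro: subspace_diff)
    obtain u' where u': "u' \<in> M" "(u', d) \<in> core" using 2[OF dM] by blast
    have "(y2 + I x2, y2 - I x2 + d) \<in> core"
      using core_diff[OF g v'(2)] by (simp add: d_def algebra_simps)
    from core_inner[OF this core_D[OF u'(2)]] have "inner (y2 + I x2) u' = inner (y2 - I x2 + d) d" .
    then have "inner d d = 0"
      using m u'(1) dM IM[of u'] IM[of d] by (simp add: inner_add_left inner_diff_left inner_I_left)
    then have "v' = y1 - I x1" by (simp add: d_def)
    then show "(x1, y1) \<in> G" using v' core_Cayley by simp
  qed
  moreover have "self_adjoint_part I G M"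
    unfolding self_adjoint_part_def
  proof (intro equalityI subrelI)
    fix y z assume "(y, z) \<in> {(y, z). y \<in> M \<and> z \<in> M \<and> (\<forall>(x, w)\<in>G \<inter> M \<times> M. cinner I w y = cinner I x z)}"
    then have m: "y \<in> M" "z \<in> M" and a: "\<And>x w. (x, w) \<in> G \<Longrightarrow> x \<in> M \<Longrightarrow> w \<in> M \<Longrightarrow> cinner I w y = cinner I x z"
      by auto
    obtain v' where v': "v' \<in> M" "(z + I y, v') \<in> core" using 1[OF Cayley_M(1)[OF m]] by blast
    \<comment> \<open>The same kind of test vector, with the adjoint relation on \<open>M\<close> in
      place of the orthogonal decomposition.\<close>
    define d where "d = z - I y - v'"
    have dM: "d \<in> M" using v' m Cayley_M sub by (auto simp: d_def intro: subspace_diff)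
    obtain u' where u': "u' \<in> M" "(u', d) \<in> core" using 2[OF dM] by blast
    obtain x w where xw: "u' = w + I x" "d = w - I x" using Cayley_exists by blast
    have G: "(x, w) \<in> G" using u' xw core_Cayley by simp
    have "2 *\<^sub>R w = u' + d" "2 *\<^sub>R (I x) = u' - d" by (simp_all add: xw scaleR_2)
    then have "w = (1/2) *\<^sub>R (u' + d)" "I x = (1/2) *\<^sub>R (u' - d)"
      by (metis scaleR_half_double scaleR_scaleR scaleR_one field_sum_of_halves mult_2 real_vector.scale_right_imp_eq scaleR_2 times_divide_eq_left div_by_1 nonzero_divide_mult_cancel_right zero_neq_numeral)+
    then have wM: "w \<in> M" and "I x \<in> M"
      using u'(1) dM sub by (auto intro: subspace_add subspace_diff subspace_scale)
    then have "- x \<in> M" using IM[of "I x"] by simp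
    then have xM: "x \<in> M" using subspace_neg[OF sub, of "- x"] by simp
    have "\<langle>w, y\<rangle> = \<langle>x, z\<rangle>" using a[OF G xM wM] .
    then have "\<langle>u', z + I y\<rangle> = \<langle>d, z - I y\<rangle>"
      by (simp add: xw cip_simps cip_I_left cip_I_right algebra_simps)
    moreover have "\<langle>u', z + I y\<rangle> = \<langle>d, v'\<rangle>" using core_cip[OF u'(2) core_D[OF v'(2)]] .
    ultimately have "\<langle>d, d\<rangle> = 0" by (simp add: d_def cip_diff_right)
    then have "v' = z - I y" by (simp add: d_def)
    then show "(y, z) \<in> G \<inter> M \<times> M" using v' core_Cayley m by simp
  next
    fix y z assume yz: "(y, z) \<in> G \<inter> M \<times> M"
    have "G \<subseteq> adjoint I G" using simple by (simp add: simple_symmetric_def symmetric_op_def)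
    then have "(y, z) \<in> adjoint I G" using yz by blast
    then show "(y, z) \<in> {(y, z). y \<in> M \<and> z \<in> M \<and> (\<forall>(x, w)\<in>G \<inter> M \<times> M. cinner I w y = cinner I x z)}"
      using yz by (auto simp: adjoint_def)
  qed
  ultimately show ?thesis using simple unfolding simple_symmetric_def by blast
qed

end

section \<open>The spectral measure of a unitary operator\<close>

lemma subspace_closure:
  fixes S :: "'a::real_normed_vector set"
  assumes "subspace S"
  shows "subspace (closure S)"
proof (rule subspaceI)
  show "0 \<in> closure S" using assms subspace_0 closure_subset by blast
  show "x + y \<in> closure S" if xy: "x \<in> closure S" "y \<in> closure S" for x y
  proof -
    obtain f g where fg: "\<And>n. f n \<in> S" "\<And>n. g n \<in> S" "f \<longlonglongrightarrow> x" "g \<longlonglongrightarrow> y"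
      using xy unfolding closure_sequential by blast
    then show ?thesis unfolding closure_sequential
      by (intro exI[of _ "\<lambda>n. f n + g n"]) (auto intro!: tendsto_intros subspace_add assms)
  qed
  show "c *\<^sub>R x \<in> closure S" if x: "x \<in> closure S" for c x
  proof -
    obtain f where f: "\<And>n. f n \<in> S" "f \<longlonglongrightarrow> x" using x unfolding closure_sequential by blast
    then show ?thesis unfolding closure_sequential
      by (intro exI[of _ "\<lambda>n. c *\<^sub>R f n"]) (auto intro!: tendsto_intros subspace_scale assms)
  qed
qed

lemma has_bochner_integral_cis:
  fixes j :: int
  shows "has_bochner_integral lborel (\<lambda>x. indicator {0..2 * pi} x *\<^sub>R cis (of_int j * x)) (if j = 0 then 2 * pi else 0)"
proof (cases "j = 0")
  case True
  have "has_bochner_integral lborel (\<lambda>x. indicator {0..2 * pi} x *\<^sub>R (1::complex)) (measure lborel {0..2 * pi} *\<^sub>R 1)"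
    by (rule has_bochner_integral_indicator) (auto)
  then show ?thesis using True by (simp add: scaleR_conv_of_real)
next
  case False
  define h where "h z = exp (\<i> * of_int j * z) / (\<i> * of_int j)" for z :: complex
  have "has_bochner_integral lborel (\<lambda>x. indicator {0..2 * pi} x *\<^sub>R exp (\<i> * of_int j * of_real x))
      (h (of_real (2 * pi)) - h (of_real 0))"
  proof (rule has_bochner_integral_FTC_Icc[where F="\<lambda>x. h (of_real x)"])
    show "((\<lambda>x. h (complex_of_real x)) has_vector_derivative exp (\<i> * of_int j * of_real x)) (at x within {0..2 * pi})" for x
      unfolding h_def
      by (rule has_vector_derivative_real_field) (use False in \<open>auto intro!: derivative_eq_intros\<close>)
  qed (auto intro!: continuous_intros)
  moreover have "exp (\<i> * of_int j * of_real (2 * pi)) = 1"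
    using exp_integer_2pi[of "of_int j"] by (simp add: mult_ac)
  ultimately show ?thesis using False by (simp add: h_def cis_conv_exp mult_ac)
qed

section \<open>Trigonometric moments and ergodic means of a unitary operator\<close>

context cunitary
begin

lemma W_0[simp]: "W 0 = 0" and W_minus[simp]: "W (- x) = - W x" and W_diff[simp]: "W (x - y) = W x - W y"
  and W_scale[simp]: "W (c *\<^sub>R x) = c *\<^sub>R W x"
proof -
  show "W 0 = 0" "W (- x) = - W x" "W (c *\<^sub>R x) = c *\<^sub>R W x" for x c
    using W_csc[of 0 x] W_csc[of "-1" x] W_csc[of "of_real c" x] by (simp_all add: csc_of_real)
  then show "W (x - y) = W x - W y" using W_add[of x "- y"] by simp
qed

lemma norm_W[simp]: "norm (W x) = norm x"
  using cip_W[of x x] by (simp only: cip_self of_real_eq_iff) (simp add: power2_eq_iff_nonneg)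

lemma norm_W_funpow[simp]: "norm ((W ^^ k) x) = norm x"
  by (induction k) auto

lemma cip_W_funpow: "\<langle>(W ^^ (k + j)) x, (W ^^ (k + l)) y\<rangle> = \<langle>(W ^^ j) x, (W ^^ l) y\<rangle>"
  by (induction k) auto

text \<open>The Fejer mean of the formal Fourier series whose coefficients are the moments of
  \<open>W\<close> at \<open>e\<close>, written as a squared norm to make it visibly
  nonnegative.\<close>

definition fejer :: "'h \<Rightarrow> nat \<Rightarrow> real \<Rightarrow> real" where
  "fejer e N x = (norm (\<Sum>k<N. cis (- (of_nat k * x)) \<odot> (W ^^ k) e))\<^sup>2 / (2 * pi * N)"

lemma cip_sum: "\<langle>\<Sum>k\<in>A. f k, \<Sum>l\<in>B. g l\<rangle> = (\<Sum>k\<in>A. \<Sum>l\<in>B. \<langle>f k, g l\<rangle>)"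
proof -
  have 1: "\<langle>\<Sum>k\<in>A. f k, y\<rangle> = (\<Sum>k\<in>A. \<langle>f k, y\<rangle>)" for y
    by (rule linear_sum) (rule bounded_linear.linear[OF bounded_linear_cip_left])
  have 2: "\<langle>x, \<Sum>l\<in>B. g l\<rangle> = (\<Sum>l\<in>B. \<langle>x, g l\<rangle>)" for x
    by (rule linear_sum) (rule bounded_linear.linear[OF bounded_linear_cip_right])
  show ?thesis by (subst 1) (simp only: 2)
qed

lemma fejer_expansion:
  "of_real (fejer e N x) = (\<Sum>m<N. \<Sum>l<N. cis (of_int (int l - int m) * x) * \<langle>(W ^^ m) e, (W ^^ l) e\<rangle>) / (2 * pi * N)"
proof -
  have "complex_of_real ((norm (\<Sum>k<N. cis (- (of_nat k * x)) \<odot> (W ^^ k) e))\<^sup>2)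
      = (\<Sum>m<N. \<Sum>l<N. \<langle>cis (- (of_nat m * x)) \<odot> (W ^^ m) e, cis (- (of_nat l * x)) \<odot> (W ^^ l) e\<rangle>)"
    by (simp only: cip_self[symmetric] cip_sum)
  also have "\<dots> = (\<Sum>m<N. \<Sum>l<N. cis (of_int (int l - int m) * x) * \<langle>(W ^^ m) e, (W ^^ l) e\<rangle>)"
    by (intro sum.cong refl) (simp add: cip_csc_left cip_csc_right cis_cnj cis_mult algebra_simps flip: mult.assoc)
  finally show ?thesis by (simp add: fejer_def)
qed

lemma fejer_nonneg: "0 \<le> fejer e N x"
  by (simp add: fejer_def)

text \<open>Integration keeps the terms with m = k + l. There are N - k of them, all with the same
  coefficient, whence the Fejer weight 1 - k / N.\<close>

lemma fejer_moment:
  assumes "k < N"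
  shows "has_bochner_integral lborel (\<lambda>x. (indicator {0..2 * pi} x * fejer e N x) *\<^sub>R cis (of_nat k * x))
    (of_real (1 - k / N) * \<langle>(W ^^ k) e, e\<rangle>)"
proof -
  have "0 < N" using assms by simp
  have "has_bochner_integral lborel (\<lambda>x. (\<Sum>m<N. \<Sum>l<N. (indicator {0..2 * pi} x *\<^sub>R cis (of_int (int k + int l - int m) * x))
        * \<langle>(W ^^ m) e, (W ^^ l) e\<rangle>) / (2 * pi * N))
      ((\<Sum>m<N. \<Sum>l<N. (if int k + int l - int m = 0 then 2 * pi else 0) * \<langle>(W ^^ m) e, (W ^^ l) e\<rangle>) / (2 * pi * N))"
    by (intro has_bochner_integral_divide_zero has_bochner_integral_sum has_bochner_integral_mult_left has_bochner_integral_cis)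
  also have "(\<lambda>x. (\<Sum>m<N. \<Sum>l<N. (indicator {0..2 * pi} x *\<^sub>R cis (of_int (int k + int l - int m) * x))
        * \<langle>(W ^^ m) e, (W ^^ l) e\<rangle>) / (2 * pi * N)) = (\<lambda>x. (indicator {0..2 * pi} x * fejer e N x) *\<^sub>R cis (of_nat k * x))"
    by (simp add: fun_eq_iff scaleR_conv_of_real fejer_expansion sum_distrib_left sum_distrib_right sum_divide_distrib
        cis_mult algebra_simps flip: cis_mult)
      (intro allI sum.cong refl, simp add: cis_mult algebra_simps)
  also have "(\<Sum>m<N. \<Sum>l<N. (if int k + int l - int m = 0 then 2 * pi else 0) * \<langle>(W ^^ m) e, (W ^^ l) e\<rangle>)
      = (\<Sum>l<N. \<Sum>m<N. (if m = k + l then 2 * pi * \<langle>(W ^^ m) e, (W ^^ l) e\<rangle> else 0))"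
    by (subst sum.swap) (intro sum.cong refl, auto)
  also have "\<dots> = (\<Sum>l<N. if k + l < N then 2 * pi * \<langle>(W ^^ k) e, e\<rangle> else 0)"
    using cip_W_funpow[of _ k e 0 e] by (intro sum.cong refl) (simp add: sum.delta add.commute)
  also have "\<dots> = (\<Sum>l<N - k. 2 * pi * \<langle>(W ^^ k) e, e\<rangle>)"
    by (rule sum.mono_neutral_cong_right) auto
  also have "\<dots> / (2 * pi * N) = of_real (1 - k / N) * \<langle>(W ^^ k) e, e\<rangle>"
    using assms \<open>0 < N\<close> by (simp add: of_nat_diff field_simps)
  finally show ?thesis .
qed

lemma measurable_fejer[measurable]: "fejer e N \<in> borel_measurable borel"
proof -
  have "fejer e N = (\<lambda>x. Re (of_real (fejer e N x)))" by simp
  also have "\<dots> \<in> borel_measurable borel"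
    unfolding fejer_expansion divide_inverse by (intro borel_measurable_continuous_onI continuous_intros)
  finally show ?thesis .
qed

text \<open>Unit length of \<open>e\<close> makes the Fejer densities probabilities. They live on
  one compact interval, hence are tight, and a weak limit has the moments that remain when the Fejer
  weights tend to 1.\<close>

lemma trigonometric_moment_measure:
  assumes e: "norm e = 1"
  obtains M where "real_distribution M" "\<And>k::nat. (\<integral>x. cis (of_nat k * x) \<partial>M) = \<langle>(W ^^ k) e, e\<rangle>"
proof -
  \<comment> \<open>\<open>Suc N\<close> keeps the normalising divisor nonzero.\<close>
  define g where "g N x = indicator {0..2 * pi} x * fejer e (Suc N) x" for N x
  define \<mu> where "\<mu> N = density lborel (\<lambda>x. ennreal (g N x))" for N
  have g[measurable]: "g N \<in> borel_measurable borel" for N unfolding g_def by measurable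
  have g0: "0 \<le> g N x" for N x by (simp add: g_def fejer_nonneg)
  have mom: "has_bochner_integral (\<mu> N) (\<lambda>x. cis (of_nat k * x)) (of_real (1 - k / Suc N) * \<langle>(W ^^ k) e, e\<rangle>)"
    if "k < Suc N" for k N
    unfolding \<mu>_def using fejer_moment[OF that, of e] g0
    by (intro has_bochner_integral_density) (auto simp: g_def intro!: borel_measurable_continuous_onI continuous_intros)
  have "emeasure (\<mu> N) (space (\<mu> N)) = 1" for N
  proof -
    have "has_bochner_integral (\<mu> N) (\<lambda>x. 1::complex) 1" using mom[of 0 N] e by (simp add: cip_self)
    then have i: "integrable (\<mu> N) (\<lambda>x. 1::complex)" "(\<integral>x. (1::complex) \<partial>\<mu> N) = 1"
      by (auto simp: has_bochner_integral_iff)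
    then have "measure (\<mu> N) (space (\<mu> N)) = 1" by (simp add: scaleR_conv_of_real)
    moreover have "emeasure (\<mu> N) (space (\<mu> N)) \<noteq> top"
      using i(1) unfolding integrable_iff_bounded by simp
    ultimately show ?thesis by (metis emeasure_eq_ennreal_measure ennreal_1)
  qed
  then have prob: "prob_space (\<mu> N)" for N by (rule prob_spaceI)
  have \<mu>: "real_distribution (\<mu> N)" for N
  proof -
    interpret prob_space "\<mu> N" by (rule prob)
    show ?thesis by unfold_locales (simp_all add: \<mu>_def)
  qed
  have "tight \<mu>"
    unfolding tight_def
  proof (intro conjI allI impI \<mu>)
    fix \<epsilon> :: real assume "\<epsilon> > 0"
    \<comment> \<open>Tightness asks for a half-open interval, which has to start below 0; and 8
      exceeds 2 * pi.\<close>
    have "measure (\<mu> N) {-1<..8} = 1" for N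
    proof -
      interpret real_distribution "\<mu> N" by (rule \<mu>)
      have "AE x in \<mu> N. x \<in> {-1<..8}"
        unfolding \<mu>_def using pi_less_4 by (subst AE_density) (auto simp: g_def indicator_def)
      then show ?thesis by (subst prob_eq_1) auto
    qed
    then show "\<exists>a b. a < b \<and> (\<forall>n. 1 - \<epsilon> < measure (\<mu> n) {a<..b})"
      using \<open>\<epsilon> > 0\<close> by (intro exI[of _ "-1"] exI[of _ 8]) auto
  qed
  then obtain s M where s: "strict_mono s" and M: "real_distribution M" and conv: "weak_conv_m (\<mu> \<circ> id \<circ> s) M"
    using tight_imp_convergent_subsubsequence[of \<mu> id] strict_mono_id by blast
  interpret M: real_distribution M by fact
  have "(\<integral>x. cis (of_nat k * x) \<partial>M) = \<langle>(W ^^ k) e, e\<rangle>" for k :: nat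
  proof (rule LIMSEQ_unique)
    show "(\<lambda>n. \<integral>x. cis (of_nat k * x) \<partial>(\<mu> \<circ> id \<circ> s) n) \<longlonglongrightarrow> (\<integral>x. cis (of_nat k * x) \<partial>M)"
    proof (rule weak_conv_imp_integral_bdd_continuous_conv[OF _ M conv, where B=1])
      show "real_distribution ((\<mu> \<circ> id \<circ> s) n)" for n using \<mu> by simp
      have "continuous_on UNIV (\<lambda>x. cis (of_nat k * x))" by (intro continuous_intros)
      then show "isCont (\<lambda>x. cis (of_nat k * x)) x" for x by (simp add: continuous_on_eq_continuous_at)
    qed simp
    have lim: "(\<lambda>n. inverse (real (Suc (s n)))) \<longlonglongrightarrow> 0"
      using LIMSEQ_subseq_LIMSEQ[OF LIMSEQ_inverse_real_of_nat s] by (simp add: o_def)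
    have "(\<lambda>n. of_real (1 - k * inverse (real (Suc (s n)))) * \<langle>(W ^^ k) e, e\<rangle>) \<longlonglongrightarrow> of_real (1 - real k * 0) * \<langle>(W ^^ k) e, e\<rangle>"
      by (intro tendsto_intros lim)
    moreover have "\<forall>\<^sub>F n in sequentially. of_real (1 - k * inverse (real (Suc (s n)))) * \<langle>(W ^^ k) e, e\<rangle>
        = (\<integral>x. cis (of_nat k * x) \<partial>(\<mu> \<circ> id \<circ> s) n)"
      using eventually_ge_at_top[of k]
    proof eventually_elim
      case (elim n)
      then have "k < Suc (s n)" using seq_suble[OF s, of n] by simp
      from mom[OF this] show ?case by (simp add: has_bochner_integral_iff divide_inverse)
    qed
    ultimately show "(\<lambda>n. \<integral>x. cis (of_nat k * x) \<partial>(\<mu> \<circ> id \<circ> s) n) \<longlonglongrightarrow> \<langle>(W ^^ k) e, e\<rangle>"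
      by (simp add: tendsto_cong)
  qed
  then show ?thesis using that M by blast
qed

text \<open>The hypothesis says that 1 - W has dense range. On the range the sums telescope to
  bounded vectors, and a small remainder stays small because \<open>W\<close> is isometric.\<close>

lemma mean_ergodic:
  assumes dense: "\<And>z. (\<And>y. inner z (y - W y) = 0) \<Longrightarrow> z = 0"
  shows "(\<lambda>N. (1 / Suc N) *\<^sub>R (\<Sum>k\<le>N. (W ^^ k) x)) \<longlonglongrightarrow> 0"
proof -
  define R where "R = closure (range (\<lambda>y. y - W y))"
  have "subspace (range (\<lambda>y. y - W y))"
    by (rule linear_subspace_image) (auto simp: linear_iff algebra_simps)
  then have R: "subspace R" "closed R" by (auto simp: R_def subspace_closure)
  obtain p where p: "p \<in> R" "\<And>s. s \<in> R \<Longrightarrow> inner (x - p) s = 0" using hilbert_projection[OF R] by metis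
  have "inner (x - p) (y - W y) = 0" for y
    by (rule p(2)) (auto simp: R_def intro: closure_subset[THEN subsetD])
  then have x: "x \<in> R" using dense[of "x - p"] p(1) by simp
  show ?thesis
  proof (rule LIMSEQ_I)
    fix r :: real assume r: "0 < r"
    obtain y where y: "norm (x - (y - W y)) < r / 2"
      using x r unfolding R_def closure_approachable by (metis dist_norm dist_commute half_gt_zero rangeE)
    define q where "q = x - (y - W y)"
    have sum: "(\<Sum>k\<le>N. (W ^^ k) (y - W y)) = y - (W ^^ Suc N) y" for N
    proof -
      have "(W ^^ k) (y - W y) = (W ^^ k) y - (W ^^ Suc k) y" for k
        by (induction k) auto
      then show ?thesis by (induction N) simp_all
    qed
    have add: "(W ^^ k) (a + b) = (W ^^ k) a + (W ^^ k) b" for k a b by (induction k) auto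
    obtain N where N: "real N > 4 * norm y / r" using reals_Archimedean2 by blast
    have "norm ((1 / Suc n) *\<^sub>R (\<Sum>k\<le>n. (W ^^ k) x)) < r" if n: "n \<ge> N" for n
    proof -
      have "x = q + (y - W y)" by (simp add: q_def)
      then have "(\<Sum>k\<le>n. (W ^^ k) x) = (\<Sum>k\<le>n. (W ^^ k) q) + (y - (W ^^ Suc n) y)"
        by (simp only: add sum.distrib sum)
      then have "norm (\<Sum>k\<le>n. (W ^^ k) x) \<le> (\<Sum>k\<le>n. norm ((W ^^ k) q)) + (norm y + norm ((W ^^ Suc n) y))"
        by (simp only:) (intro order_trans[OF norm_triangle_ineq] add_mono norm_sum norm_triangle_ineq4)
      also have "\<dots> = Suc n * norm q + 2 * norm y" by (simp del: funpow.simps)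
      finally have "norm (\<Sum>k\<le>n. (W ^^ k) x) / Suc n \<le> (Suc n * norm q + 2 * norm y) / Suc n"
        by (rule divide_right_mono) simp
      then have "norm ((1 / Suc n) *\<^sub>R (\<Sum>k\<le>n. (W ^^ k) x)) \<le> norm q + 2 * norm y / Suc n"
        by (simp add: add_divide_distrib del: of_nat_Suc)
      moreover have "2 * norm y / Suc n < r / 2"
      proof -
        have "4 * norm y / r < Suc n" using N n by linarith
        then show ?thesis using r by (simp add: field_simps)
      qed
      ultimately show ?thesis using y unfolding q_def by linarith
    qed
    then show "\<exists>no. \<forall>n\<ge>no. norm ((1 / Suc n) *\<^sub>R (\<Sum>k\<le>n. (W ^^ k) x) - 0) < r" by auto
  qed
qed

end

text \<open>The Cayley map of the line onto the circle without the point 1; hence mass at 1 must be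
  excluded before a measure is moved from the circle to the line.\<close>

definition zeta :: "real \<Rightarrow> complex" where "zeta t = (of_real t - \<i>) / (of_real t + \<i>)"

lemma real_plus_i[simp]: "complex_of_real t + \<i> \<noteq> 0" "complex_of_real t - \<i> \<noteq> 0"
  by (auto simp: complex_eq_iff)

lemma norm_zeta[simp]: "cmod (zeta t) = 1"
  by (simp only: zeta_def norm_divide) (simp add: cmod_def, smt (verit) zero_le_power2)

lemma continuous_zeta[continuous_intros]: "continuous_on A zeta"
  unfolding zeta_def by (intro continuous_intros) auto

lemma measurable_zeta[measurable]: "zeta \<in> borel_measurable borel"
  by (intro borel_measurable_continuous_onI continuous_intros)

lemma zeta_cot:
  assumes "cis x \<noteq> 1"
  shows "zeta (- (cos (x / 2) / sin (x / 2))) = cis x"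
proof -
  have "cis x = cis (x / 2) * cis (x / 2)" by (simp add: cis_mult)
  have s: "sin (x / 2) \<noteq> 0"
  proof
    assume "sin (x / 2) = 0"
    then have "sin x = 0" "cos x = 1"
      using sin_double[of "x / 2"] cos_double_sin[of "x / 2"] by auto
    then show False using assms by (simp add: complex_eq_iff)
  qed
  have n: "cis (- (x / 2)) \<noteq> 0" by simp
  have "zeta (- (cos (x / 2) / sin (x / 2))) = (- of_real (cos (x / 2)) - \<i> * of_real (sin (x / 2))) / (- of_real (cos (x / 2)) + \<i> * of_real (sin (x / 2)))"
    using s by (simp add: zeta_def divide_simps)
  also have "\<dots> = (- cis (x / 2)) / (- cis (- (x / 2)))"
    by (rule arg_cong2[of _ _ _ _ "(/)"]) (auto simp: complex_eq_iff)
  also have "\<dots> = cis (x / 2) * cis (x / 2)"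
    by (simp add: cis_divide cis_mult)
  finally show ?thesis by (simp add: cis_mult)
qed

lemma cesaro_powers_tendsto:
  fixes z :: complex
  assumes "cmod z = 1"
  shows "(\<lambda>N. (1 / Suc N) *\<^sub>R (\<Sum>k\<le>N. z ^ k)) \<longlonglongrightarrow> (if z = 1 then 1 else 0)"
proof (cases "z = 1")
  case True
  have "(1 / Suc N) *\<^sub>R (\<Sum>k\<le>N. z ^ k) = of_real (1 / Suc N * Suc N)" for N
    using True by (simp add: scaleR_conv_of_real del: of_nat_Suc)
  then show ?thesis using True by simp
next
  case False
  have "(\<lambda>N. (1 / Suc N) *\<^sub>R (\<Sum>k\<le>N. z ^ k)) \<longlonglongrightarrow> 0"
  proof (rule Lim_null_comparison)
    have "norm ((1 / Suc N) *\<^sub>R (\<Sum>k\<le>N. z ^ k)) \<le> inverse (Suc N) * (2 / cmod (z - 1))" for N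
    proof -
      have "(\<Sum>k\<le>N. z ^ k) = (z ^ Suc N - 1) / (z - 1)"
        using geometric_sum[OF False, of "Suc N"] by (simp only: lessThan_Suc_atMost)
      moreover have "cmod (z ^ Suc N - 1) \<le> 2"
        using norm_triangle_ineq4[of "z ^ Suc N" 1] assms by (simp add: norm_power norm_mult)
      ultimately have "cmod (\<Sum>k\<le>N. z ^ k) \<le> 2 / cmod (z - 1)"
        by (simp add: norm_divide divide_right_mono del: power_Suc)
      then show ?thesis by (simp add: divide_inverse mult_left_mono)
    qed
    then show "\<forall>\<^sub>F N in sequentially. norm ((1 / Suc N) *\<^sub>R (\<Sum>k\<le>N. z ^ k)) \<le> inverse (Suc N) * (2 / cmod (z - 1))"
      by simp
    show "(\<lambda>N. inverse (Suc N) * (2 / cmod (z - 1))) \<longlonglongrightarrow> 0"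
      using tendsto_mult_right[OF LIMSEQ_inverse_real_of_nat, of "2 / cmod (z - 1)"] by simp
  qed
  then show ?thesis using False by simp
qed

lemma (in cunitary) spectral_measure_exists:
  assumes dense: "\<And>z. (\<And>y. inner z (y - W y) = 0) \<Longrightarrow> z = 0" and e: "e \<noteq> 0"
  obtains \<mu> where "finite_measure \<mu>" "sets \<mu> = sets borel" "\<And>k::nat. (\<integral>t. zeta t ^ k \<partial>\<mu>) = \<langle>(W ^^ k) e, e\<rangle>"
proof -
  define e1 where "e1 = e /\<^sub>R norm e"
  have e1: "norm e1 = 1" using e by (simp add: e1_def)
  obtain M where M: "real_distribution M" and mom: "\<And>k::nat. (\<integral>x. cis (of_nat k * x) \<partial>M) = \<langle>(W ^^ k) e1, e1\<rangle>"
    using trigonometric_moment_measure[OF e1] by blast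
  interpret M: real_distribution M by fact
  have [measurable]: "cis \<in> borel_measurable borel" by (intro borel_measurable_continuous_onI continuous_intros)
  define A where "A = {x. cis x = 1}"
  have A[measurable]: "A \<in> sets borel"
    unfolding A_def by (intro borel_closed closed_Collect_eq continuous_intros)
  \<comment> \<open>Cesaro means of the powers of \<open>cis\<close> converge to the indicator of
    \<open>A\<close>, while their integrals are products of ergodic means with \<open>e1\<close> and
    tend to 0.\<close>
  have "measure M A = 0"
  proof -
    have "(\<lambda>N. \<integral>x. (1 / Suc N) *\<^sub>R (\<Sum>k\<le>N. cis x ^ k) \<partial>M) \<longlonglongrightarrow> (\<integral>x. (if cis x = 1 then 1 else 0) \<partial>M)"
    proof (rule integral_dominated_convergence[where w = "\<lambda>_. 1"])
      show "AE x in M. (\<lambda>N. (1 / Suc N) *\<^sub>R (\<Sum>k\<le>N. cis x ^ k)) \<longlonglongrightarrow> (if cis x = 1 then 1 else 0)"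
        by (intro AE_I2 cesaro_powers_tendsto) simp
      show "AE x in M. norm ((1 / Suc N) *\<^sub>R (\<Sum>k\<le>N. cis x ^ k)) \<le> 1" for N
      proof (intro AE_I2)
        fix x
        have "norm (\<Sum>k\<le>N. cis x ^ k) \<le> (\<Sum>k\<le>N. norm (cis x ^ k))" by (rule norm_sum)
        then show "norm ((1 / Suc N) *\<^sub>R (\<Sum>k\<le>N. cis x ^ k)) \<le> 1" by (simp add: norm_power)
      qed
    qed auto
    moreover have "(\<integral>x. (if cis x = 1 then 1 else 0) \<partial>M) = (\<integral>x. indicator A x *\<^sub>R (1::complex) \<partial>M)"
      by (intro Bochner_Integration.integral_cong) (auto simp: A_def)
    moreover have "(\<integral>x. (1 / Suc N) *\<^sub>R (\<Sum>k\<le>N. cis x ^ k) \<partial>M) = \<langle>(1 / Suc N) *\<^sub>R (\<Sum>k\<le>N. (W ^^ k) e1), e1\<rangle>" for N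
    proof -
      have "integrable M (\<lambda>x. cis (of_nat k * x))" for k
        by (rule M.integrable_const_bound[of _ 1]) (auto simp: norm_power intro!: borel_measurable_continuous_onI continuous_intros)
      then show ?thesis
        using cip_sum[of "\<lambda>k. (W ^^ k) e1" "{..N}" "\<lambda>_. e1" "{0::nat}"]
        by (simp add: Complex.DeMoivre cip_scaleR_left mom scaleR_conv_of_real)
    qed
    moreover have "(\<lambda>N. \<langle>(1 / Suc N) *\<^sub>R (\<Sum>k\<le>N. (W ^^ k) e1), e1\<rangle>) \<longlonglongrightarrow> \<langle>0, e1\<rangle>"
      by (intro bounded_linear.tendsto[OF bounded_linear_cip_left] mean_ergodic dense)
    ultimately have "(\<integral>x. indicator A x *\<^sub>R (1::complex) \<partial>M) = 0"
      using LIMSEQ_unique by (metis (no_types, lifting) cip_0_left tendsto_cong_limit ext)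
    then show ?thesis by (simp add: scaleR_conv_of_real)
  qed
  then have AE: "AE x in M. cis x \<noteq> 1"
    using M.prob_eq_0[of A] by (auto simp: A_def)
  \<comment> \<open>This is - cot (x / 2), the inverse Cayley map in terms of the angle. Where the
    sine vanishes its value is 0 by division by zero, but that happens on a null set.\<close>
  define t where "t x = - (cos (x / 2) / sin (x / 2))" for x :: real
  have t[measurable]: "t \<in> borel_measurable borel"
  proof -
    have "(\<lambda>x::real. cos (x / 2)) \<in> borel_measurable borel" "(\<lambda>x::real. sin (x / 2)) \<in> borel_measurable borel"
      by (auto intro!: borel_measurable_continuous_onI continuous_intros)
    then show ?thesis unfolding t_def by measurable
  qed
  define \<nu> where "\<nu> = distr M borel t"
  interpret \<nu>: finite_measure \<nu> unfolding \<nu>_def by (rule M.finite_measure_distr) simp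
  define \<mu> where "\<mu> = density \<nu> (\<lambda>_. ennreal ((norm e)\<^sup>2))"
  have \<nu>: "(\<integral>t. zeta t ^ k \<partial>\<nu>) = \<langle>(W ^^ k) e1, e1\<rangle>" for k
  proof -
    have "(\<integral>t. zeta t ^ k \<partial>\<nu>) = (\<integral>x. zeta (t x) ^ k \<partial>M)" unfolding \<nu>_def by (rule integral_distr) auto
    also have "\<dots> = (\<integral>x. cis (of_nat k * x) \<partial>M)"
      using AE by (intro integral_cong_AE) (auto simp: t_def zeta_cot Complex.DeMoivre)
    finally show ?thesis using mom by simp
  qed
  show ?thesis
  proof (rule that[of \<mu>])
    show "sets \<mu> = sets borel" by (simp add: \<mu>_def \<nu>_def)
    show "finite_measure \<mu>"
      by (rule finite_measureI) (simp add: \<mu>_def emeasure_density nn_integral_cmult \<nu>.emeasure_finite ennreal_mult_eq_top_iff)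
    have lin: "(W ^^ k) (c *\<^sub>R x) = c *\<^sub>R (W ^^ k) x" for k c x by (induction k) auto
    have e: "e = norm e *\<^sub>R e1" using e by (simp add: e1_def)
    have "\<langle>(W ^^ k) e, e\<rangle> = \<langle>(W ^^ k) (norm e *\<^sub>R e1), norm e *\<^sub>R e1\<rangle>" for k using e by simp
    also have "\<dots> k = of_real ((norm e)\<^sup>2) * \<langle>(W ^^ k) e1, e1\<rangle>" for k
      by (simp add: lin cip_scaleR_left cip_scaleR_right power2_eq_square)
    finally show "(\<integral>t. zeta t ^ k \<partial>\<mu>) = \<langle>(W ^^ k) e, e\<rangle>" for k
      unfolding \<mu>_def by (subst integral_density) (auto simp: \<nu>[symmetric] \<nu>_def scaleR_conv_of_real)
  qed
qed

section \<open>Square-integrable functions for a finite measure on the line\<close>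

locale finite_borel = finite_measure \<mu> for \<mu> :: "real measure" +
  assumes sets_\<mu>[simp, measurable_cong]: "sets \<mu> = sets borel"
begin

lemma space_\<mu>[simp]: "space \<mu> = UNIV"
  using sets_eq_imp_space_eq[OF sets_\<mu>] by simp

definition sqint :: "(real \<Rightarrow> complex) \<Rightarrow> bool" where
  "sqint f \<longleftrightarrow> f \<in> borel_measurable borel \<and> integrable \<mu> (\<lambda>t. (cmod (f t))\<^sup>2)"

lemma sqint_measurable[measurable_dest]: "sqint f \<Longrightarrow> f \<in> borel_measurable borel"
  and sqint_integrable: "sqint f \<Longrightarrow> integrable \<mu> (\<lambda>t. (cmod (f t))\<^sup>2)"
  by (auto simp: sqint_def)

lemma sqint_mult_integrable:
  assumes "sqint f" "sqint g" shows "integrable \<mu> (\<lambda>t. f t * g t)"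
proof (rule Bochner_Integration.integrable_bound)
  show "integrable \<mu> (\<lambda>t. (cmod (f t))\<^sup>2 + (cmod (g t))\<^sup>2)" using assms sqint_integrable by auto
  show "AE t in \<mu>. norm (f t * g t) \<le> norm ((cmod (f t))\<^sup>2 + (cmod (g t))\<^sup>2)"
  proof (intro AE_I2)
    fix t
    have "cmod (f t) * cmod (g t) * 2 \<le> (cmod (f t))\<^sup>2 + (cmod (g t))\<^sup>2"
      using sum_squares_bound[of "cmod (f t)" "cmod (g t)"] by (simp add: mult_ac)
    moreover have "0 \<le> cmod (f t) * cmod (g t)" by simp
    ultimately show "norm (f t * g t) \<le> norm ((cmod (f t))\<^sup>2 + (cmod (g t))\<^sup>2)"
      unfolding norm_mult by (simp only: real_norm_def)
  qed
qed (use assms in measurable)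

lemma sqint_bounded:
  assumes "g \<in> borel_measurable borel" "\<And>t. cmod (g t) \<le> B" shows "sqint g"
proof -
  have "integrable \<mu> (\<lambda>t. (cmod (g t))\<^sup>2)"
    by (rule integrable_const_bound[of _ "B\<^sup>2"]) (use assms in \<open>auto intro!: power_mono AE_I2\<close>)
  then show ?thesis using assms by (simp add: sqint_def)
qed

lemma sqint_mult_bounded:
  assumes f: "sqint f" and g: "g \<in> borel_measurable borel" "\<And>t. cmod (g t) \<le> B"
  shows "sqint (\<lambda>t. g t * f t)"
proof -
  have "integrable \<mu> (\<lambda>t. (cmod (g t * f t))\<^sup>2)"
  proof (rule Bochner_Integration.integrable_bound)
    show "integrable \<mu> (\<lambda>t. B\<^sup>2 * (cmod (f t))\<^sup>2)" using sqint_integrable[OF f] by simp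
    show "AE t in \<mu>. norm ((cmod (g t * f t))\<^sup>2) \<le> norm (B\<^sup>2 * (cmod (f t))\<^sup>2)"
      using g(2) by (intro AE_I2) (auto simp: norm_mult power_mult_distrib intro!: mult_right_mono power_mono)
  qed (use f g in measurable)
  moreover have "(\<lambda>t. g t * f t) \<in> borel_measurable borel" using f g(1) by measurable
  ultimately show ?thesis by (simp add: sqint_def)
qed

lemma sqint_add: assumes "sqint f" "sqint g" shows "sqint (\<lambda>t. f t + g t)"
proof -
  have "integrable \<mu> (\<lambda>t. (cmod (f t + g t))\<^sup>2)"
  proof (rule Bochner_Integration.integrable_bound)
    show "integrable \<mu> (\<lambda>t. 2 * (cmod (f t))\<^sup>2 + 2 * (cmod (g t))\<^sup>2)" using assms sqint_integrable by auto
    show "AE t in \<mu>. norm ((cmod (f t + g t))\<^sup>2) \<le> norm (2 * (cmod (f t))\<^sup>2 + 2 * (cmod (g t))\<^sup>2)"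
    proof (intro AE_I2)
      fix t
      have "(cmod (f t + g t))\<^sup>2 \<le> (cmod (f t) + cmod (g t))\<^sup>2" by (intro power_mono norm_triangle_ineq) simp
      also have "\<dots> \<le> 2 * (cmod (f t))\<^sup>2 + 2 * (cmod (g t))\<^sup>2"
        using sum_squares_bound[of "cmod (f t)" "cmod (g t)"] by (simp add: power2_sum)
      finally show "norm ((cmod (f t + g t))\<^sup>2) \<le> norm (2 * (cmod (f t))\<^sup>2 + 2 * (cmod (g t))\<^sup>2)" by simp
    qed
  qed (use assms in measurable)
  moreover have "(\<lambda>t. f t + g t) \<in> borel_measurable borel" using assms by measurable
  ultimately show ?thesis by (simp add: sqint_def)
qed

lemma sqint_cmult: "sqint f \<Longrightarrow> sqint (\<lambda>t. c * f t)"
  using sqint_mult_bounded[of f "\<lambda>_. c" "cmod c"] by simp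

lemma sqint_diff: "sqint f \<Longrightarrow> sqint g \<Longrightarrow> sqint (\<lambda>t. f t - g t)"
  using sqint_add[of f "\<lambda>t. (-1) * g t"] sqint_cmult[of g "-1"] by simp

lemma sqint_cnj: "sqint f \<Longrightarrow> sqint (\<lambda>t. cnj (f t))"
  using measurable_compose[OF sqint_measurable borel_measurable_continuous_onI[OF continuous_on_cnj[OF continuous_on_id]]]
  by (simp add: sqint_def)

lemma Cauchy_Schwarz_sqint:
  assumes f: "sqint f" and g: "sqint g"
  shows "(\<integral>t. cmod (f t) * cmod (g t) \<partial>\<mu>)\<^sup>2 \<le> (\<integral>t. (cmod (f t))\<^sup>2 \<partial>\<mu>) * (\<integral>t. (cmod (g t))\<^sup>2 \<partial>\<mu>)"
proof -
  have i: "integrable \<mu> (\<lambda>t. cmod (f t) * cmod (g t))"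
    using integrable_norm[OF sqint_mult_integrable[OF f g]] by (simp add: norm_mult)
  have "ennreal ((\<integral>t. cmod (f t) * cmod (g t) \<partial>\<mu>)\<^sup>2) = (\<integral>\<^sup>+t. ennreal (cmod (f t)) * ennreal (cmod (g t)) \<partial>\<mu>)\<^sup>2"
    using i by (simp add: nn_integral_eq_integral ennreal_power flip: ennreal_mult)
  also have "\<dots> \<le> (\<integral>\<^sup>+t. (ennreal (cmod (f t)))\<^sup>2 \<partial>\<mu>) * (\<integral>\<^sup>+t. (ennreal (cmod (g t)))\<^sup>2 \<partial>\<mu>)"
    by (rule Cauchy_Schwarz_nn_integral) (use f g in measurable)
  also have "\<dots> = ennreal ((\<integral>t. (cmod (f t))\<^sup>2 \<partial>\<mu>) * (\<integral>t. (cmod (g t))\<^sup>2 \<partial>\<mu>))"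
    using f g by (simp add: nn_integral_eq_integral ennreal_power sqint_integrable ennreal_mult)
  finally show ?thesis by (subst (asm) ennreal_le_iff) (auto intro!: mult_nonneg_nonneg integral_nonneg_AE)
qed

text \<open>On a finite measure, Cauchy-Schwarz against 1 turns square-mean Cauchy into mean Cauchy,
  which yields a subsequence converging almost everywhere. Fatou along it controls the distance to
  the limit.\<close>

lemma sqint_complete:
  assumes f: "\<And>n. sqint (f n)"
    and c: "\<And>e. e > 0 \<Longrightarrow> \<exists>N. \<forall>m\<ge>N. \<forall>n\<ge>N. (\<integral>t. (cmod (f m t - f n t))\<^sup>2 \<partial>\<mu>) < e"
  obtains g where "sqint g" "(\<lambda>n. \<integral>t. (cmod (f n t - g t))\<^sup>2 \<partial>\<mu>) \<longlonglongrightarrow> 0"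
proof -
  note [measurable] = sqint_measurable[OF f]
  have one: "sqint (\<lambda>_. 1)" by (rule sqint_bounded[of _ 1]) auto
  have int: "integrable \<mu> (f n)" for n using sqint_mult_integrable[OF f one, of n] by simp
  \<comment> \<open>The summand 1 keeps the divisor positive even for the zero measure.\<close>
  let ?B = "measure \<mu> UNIV + 1"
  have B: "?B > 0" by (simp add: add_nonneg_pos)
  have "\<exists>N. \<forall>i\<ge>N. \<forall>j\<ge>N. (LINT x|\<mu>. norm (f i x - f j x)) < e" if e: "e > 0" for e :: real
  proof -
    have "e\<^sup>2 / ?B > 0" using e B by simp
    from c[OF this] obtain N where N: "\<And>m n. m \<ge> N \<Longrightarrow> n \<ge> N \<Longrightarrow> (\<integral>t. (cmod (f m t - f n t))\<^sup>2 \<partial>\<mu>) < e\<^sup>2 / ?B"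
      by blast
    have "(LINT x|\<mu>. norm (f i x - f j x)) < e" if ij: "i \<ge> N" "j \<ge> N" for i j
    proof -
      have "(LINT x|\<mu>. norm (f i x - f j x))\<^sup>2 \<le> (\<integral>t. (cmod (f i t - f j t))\<^sup>2 \<partial>\<mu>) * measure \<mu> UNIV"
        using Cauchy_Schwarz_sqint[OF sqint_diff[OF f f] one, of i j] by simp
      also have "\<dots> \<le> (\<integral>t. (cmod (f i t - f j t))\<^sup>2 \<partial>\<mu>) * ?B"
        by (intro mult_left_mono) (auto intro!: integral_nonneg_AE)
      also have "\<dots> < e\<^sup>2" using N[OF ij] B by (simp add: field_simps)
      finally show ?thesis using e by (simp add: power2_less_imp_less)
    qed
    then show ?thesis by blast
  qed
  then obtain r where r: "strict_mono r" "AE x in \<mu>. Cauchy (\<lambda>i. f (r i) x)"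
    by (rule cauchy_L1_AE_cauchy_subseq[OF int])
  define g where "g x = lim (\<lambda>i. f (r i) x)" for x
  have g[measurable]: "g \<in> borel_measurable borel" unfolding g_def by (rule borel_measurable_lim_metric) simp
  have lim: "AE x in \<mu>. (\<lambda>i. f (r i) x) \<longlonglongrightarrow> g x"
    using r(2) by eventually_elim (simp add: g_def Cauchy_convergent_iff convergent_LIMSEQ_iff)
  have fatou: "\<exists>N. \<forall>n\<ge>N. (\<integral>\<^sup>+t. ennreal ((cmod (f n t - g t))\<^sup>2) \<partial>\<mu>) \<le> ennreal e" if e: "e > 0" for e
  proof -
    obtain N where N: "\<And>m n. m \<ge> N \<Longrightarrow> n \<ge> N \<Longrightarrow> (\<integral>t. (cmod (f m t - f n t))\<^sup>2 \<partial>\<mu>) < e" using c[OF e] by blast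
    have "(\<integral>\<^sup>+t. ennreal ((cmod (f n t - g t))\<^sup>2) \<partial>\<mu>) \<le> ennreal e" if n: "n \<ge> N" for n
    proof -
      have "(\<integral>\<^sup>+t. ennreal ((cmod (f n t - g t))\<^sup>2) \<partial>\<mu>) = (\<integral>\<^sup>+t. liminf (\<lambda>i. ennreal ((cmod (f n t - f (r i) t))\<^sup>2)) \<partial>\<mu>)"
      proof (rule nn_integral_cong_AE, use lim in eventually_elim)
        fix t assume "(\<lambda>i. f (r i) t) \<longlonglongrightarrow> g t"
        then have "(\<lambda>i. ennreal ((cmod (f n t - f (r i) t))\<^sup>2)) \<longlonglongrightarrow> ennreal ((cmod (f n t - g t))\<^sup>2)"
          by (intro tendsto_intros) auto
        then show "ennreal ((cmod (f n t - g t))\<^sup>2) = liminf (\<lambda>i. ennreal ((cmod (f n t - f (r i) t))\<^sup>2))"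
          by (rule lim_imp_Liminf[OF trivial_limit_sequentially, symmetric])
      qed
      also have "\<dots> \<le> liminf (\<lambda>i. \<integral>\<^sup>+t. ennreal ((cmod (f n t - f (r i) t))\<^sup>2) \<partial>\<mu>)"
        by (rule nn_integral_liminf) measurable
      also have "\<dots> \<le> ennreal e"
      proof (rule Liminf_le)
        show "\<forall>\<^sub>F i in sequentially. (\<integral>\<^sup>+t. ennreal ((cmod (f n t - f (r i) t))\<^sup>2) \<partial>\<mu>) \<le> ennreal e"
          using eventually_ge_at_top[of N]
        proof eventually_elim
          case (elim i)
          then have "r i \<ge> N" using seq_suble[OF r(1), of i] by simp
          then show ?case using N[OF n] sqint_integrable[OF sqint_diff[OF f f]]
            by (simp add: nn_integral_eq_integral ennreal_leI less_imp_le)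
        qed
      qed simp
      finally show ?thesis .
    qed
    then show ?thesis by blast
  qed
  have sq: "sqint (\<lambda>t. f n t - g t)" if "(\<integral>\<^sup>+t. ennreal ((cmod (f n t - g t))\<^sup>2) \<partial>\<mu>) \<le> ennreal e" for n e
    unfolding sqint_def integrable_iff_bounded using that by (auto intro: le_less_trans)
  obtain N where "(\<integral>\<^sup>+t. ennreal ((cmod (f N t - g t))\<^sup>2) \<partial>\<mu>) \<le> ennreal 1" using fatou[of 1] by auto
  from sqint_diff[OF f sq[OF this], of N] have gs: "sqint g" by simp
  have "(\<lambda>n. \<integral>t. (cmod (f n t - g t))\<^sup>2 \<partial>\<mu>) \<longlonglongrightarrow> 0"
  proof (rule LIMSEQ_I)
    fix e :: real assume e: "e > 0"
    then obtain N where N: "\<And>n. n \<ge> N \<Longrightarrow> (\<integral>\<^sup>+t. ennreal ((cmod (f n t - g t))\<^sup>2) \<partial>\<mu>) \<le> ennreal (e / 2)"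
      using fatou[of "e / 2"] by auto
    have "norm ((\<integral>t. (cmod (f n t - g t))\<^sup>2 \<partial>\<mu>) - 0) < e" if "n \<ge> N" for n
    proof -
      have "(\<integral>t. (cmod (f n t - g t))\<^sup>2 \<partial>\<mu>) \<le> e / 2"
        using N[OF that] e sqint_integrable[OF sqint_diff[OF f gs]] by (simp add: nn_integral_eq_integral)
      moreover have "0 \<le> (\<integral>t. (cmod (f n t - g t))\<^sup>2 \<partial>\<mu>)" by (intro integral_nonneg_AE) auto
      ultimately show ?thesis using e by simp
    qed
    then show "\<exists>no. \<forall>n\<ge>no. norm ((\<integral>t. (cmod (f n t - g t))\<^sup>2 \<partial>\<mu>) - 0) < e" by blast
  qed
  with gs that show ?thesis by blast
qed

lemma sqint_integral_tendsto:
  assumes f: "\<And>n. sqint (f n)" and g: "sqint g" and l: "(\<lambda>n. \<integral>t. (cmod (f n t - g t))\<^sup>2 \<partial>\<mu>) \<longlonglongrightarrow> 0"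
    and h: "sqint h"
  shows "(\<lambda>n. \<integral>t. f n t * h t \<partial>\<mu>) \<longlonglongrightarrow> (\<integral>t. g t * h t \<partial>\<mu>)"
proof -
  have "(\<lambda>n. (\<integral>t. f n t * h t \<partial>\<mu>) - (\<integral>t. g t * h t \<partial>\<mu>)) \<longlonglongrightarrow> 0"
  proof (rule Lim_null_comparison)
    have "norm ((\<integral>t. f n t * h t \<partial>\<mu>) - (\<integral>t. g t * h t \<partial>\<mu>))
        \<le> sqrt ((\<integral>t. (cmod (f n t - g t))\<^sup>2 \<partial>\<mu>) * (\<integral>t. (cmod (h t))\<^sup>2 \<partial>\<mu>))" for n
    proof -
      have "(\<integral>t. f n t * h t \<partial>\<mu>) - (\<integral>t. g t * h t \<partial>\<mu>) = (\<integral>t. (f n t - g t) * h t \<partial>\<mu>)"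
        using f g h by (simp add: sqint_mult_integrable left_diff_distrib)
      also have "norm \<dots> \<le> (\<integral>t. norm ((f n t - g t) * h t) \<partial>\<mu>)" by (rule integral_norm_bound)
      also have "\<dots> \<le> sqrt ((\<integral>t. (cmod (f n t - g t))\<^sup>2 \<partial>\<mu>) * (\<integral>t. (cmod (h t))\<^sup>2 \<partial>\<mu>))"
        using Cauchy_Schwarz_sqint[OF sqint_diff[OF f g] h] by (intro real_le_rsqrt) (simp add: norm_mult)
      finally show ?thesis .
    qed
    then show "\<forall>\<^sub>F n in sequentially. norm ((\<integral>t. f n t * h t \<partial>\<mu>) - (\<integral>t. g t * h t \<partial>\<mu>))
        \<le> sqrt ((\<integral>t. (cmod (f n t - g t))\<^sup>2 \<partial>\<mu>) * (\<integral>t. (cmod (h t))\<^sup>2 \<partial>\<mu>))" by simp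
    show "(\<lambda>n. sqrt ((\<integral>t. (cmod (f n t - g t))\<^sup>2 \<partial>\<mu>) * (\<integral>t. (cmod (h t))\<^sup>2 \<partial>\<mu>))) \<longlonglongrightarrow> 0"
      using tendsto_real_sqrt[OF tendsto_mult_right[OF l, of "\<integral>t. (cmod (h t))\<^sup>2 \<partial>\<mu>"]] by simp
  qed
  then show ?thesis by (rule LIM_zero_cancel)
qed

lemma bounded_mult_integrable:
  fixes h :: "real \<Rightarrow> complex"
  assumes h: "integrable \<mu> h" and g: "g \<in> borel_measurable borel" "\<And>t. cmod (g t) \<le> B"
  shows "integrable \<mu> (\<lambda>t. g t * h t)"
proof (rule Bochner_Integration.integrable_bound)
  show "integrable \<mu> (\<lambda>t. B * norm (h t))" using h by simp
  have B: "0 \<le> B" using g(2)[of 0] norm_ge_zero order_trans by blast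
  show "AE t in \<mu>. norm (g t * h t) \<le> norm (B * norm (h t))"
    using g(2) B by (intro AE_I2) (auto simp: norm_mult intro!: mult_right_mono)
qed (use h g in measurable)

section \<open>Uniqueness for trigonometric moments on the line\<close>

lemma zeta_powi_measurable[measurable]: "(\<lambda>t. zeta t powi n) \<in> borel_measurable borel"
  unfolding power_int_def by measurable

lemma norm_zeta_powi[simp]: "cmod (zeta t powi n) = 1"
  by (simp add: norm_power_int)

lemma zeta_nz[simp]: "zeta t \<noteq> 0"
  by (metis norm_zeta norm_zero zero_neq_one)

lemma cnj_zeta: "cnj (zeta t) = inverse (zeta t)"
proof -
  have "zeta t * cnj (zeta t) = 1" using complex_norm_square[of "zeta t"] by simp
  then show ?thesis by (simp add: field_simps)
qed

lemma cnj_zeta_powi: "cnj (zeta t powi n) = zeta t powi (- n)"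
  by (simp add: cnj_zeta power_int_minus power_int_inverse)

text \<open>Exponents of both signs occur, so multiplication by \<open>zeta\<close> and by its
  conjugate maps the set into itself. The aim is \<open>annihilator_eq_0\<close>.\<close>

definition annihilator where
  "annihilator = {h. integrable \<mu> h \<and> (\<forall>n. (\<integral>t. zeta t powi n * h t \<partial>\<mu>) = 0)}"

lemma annihilator_bounded: "integrable \<mu> h \<Longrightarrow> integrable \<mu> (\<lambda>t. zeta t powi n * h t)"
  by (rule bounded_mult_integrable[of _ _ 1]) auto

lemma annihilator_add: "h \<in> annihilator \<Longrightarrow> k \<in> annihilator \<Longrightarrow> (\<lambda>t. h t + k t) \<in> annihilator"
  using annihilator_bounded by (auto simp: annihilator_def distrib_left)

lemma annihilator_cmult: "h \<in> annihilator \<Longrightarrow> (\<lambda>t. c * h t) \<in> annihilator"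
  by (auto simp: annihilator_def mult.left_commute[of _ c])

lemma annihilator_zeta: assumes h: "h \<in> annihilator" shows "(\<lambda>t. zeta t powi m * h t) \<in> annihilator"
proof -
  have "(\<integral>t. zeta t powi n * (zeta t powi m * h t) \<partial>\<mu>) = (\<integral>t. zeta t powi (n + m) * h t \<partial>\<mu>)" for n
    by (simp add: power_int_add mult.assoc)
  then show ?thesis using h annihilator_bounded by (auto simp: annihilator_def)
qed

text \<open>The annihilator of all powers of \<open>zeta\<close> is closed under multiplication by polynomials in the real and
  imaginary parts of \<open>zeta\<close>; this avoids any bookkeeping with trigonometric polynomials.\<close>

lemma annihilator_polynomial:
  fixes p :: "complex \<Rightarrow> real"
  assumes "real_polynomial_function p" "h \<in> annihilator"
  shows "(\<lambda>t. of_real (p (zeta t)) * h t) \<in> annihilator"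
  using assms
proof (induction arbitrary: h)
  case (linear p)
  interpret bounded_linear p by fact
  \<comment> \<open>A real-linear functional is a complex combination of z and its conjugate, and on
    the circle the conjugate is the inverse.\<close>
  have "of_real (p (zeta t)) * h t = (of_real (p 1) / 2 - \<i> * of_real (p \<i>) / 2) * (zeta t powi 1 * h t)
      + (of_real (p 1) / 2 + \<i> * of_real (p \<i>) / 2) * (zeta t powi (-1) * h t)" for t
  proof -
    have "zeta t = Re (zeta t) *\<^sub>R 1 + Im (zeta t) *\<^sub>R \<i>" by (simp add: complex_eq_iff)
    then have "p (zeta t) = Re (zeta t) * p 1 + Im (zeta t) * p \<i>" by (metis add scaleR real_scaleR_def)
    then have "of_real (p (zeta t)) = (of_real (p 1) / 2 - \<i> * of_real (p \<i>) / 2) * zeta t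
      + (of_real (p 1) / 2 + \<i> * of_real (p \<i>) / 2) * cnj (zeta t)"
      by (simp add: complex_eq_iff algebra_simps)
    moreover have "zeta t powi 1 = zeta t" "zeta t powi (-1) = cnj (zeta t)" by (simp_all add: cnj_zeta)
    ultimately show ?thesis by (simp only: distrib_right mult.assoc)
  qed
  then show ?case using linear.prems
    by (simp only:) (intro annihilator_add annihilator_cmult annihilator_zeta)
next
  case (const c)
  then show ?case by (rule annihilator_cmult)
next
  case (add p q)
  then show ?case using annihilator_add[OF add.IH(1) add.IH(2)] by (simp add: distrib_right)
next
  case (mult p q)
  then show ?case using mult.IH(1)[OF mult.IH(2)] by (simp add: mult.assoc)
qed

text \<open>By Stone-Weierstrass on the circle, polynomials in the real and imaginary parts
  approximate \<open>F\<close> uniformly, and each of them integrates to 0 against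
  \<open>h\<close>.\<close>

lemma annihilator_continuous:
  fixes F :: "complex \<Rightarrow> real"
  assumes h: "h \<in> annihilator" and F: "continuous_on UNIV F"
  shows "integrable \<mu> (\<lambda>t. of_real (F (zeta t)) * h t)" "(\<integral>t. of_real (F (zeta t)) * h t \<partial>\<mu>) = 0"
proof -
  have hi: "integrable \<mu> h" using h by (simp add: annihilator_def)
  have z: "zeta t \<in> sphere 0 1" for t by simp
  obtain B where B: "\<And>z. z \<in> sphere 0 1 \<Longrightarrow> \<bar>F z\<bar> \<le> B"
    using compact_imp_bounded[OF compact_continuous_image[OF continuous_on_subset[OF F] compact_sphere, of 0 1]]
    by (auto simp: bounded_iff) (metis mem_sphere_0)
  have [measurable]: "F \<in> borel_measurable borel" using F by (rule borel_measurable_continuous_onI)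
  show Fi: "integrable \<mu> (\<lambda>t. of_real (F (zeta t)) * h t)"
    by (rule bounded_mult_integrable[OF hi, of _ B]) (use B z in auto)
  have le: "norm (\<integral>t. of_real (F (zeta t)) * h t \<partial>\<mu>) \<le> e * (\<integral>t. norm (h t) \<partial>\<mu>)" if e: "e > 0" for e
  proof -
    obtain p where p: "real_polynomial_function p" "\<And>z. z \<in> sphere 0 1 \<Longrightarrow> \<bar>F z - p z\<bar> < e"
      using Stone_Weierstrass_real_polynomial_function[OF compact_sphere continuous_on_subset[OF F] e, of 0 1] by auto
    have "(\<lambda>t. of_real (p (zeta t)) * h t) \<in> annihilator" by (rule annihilator_polynomial[OF p(1) h])
    then have pi: "integrable \<mu> (\<lambda>t. of_real (p (zeta t)) * h t)" "(\<integral>t. of_real (p (zeta t)) * h t \<partial>\<mu>) = 0"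
      by (auto simp: annihilator_def dest: spec[of _ 0])
    have "(\<integral>t. of_real (F (zeta t)) * h t \<partial>\<mu>) = (\<integral>t. of_real (F (zeta t)) * h t - of_real (p (zeta t)) * h t \<partial>\<mu>)"
      using Fi pi by simp
    also have "norm \<dots> \<le> (\<integral>t. e * norm (h t) \<partial>\<mu>)"
    proof (rule order_trans[OF integral_norm_bound], rule integral_mono)
      show "norm (of_real (F (zeta t)) * h t - of_real (p (zeta t)) * h t) \<le> e * norm (h t)" for t
        using p(2)[OF z, of t] by (simp add: norm_mult mult_right_mono flip: left_diff_distrib of_real_diff)
    qed (use Fi pi hi in auto)
    finally show ?thesis by simp
  qed
  have "norm (\<integral>t. of_real (F (zeta t)) * h t \<partial>\<mu>) \<le> 0"
  proof (rule field_le_epsilon)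
    fix e :: real assume e: "0 < e"
    let ?N = "(\<integral>t. norm (h t) \<partial>\<mu>)"
    have N: "0 \<le> ?N" by (intro integral_nonneg_AE) auto
    have "0 < e / (?N + 1)" using e N by (intro divide_pos_pos) linarith+
    then have "norm (\<integral>t. of_real (F (zeta t)) * h t \<partial>\<mu>) \<le> e / (?N + 1) * ?N" by (rule le)
    also have "\<dots> = e * (?N / (?N + 1))" by simp
    also have "?N / (?N + 1) \<le> 1" using N by (subst divide_le_eq_1_pos) linarith+
    then have "e * (?N / (?N + 1)) \<le> e * 1" using e by (intro mult_left_mono) simp_all
    finally show "norm (\<integral>t. of_real (F (zeta t)) * h t \<partial>\<mu>) \<le> 0 + e" by simp
  qed
  then show "(\<integral>t. of_real (F (zeta t)) * h t \<partial>\<mu>) = 0" by simp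
qed

text \<open>Indicators of closed sets are limits of continuous functions of the distance;
  complements and disjoint unions follow by a Dynkin argument.\<close>

lemma annihilator_indicator:
  assumes h: "h \<in> annihilator" and A: "A \<in> sets borel"
  shows "(\<integral>t. indicator A (zeta t) * h t \<partial>\<mu>) = 0"
proof -
  have hi: "integrable \<mu> h" using h by (simp add: annihilator_def)
  have ind_int: "integrable \<mu> (\<lambda>t. indicator B (zeta t) * h t)" if [measurable]: "B \<in> sets borel" for B
    by (rule bounded_mult_integrable[OF hi, of _ 1]) (auto simp: indicator_def)
  have "Int_stable (Collect (closed :: complex set \<Rightarrow> bool))" by (auto simp: Int_stable_def)
  moreover have "Collect (closed :: complex set \<Rightarrow> bool) \<subseteq> Pow UNIV" by simp
  moreover have "A \<in> sigma_sets UNIV (Collect closed)"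
    using A unfolding borel_eq_closed by simp
  ultimately show ?thesis
  proof (induction rule: sigma_sets_induct_disjoint)
    case (basic C)
    show ?case
    \<comment> \<open>The distance to the empty set is 0 by convention, so the functions
      \<open>F k\<close> would be constantly 1 for it.\<close>
    proof (cases "C = {}")
      case False
      define F where "F k z = max 0 (1 - real k * infdist z C)" for k z
      have "(\<lambda>k. \<integral>t. of_real (F k (zeta t)) * h t \<partial>\<mu>) \<longlonglongrightarrow> (\<integral>t. indicator C (zeta t) * h t \<partial>\<mu>)"
      proof (rule integral_dominated_convergence[where w = "\<lambda>t. norm (h t)"])
        show "AE t in \<mu>. (\<lambda>k. of_real (F k (zeta t)) * h t) \<longlonglongrightarrow> indicator C (zeta t) * h t"
        proof (intro AE_I2 tendsto_mult_right)
          fix t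
          show "(\<lambda>k. complex_of_real (F k (zeta t))) \<longlonglongrightarrow> indicator C (zeta t)"
          proof (cases "zeta t \<in> C")
            case True
            then show ?thesis by (simp add: F_def)
          next
            case False
            then have pos: "infdist (zeta t) C > 0"
              using basic \<open>C \<noteq> {}\<close> by (metis in_closed_iff_infdist_zero infdist_nonneg mem_Collect_eq order_le_less)
            obtain N where N: "real N > 1 / infdist (zeta t) C" using reals_Archimedean2 by blast
            have "F k (zeta t) = 0" if "k \<ge> N" for k
            proof -
              have "real k > 1 / infdist (zeta t) C" using N that by linarith
              then show ?thesis using pos by (simp add: F_def field_simps)
            qed
            then have "\<forall>\<^sub>F k in sequentially. complex_of_real (F k (zeta t)) = 0"
              unfolding eventually_sequentially by auto
            then show ?thesis using False by (simp add: tendsto_eventually)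
          qed
        qed
        show "AE t in \<mu>. norm (of_real (F k (zeta t)) * h t) \<le> norm (h t)" for k
          by (intro AE_I2) (auto simp: norm_mult F_def infdist_nonneg max_def intro!: mult_left_le_one_le)
        show "(\<lambda>t. indicator C (zeta t) * h t) \<in> borel_measurable \<mu>"
          using basic ind_int[of C] by (auto simp: borel_measurable_integrable)
        have F: "continuous_on UNIV (F k)" for k unfolding F_def by (intro continuous_intros)
        show "(\<lambda>t. of_real (F k (zeta t)) * h t) \<in> borel_measurable \<mu>" for k
          using annihilator_continuous(1)[OF h F] by (rule borel_measurable_integrable)
      qed (use hi in simp)
      moreover have "(\<integral>t. of_real (F k (zeta t)) * h t \<partial>\<mu>) = 0" for k
        by (rule annihilator_continuous(2)[OF h]) (auto simp: F_def intro!: continuous_intros)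
      ultimately show ?thesis by (simp add: LIMSEQ_const_iff)
    qed simp
  next
    case (compl A)
    then have A: "A \<in> sets borel" unfolding borel_eq_closed by simp
    have "(\<integral>t. indicator (UNIV - A) (zeta t) * h t \<partial>\<mu>) = (\<integral>t. h t - indicator A (zeta t) * h t \<partial>\<mu>)"
      by (intro Bochner_Integration.integral_cong) (auto simp: indicator_def)
    also have "\<dots> = (\<integral>t. h t \<partial>\<mu>)" using compl ind_int[OF A] hi by simp
    also have "\<dots> = 0" using h by (auto simp: annihilator_def dest: spec[of _ 0])
    finally show ?case .
  next
    case (union A)
    then have A[measurable]: "A i \<in> sets borel" for i unfolding borel_eq_closed by auto
    have "(\<lambda>n. \<integral>t. indicator (\<Union>i<n. A i) (zeta t) * h t \<partial>\<mu>) \<longlonglongrightarrow> (\<integral>t. indicator (\<Union>i. A i) (zeta t) * h t \<partial>\<mu>)"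
    proof (rule integral_dominated_convergence[where w = "\<lambda>t. norm (h t)"])
      show "AE t in \<mu>. (\<lambda>n. indicator (\<Union>i<n. A i) (zeta t) * h t) \<longlonglongrightarrow> indicator (\<Union>i. A i) (zeta t) * h t"
        by (intro AE_I2 tendsto_mult_right LIMSEQ_indicator_UN)
      show "AE t in \<mu>. norm (indicator (\<Union>i<n. A i) (zeta t) * h t) \<le> norm (h t)" for n
        by (intro AE_I2) (auto simp: norm_mult indicator_def)
      show "(\<lambda>t. indicator (\<Union>i. A i) (zeta t) * h t) \<in> borel_measurable \<mu>"
        by (rule borel_measurable_integrable[OF ind_int]) (use A in auto)
      show "(\<lambda>t. indicator (\<Union>i<n. A i) (zeta t) * h t) \<in> borel_measurable \<mu>" for n
        by (rule borel_measurable_integrable[OF ind_int]) (use A in auto)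
    qed (use hi in simp)
    moreover have "(\<integral>t. indicator (\<Union>i<n. A i) (zeta t) * h t \<partial>\<mu>) = 0" for n
    proof -
      have "(\<integral>t. indicator (\<Union>i<n. A i) (zeta t) * h t \<partial>\<mu>) = (\<integral>t. (\<Sum>i<n. indicator (A i) (zeta t) * h t) \<partial>\<mu>)"
        using union(1) by (subst indicator_UN_disjoint) (auto simp: disjoint_family_on_def sum_distrib_right)
      also have "\<dots> = (\<Sum>i<n. \<integral>t. indicator (A i) (zeta t) * h t \<partial>\<mu>)"
        by (rule Bochner_Integration.integral_sum) (rule ind_int[OF A])
      also have "\<dots> = 0" using union(3) by simp
      finally show ?thesis .
    qed
    ultimately show ?case by (simp add: LIMSEQ_const_iff)
  qed simp
qed

text \<open>\<open>\<tau>\<close> inverts \<open>zeta\<close>, so a Borel set of the line is the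
  preimage under \<open>zeta\<close> of a Borel set of the plane. The test set is where the real
  part of \<open>h\<close> is positive.\<close>

lemma annihilator_Re_le:
  assumes h: "h \<in> annihilator" and [measurable]: "h \<in> borel_measurable borel"
  shows "AE t in \<mu>. Re (h t) \<le> 0"
proof -
  define \<tau> where "\<tau> z = Re (\<i> * (1 + z) / (1 - z))" for z
  have \<tau>: "\<tau> (zeta t) = t" for t
  proof -
    have "\<i> * (1 + zeta t) / (1 - zeta t) = of_real t"
      unfolding zeta_def using real_plus_i[of t] by (simp add: divide_simps)
    then show ?thesis by (simp add: \<tau>_def)
  qed
  have [measurable]: "\<tau> \<in> borel_measurable borel" unfolding \<tau>_def by measurable
  define A where "A = {z. 0 < Re (h (\<tau> z))}"
  have [measurable]: "A \<in> sets borel" unfolding A_def by measurable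
  have hi: "integrable \<mu> h" using h by (simp add: annihilator_def)
  have ii: "integrable \<mu> (\<lambda>t. indicator A (zeta t) * h t)"
    by (rule bounded_mult_integrable[OF hi, of _ 1]) (auto simp: indicator_def)
  have "(\<integral>t. Re (indicator A (zeta t) * h t) \<partial>\<mu>) = 0"
    using ii annihilator_indicator[OF h, of A] by (simp del: times_complex.sel)
  moreover have "0 \<le> Re (indicator A (zeta t) * h t)" for t
    by (auto simp: A_def indicator_def \<tau>)
  ultimately have "AE t in \<mu>. Re (indicator A (zeta t) * h t) = 0"
    using ii by (subst (asm) integral_nonneg_eq_0_iff_AE) (auto simp del: times_complex.sel)
  then show ?thesis
  proof eventually_elim
    case (elim t)
    then show ?case by (cases "0 < Re (h t)") (auto simp: A_def indicator_def \<tau>)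
  qed
qed

text \<open>The factors 1, -1, \<i> and -\<i> bound the real and imaginary parts from both
  sides.\<close>

lemma annihilator_eq_0:
  assumes h: "h \<in> annihilator" and m: "h \<in> borel_measurable borel"
  shows "AE t in \<mu>. h t = 0"
proof -
  have "(\<lambda>t. c * h t) \<in> borel_measurable borel" for c using m by measurable
  then have "AE t in \<mu>. Re (c * h t) \<le> 0" for c
    by (rule annihilator_Re_le[OF annihilator_cmult[OF h]])
  from this[of 1] this[of "-1"] this[of \<i>] this[of "-\<i>"] show ?thesis
    by eventually_elim (simp add: complex_eq_iff)
qed

end

section \<open>The spectral representation of a cyclic subspace\<close>

locale spectral = cunitary I W + finite_borel \<mu>
  for I W :: "'h::{real_inner, complete_space} \<Rightarrow> 'h" and \<mu> +
  fixes e :: 'h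
  assumes moments: "(\<integral>t. zeta t ^ k \<partial>\<mu>) = \<langle>(W ^^ k) e, e\<rangle>"
begin

section \<open>The two-sided orbit of \<open>e\<close> and the functions that represent
  vectors\<close>

lemma inj_W: "inj W"
proof (rule injI)
  fix x y assume "W x = W y"
  then show "x = y" using norm_W[of "x - y"] by (simp del: norm_W)
qed

definition u :: "int \<Rightarrow> 'h" where
  "u n = (if 0 \<le> n then (W ^^ nat n) e else (inv W ^^ nat (- n)) e)"

lemma u_0: "u 0 = e" by (simp add: u_def)

lemma W_u: "W (u n) = u (n + 1)"
proof (cases "0 \<le> n")
  case True
  then show ?thesis by (simp add: u_def nat_add_distrib)
next
  case False
  define k where "k = nat (- n - 1)"
  have n: "n = - int (Suc k)" using False by (simp add: k_def)
  have "u n = inv W ((inv W ^^ k) e)" unfolding n by (simp add: u_def nat_add_distrib)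
  then have "W (u n) = (inv W ^^ k) e" by (simp add: surj_f_inv_f surj_W)
  also have "\<dots> = u (n + 1)" unfolding n by (cases k) (auto simp: u_def nat_add_distrib)
  finally show ?thesis .
qed

lemma cip_u_shift: "\<langle>u (m + int k), u (n + int k)\<rangle> = \<langle>u m, u n\<rangle>"
proof (induction k)
  case (Suc k)
  have "\<langle>u (m + int (Suc k)), u (n + int (Suc k))\<rangle> = \<langle>W (u (m + int k)), W (u (n + int k))\<rangle>"
    unfolding W_u by (simp add: add.commute add.left_commute)
  then show ?case using Suc by simp
qed simp

text \<open>Moments are given for nonnegative powers. Shifting along the orbit leaves only the
  difference of the exponents, and conjugation supplies the negative ones.\<close>

lemma cip_u: "\<langle>u m, u n\<rangle> = (\<integral>t. zeta t powi (m - n) \<partial>\<mu>)"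
proof -
  have pos: "\<langle>u (int k + n), u n\<rangle> = (\<integral>t. zeta t powi (int k) \<partial>\<mu>)" for k n
  proof -
    have "\<langle>u (int k + n), u n\<rangle> = \<langle>u (int k), u 0\<rangle>"
    proof (cases "0 \<le> n")
      case True
      then show ?thesis using cip_u_shift[of "int k" "nat n" 0] by simp
    next
      case False
      then show ?thesis using cip_u_shift[of "int k + n" "nat (- n)" n] by simp
    qed
    then show ?thesis using moments by (simp add: u_0) (simp add: u_def)
  qed
  show ?thesis
  proof (cases "n \<le> m")
    case True
    then show ?thesis using pos[of "nat (m - n)" n] by simp
  next
    case False
    then have "\<langle>u n, u m\<rangle> = (\<integral>t. zeta t powi (n - m) \<partial>\<mu>)" using pos[of "nat (n - m)" m] by simp
    then have "\<langle>u m, u n\<rangle> = cnj (\<integral>t. zeta t powi (n - m) \<partial>\<mu>)" by (metis cnj_cip)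
    also have "\<dots> = (\<integral>t. cnj (zeta t powi (n - m)) \<partial>\<mu>)" by (simp only: Bochner_Integration.integral_cnj)
    finally show ?thesis by (simp only: cnj_zeta_powi minus_diff_eq)
  qed
qed

text \<open>\<open>f\<close> has the moments of \<open>x\<close> along the orbit, so it represents
  the projection of \<open>x\<close> onto the cyclic subspace and ignores the orthogonal part. As a
  relation it postpones the choice of a representative to \<open>\<phi>\<close>.\<close>

definition R :: "'h \<Rightarrow> (real \<Rightarrow> complex) \<Rightarrow> bool" where
  "R x f \<longleftrightarrow> sqint f \<and> (\<forall>n. \<langle>x, u n\<rangle> = (\<integral>t. f t * zeta t powi (- n) \<partial>\<mu>))"

lemma sqint_powi: "sqint (\<lambda>t. zeta t powi n)"
  by (rule sqint_bounded[of _ 1]) auto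

lemma sqint_powi_integrable: "sqint f \<Longrightarrow> integrable \<mu> (\<lambda>t. f t * zeta t powi n)"
  by (rule sqint_mult_integrable[OF _ sqint_powi])

lemma R_sqint: "R x f \<Longrightarrow> sqint f"
  by (simp add: R_def)

lemma R_add: "R x f \<Longrightarrow> R y g \<Longrightarrow> R (x + y) (\<lambda>t. f t + g t)"
  unfolding R_def by (auto simp: sqint_add cip_add_left distrib_right sqint_powi_integrable)

lemma R_csc: "R x f \<Longrightarrow> R (c \<odot> x) (\<lambda>t. c * f t)"
  unfolding R_def by (auto simp: sqint_cmult cip_csc_left mult.assoc)

lemma R_minus: "R x f \<Longrightarrow> R (- x) (\<lambda>t. - f t)"
  using R_csc[of x f "-1"] by simp

lemma R_diff: "R x f \<Longrightarrow> R y g \<Longrightarrow> R (x - y) (\<lambda>t. f t - g t)"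
  using R_add[of x f "- y" "\<lambda>t. - g t"] R_minus by simp

lemma R_W: assumes "R x f" shows "R (W x) (\<lambda>t. zeta t * f t)"
proof -
  have "\<langle>W x, u n\<rangle> = (\<integral>t. zeta t * f t * zeta t powi (- n) \<partial>\<mu>)" for n
  proof -
    have "\<langle>W x, u n\<rangle> = \<langle>W x, W (u (n - 1))\<rangle>" by (simp add: W_u del: cip_W)
    also have "\<dots> = (\<integral>t. f t * zeta t powi (- (n - 1)) \<partial>\<mu>)" using assms by (simp add: R_def)
    also have "\<dots> = (\<integral>t. zeta t * f t * zeta t powi (- n) \<partial>\<mu>)"
      by (intro Bochner_Integration.integral_cong refl) (simp add: power_int_diff power_int_minus field_simps)
    finally show ?thesis .
  qed
  moreover have "sqint (\<lambda>t. zeta t * f t)"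
    using assms by (intro sqint_mult_bounded[of _ _ 1]) (auto simp: R_def)
  ultimately show ?thesis by (simp add: R_def)
qed

lemma R_u: "R (u n) (\<lambda>t. zeta t powi n)"
  by (simp add: R_def sqint_powi cip_u flip: power_int_add)

lemma R_cong: "R x f \<Longrightarrow> g \<in> borel_measurable borel \<Longrightarrow> AE t in \<mu>. f t = g t \<Longrightarrow> R x g"
proof -
  assume R: "R x f" and g: "g \<in> borel_measurable borel" and eq: "AE t in \<mu>. f t = g t"
  note [measurable] = g sqint_measurable[OF R_sqint[OF R]]
  have "integrable \<mu> (\<lambda>t. (cmod (g t))\<^sup>2)"
    by (rule integrable_cong_AE_imp[OF sqint_integrable[OF R_sqint[OF R]]]) (use eq in auto)
  moreover have "(\<integral>t. f t * zeta t powi (- n) \<partial>\<mu>) = (\<integral>t. g t * zeta t powi (- n) \<partial>\<mu>)" for n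
    by (rule integral_cong_AE) (use eq in auto)
  ultimately show "R x g" using R g by (auto simp: R_def sqint_def)
qed

lemma R_zero_unique: assumes "R x f" "\<And>n. \<langle>x, u n\<rangle> = 0" shows "AE t in \<mu>. f t = 0"
proof (rule annihilator_eq_0)
  have "(\<integral>t. zeta t powi n * f t \<partial>\<mu>) = 0" for n
    using assms(1) assms(2)[of "- n"] by (simp add: R_def mult.commute)
  then show "f \<in> annihilator"
    using sqint_powi_integrable[OF R_sqint[OF assms(1)], of 0] by (simp add: annihilator_def)
  show "f \<in> borel_measurable borel" using R_sqint[OF assms(1)] by (rule sqint_measurable)
qed

lemma R_unique: assumes "R x f" "R x g" shows "AE t in \<mu>. f t = g t"
  using R_zero_unique[OF R_diff[OF assms]] by simp

text \<open>Finite combinations of the orbit together with the same combinations of powers of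
  \<open>zeta\<close>. Generating both at once avoids proving that the function depends on the
  vector alone.\<close>

inductive trig :: "'h \<Rightarrow> (real \<Rightarrow> complex) \<Rightarrow> bool" where
  trig_zero: "trig 0 (\<lambda>_. 0)"
| trig_step: "trig x f \<Longrightarrow> trig (x + c \<odot> u n) (\<lambda>t. f t + c * zeta t powi n)"

lemma R_zero: "R 0 (\<lambda>_. 0)"
  using sqint_bounded[of "\<lambda>_. 0" 0] by (simp add: R_def)

lemma trig_R: "trig x f \<Longrightarrow> R x f"
  by (induction rule: trig.induct) (rule R_zero, rule R_add[OF _ R_csc[OF R_u]])

lemma trig_cip: "trig x f \<Longrightarrow> R y g \<Longrightarrow> \<langle>x, y\<rangle> = (\<integral>t. f t * cnj (g t) \<partial>\<mu>)"
proof (induction rule: trig.induct)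
  case (trig_step x f c n)
  have g: "sqint (\<lambda>t. cnj (g t))" using trig_step(3) R_sqint sqint_cnj by blast
  have f: "sqint f" using trig_R[OF trig_step(1)] by (rule R_sqint)
  have "\<langle>u n, y\<rangle> = cnj \<langle>y, u n\<rangle>" by (simp add: cnj_cip)
  also have "\<dots> = (\<integral>t. cnj (g t * zeta t powi (- n)) \<partial>\<mu>)" using trig_step(3) unfolding R_def by (simp only: Bochner_Integration.integral_cnj)
  also have "\<dots> = (\<integral>t. zeta t powi n * cnj (g t) \<partial>\<mu>)" by (simp only: complex_cnj_mult cnj_zeta_powi minus_minus mult.commute)
  finally have "\<langle>u n, y\<rangle> = (\<integral>t. zeta t powi n * cnj (g t) \<partial>\<mu>)" .
  then show ?case using trig_step sqint_mult_integrable[OF f g] sqint_mult_integrable[OF sqint_powi g]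
    by (simp add: cip_simps distrib_right mult.assoc)
qed simp

definition S where "S = {x. \<exists>f. trig x f}"
definition K where "K = closure S"

lemma S_add: "x \<in> S \<Longrightarrow> y \<in> S \<Longrightarrow> x + y \<in> S"
proof -
  have "trig y g \<Longrightarrow> x \<in> S \<Longrightarrow> x + y \<in> S" for g
  proof (induction arbitrary: x rule: trig.induct)
    case (trig_step y g c n)
    then obtain h where "trig (x + y) h" by (auto simp: S_def)
    then show ?case unfolding S_def add.assoc[symmetric] by (blast intro: trig.trig_step)
  qed simp
  then show "x \<in> S \<Longrightarrow> y \<in> S \<Longrightarrow> x + y \<in> S" by (auto simp: S_def)
qed

lemma S_csc: "x \<in> S \<Longrightarrow> c \<odot> x \<in> S"
proof -
  have "trig x f \<Longrightarrow> c \<odot> x \<in> S" for f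
  proof (induction rule: trig.induct)
    case trig_zero
    then show ?case using trig.trig_zero by (auto simp: S_def)
  next
    case (trig_step x f d n)
    then obtain h where "trig (c \<odot> x) h" by (auto simp: S_def)
    then show ?case by (auto simp: S_def vs.scale_right_distrib intro: trig.trig_step)
  qed
  then show "x \<in> S \<Longrightarrow> c \<odot> x \<in> S" by (auto simp: S_def)
qed

lemma u_S: "u n \<in> S"
  using trig_step[OF trig_zero, of 1 n] by (auto simp: S_def)

lemma subspace_K: "subspace K"
  unfolding K_def
proof (rule subspace_closure, rule subspaceI)
  show "0 \<in> S" using trig_zero by (auto simp: S_def)
  show "c *\<^sub>R x \<in> S" if "x \<in> S" for c x using S_csc[OF that, of "of_real c"] by (simp add: csc_of_real)
qed (rule S_add)

lemma closed_K: "closed K" by (simp add: K_def)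

lemma u_K: "u n \<in> K" "I (u n) \<in> K"
  using u_S S_csc[OF u_S, of \<i>] closure_subset by (auto simp: K_def csc_i)

lemma K_orthogonal: assumes "x \<in> K" "\<And>n. \<langle>u n, y\<rangle> = 0" shows "\<langle>x, y\<rangle> = 0"
proof -
  have "trig x f \<Longrightarrow> \<langle>x, y\<rangle> = 0" for x f
    by (induction rule: trig.induct) (auto simp: cip_simps assms(2))
  then have "S \<subseteq> {x. \<langle>x, y\<rangle> = 0}" by (auto simp: S_def)
  moreover have "closed {x. \<langle>x, y\<rangle> = 0}"
    by (intro closed_Collect_eq continuous_on_const bounded_linear.continuous_on[OF bounded_linear_cip_left] continuous_on_id)
  ultimately show ?thesis using assms(1) closure_minimal unfolding K_def by blast
qed

text \<open>On finite combinations the correspondence is isometric, so it preserves Cauchy sequences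
  and extends to the closure by completeness on the function side.\<close>

lemma R_on_K:
  assumes "x \<in> K"
  shows "\<exists>f. R x f \<and> (\<forall>y g. R y g \<longrightarrow> \<langle>x, y\<rangle> = (\<integral>t. f t * cnj (g t) \<partial>\<mu>))"
proof -
  obtain s where s: "\<And>n. s n \<in> S" "s \<longlonglongrightarrow> x" using assms unfolding K_def closure_sequential by blast
  then have "\<forall>n. \<exists>f. trig (s n) f" unfolding S_def by auto
  then obtain f where f: "\<And>n. trig (s n) (f n)" by metis
  have fsq: "sqint (f n)" for n using trig_R[OF f] by (rule R_sqint)
  have dist: "(\<integral>t. (cmod (f m t - f n t))\<^sup>2 \<partial>\<mu>) = (norm (s m - s n))\<^sup>2" for m n
  proof -
    have Rd: "R (s m - s n) (\<lambda>t. f m t - f n t)" by (intro R_diff trig_R f)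
    have d: "sqint (\<lambda>t. cnj (f m t - f n t))" using Rd R_sqint sqint_cnj by blast
    have "complex_of_real ((norm (s m - s n))\<^sup>2) = \<langle>s m - s n, s m - s n\<rangle>" by (simp add: cip_self)
    also have "\<dots> = (\<integral>t. f m t * cnj (f m t - f n t) \<partial>\<mu>) - (\<integral>t. f n t * cnj (f m t - f n t) \<partial>\<mu>)"
      unfolding cip_diff_left[of "s m" "s n"] trig_cip[OF f Rd] ..
    also have "\<dots> = (\<integral>t. f m t * cnj (f m t - f n t) - f n t * cnj (f m t - f n t) \<partial>\<mu>)"
      by (rule Bochner_Integration.integral_diff[symmetric]) (intro sqint_mult_integrable fsq d)+
    also have "\<dots> = (\<integral>t. complex_of_real ((cmod (f m t - f n t))\<^sup>2) \<partial>\<mu>)"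
      by (intro Bochner_Integration.integral_cong refl) (simp only: complex_norm_square left_diff_distrib)
    also have "\<dots> = complex_of_real (\<integral>t. (cmod (f m t - f n t))\<^sup>2 \<partial>\<mu>)" by (rule integral_complex_of_real)
    finally show ?thesis by (simp only: of_real_eq_iff)
  qed
  have "Cauchy s" using s(2) by (rule LIMSEQ_imp_Cauchy)
  have "\<exists>N. \<forall>m\<ge>N. \<forall>n\<ge>N. (\<integral>t. (cmod (f m t - f n t))\<^sup>2 \<partial>\<mu>) < \<epsilon>" if "\<epsilon> > 0" for \<epsilon>
  proof -
    obtain N where N: "\<And>m n. m \<ge> N \<Longrightarrow> n \<ge> N \<Longrightarrow> norm (s m - s n) < sqrt \<epsilon>"
      using CauchyD[OF \<open>Cauchy s\<close>, of "sqrt \<epsilon>"] \<open>\<epsilon> > 0\<close> by auto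
    have "(norm (s m - s n))\<^sup>2 < \<epsilon>" if "m \<ge> N" "n \<ge> N" for m n
      using power_strict_mono[OF N[OF that], of 2] \<open>\<epsilon> > 0\<close> by simp
    then show ?thesis unfolding dist by blast
  qed
  then obtain g where g: "sqint g" "(\<lambda>n. \<integral>t. (cmod (f n t - g t))\<^sup>2 \<partial>\<mu>) \<longlonglongrightarrow> 0"
    by (rule sqint_complete[OF fsq])
  have cip: "\<langle>x, y\<rangle> = (\<integral>t. g t * cnj (h t) \<partial>\<mu>)" if "R y h" for y h
  proof (rule LIMSEQ_unique)
    show "(\<lambda>n. \<langle>s n, y\<rangle>) \<longlonglongrightarrow> \<langle>x, y\<rangle>" by (rule bounded_linear.tendsto[OF bounded_linear_cip_left s(2)])
    show "(\<lambda>n. \<langle>s n, y\<rangle>) \<longlonglongrightarrow> (\<integral>t. g t * cnj (h t) \<partial>\<mu>)"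
      unfolding trig_cip[OF f that] using that R_sqint sqint_cnj
      by (intro sqint_integral_tendsto[OF fsq g]) blast
  qed
  have "R x g" using g(1) cip[OF R_u, unfolded cnj_zeta_powi] by (simp add: R_def)
  then show ?thesis using cip by blast
qed

lemma R_cip:
  assumes x: "x \<in> K" and f: "R x f" and g: "R y g"
  shows "\<langle>x, y\<rangle> = (\<integral>t. f t * cnj (g t) \<partial>\<mu>)"
proof -
  obtain f' where f': "R x f'" "\<And>y g. R y g \<Longrightarrow> \<langle>x, y\<rangle> = (\<integral>t. f' t * cnj (g t) \<partial>\<mu>)" using R_on_K[OF x] by blast
  have [measurable]: "f \<in> borel_measurable borel" "f' \<in> borel_measurable borel" "(\<lambda>t. cnj (g t)) \<in> borel_measurable borel"
    using f f'(1) sqint_cnj[OF R_sqint[OF g]] by (auto simp: R_def sqint_def)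
  have "(\<integral>t. f' t * cnj (g t) \<partial>\<mu>) = (\<integral>t. f t * cnj (g t) \<partial>\<mu>)"
    using R_unique[OF f'(1) f] by (intro integral_cong_AE) auto
  then show ?thesis using f'(2)[OF g] by simp
qed

lemma K_projection:
  obtains p where "p \<in> K" "\<And>n. \<langle>x - p, u n\<rangle> = 0"
proof -
  obtain p where p: "p \<in> K" "\<And>s. s \<in> K \<Longrightarrow> inner (x - p) s = 0"
    using hilbert_projection[OF subspace_K closed_K] by metis
  have "\<langle>x - p, u n\<rangle> = 0" for n using p(2)[OF u_K(1)] p(2)[OF u_K(2)] by (simp add: cinner_def complex_eq_iff)
  with p(1) that show ?thesis by blast
qed

lemma R_shift: "R p f \<Longrightarrow> (\<And>n. \<langle>x - p, u n\<rangle> = 0) \<Longrightarrow> R x f"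
  by (simp add: R_def cip_diff_left)

definition \<phi> where "\<phi> x = (SOME f. R x f)"

text \<open>\<open>R\<close> only sees the projection onto \<open>K\<close>, so a representing
  function exists for every vector of the space.\<close>

lemma R_\<phi>: "R x (\<phi> x)"
proof -
  obtain p where p: "p \<in> K" "\<And>n. \<langle>x - p, u n\<rangle> = 0" using K_projection by blast
  obtain f where "R p f" using R_on_K[OF p(1)] by blast
  then have "R x f" using R_shift p(2) by blast
  then show ?thesis unfolding \<phi>_def by (rule someI[of "R x"])
qed

text \<open>Pairing with \<open>g\<close> is a functional bounded by Bessel's inequality. Its Riesz
  vector, tested on the orbit, has the moments of \<open>g\<close>; projecting it moves it into
  \<open>K\<close>.\<close>

lemma R_onto:
  assumes g: "sqint g"
  obtains z where "z \<in> K" "R z g"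
proof -
  note gc = sqint_cnj[OF g]
  define F where "F x = Re (\<integral>t. \<phi> x t * cnj (g t) \<partial>\<mu>)" for x
  have F_R: "F x = Re (\<integral>t. f t * cnj (g t) \<partial>\<mu>)" if "R x f" for x f
  proof -
    have [measurable]: "f \<in> borel_measurable borel" "\<phi> x \<in> borel_measurable borel" "(\<lambda>t. cnj (g t)) \<in> borel_measurable borel"
      using that R_\<phi>[of x] gc by (auto simp: R_def sqint_def)
    have "(\<integral>t. \<phi> x t * cnj (g t) \<partial>\<mu>) = (\<integral>t. f t * cnj (g t) \<partial>\<mu>)"
      using R_unique[OF R_\<phi> that] by (intro integral_cong_AE) auto
    then show ?thesis by (simp add: F_def)
  qed
  have norm_\<phi>: "(\<integral>t. (cmod (\<phi> x t))\<^sup>2 \<partial>\<mu>) \<le> (norm x)\<^sup>2" for x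
  proof -
    obtain p where p: "p \<in> K" "\<And>n. \<langle>x - p, u n\<rangle> = 0" using K_projection by blast
    have Rp: "R p (\<phi> x)" using R_\<phi>[of x] p(2) by (simp add: R_def cip_diff_left)
    have xp: "\<langle>p, x - p\<rangle> = 0" using K_orthogonal[OF p(1)] p(2) cip_eq_0_commute by blast
    have "complex_of_real ((norm p)\<^sup>2) = (\<integral>t. \<phi> x t * cnj (\<phi> x t) \<partial>\<mu>)"
      using R_cip[OF p(1) Rp Rp] by (simp only: cip_self)
    also have "\<dots> = complex_of_real (\<integral>t. (cmod (\<phi> x t))\<^sup>2 \<partial>\<mu>)"
      by (simp only: complex_norm_square[symmetric] integral_complex_of_real)
    finally have "(\<integral>t. (cmod (\<phi> x t))\<^sup>2 \<partial>\<mu>) = inner p p" by (simp only: of_real_eq_iff power2_norm_eq_inner)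
    also have "\<dots> \<le> inner p p + inner (x - p) (x - p)" by simp
    also have "\<dots> = inner x x - 2 * inner p (x - p)"
      by (simp add: inner_diff_left inner_diff_right inner_commute)
    also have "inner p (x - p) = 0" using xp by (metis Re_cip zero_complex.sel(1))
    finally show ?thesis by (simp add: power2_norm_eq_inner)
  qed
  have "bounded_linear F"
  proof (rule bounded_linear_intro[of _ "sqrt (\<integral>t. (cmod (g t))\<^sup>2 \<partial>\<mu>)"])
    show "F (x + y) = F x + F y" for x y
      using F_R[OF R_add[OF R_\<phi> R_\<phi>, of x y]] sqint_mult_integrable[OF R_sqint[OF R_\<phi>] gc]
      by (simp add: F_def distrib_right)
    show "F (r *\<^sub>R x) = r *\<^sub>R F x" for r x
      using F_R[OF R_csc[OF R_\<phi>[of x], of "of_real r"]] by (simp add: F_def csc_of_real mult.assoc)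
    show "norm (F x) \<le> norm x * sqrt (\<integral>t. (cmod (g t))\<^sup>2 \<partial>\<mu>)" for x
    proof -
      have "norm (F x) \<le> norm (\<integral>t. \<phi> x t * cnj (g t) \<partial>\<mu>)" unfolding F_def by (simp add: abs_Re_le_cmod)
      also have "\<dots> \<le> (\<integral>t. norm (\<phi> x t * cnj (g t)) \<partial>\<mu>)" by (rule integral_norm_bound)
      also have "\<dots> \<le> sqrt ((\<integral>t. (cmod (\<phi> x t))\<^sup>2 \<partial>\<mu>) * (\<integral>t. (cmod (g t))\<^sup>2 \<partial>\<mu>))"
        using Cauchy_Schwarz_sqint[OF R_sqint[OF R_\<phi>] g] by (intro real_le_rsqrt) (simp add: norm_mult)
      also have "\<dots> \<le> sqrt ((norm x)\<^sup>2 * (\<integral>t. (cmod (g t))\<^sup>2 \<partial>\<mu>))"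
        by (intro real_sqrt_le_mono mult_right_mono norm_\<phi> integral_nonneg_AE) auto
      finally show ?thesis by (simp add: real_sqrt_mult)
    qed
  qed
  then obtain z where z: "\<And>x. F x = inner x z" by (rule riesz_representation) blast
  obtain p where p: "p \<in> K" "\<And>n. \<langle>z - p, u n\<rangle> = 0" using K_projection by blast
  have "cnj \<langle>z, u n\<rangle> = cnj (\<integral>t. g t * zeta t powi (- n) \<partial>\<mu>)" for n
  proof -
    have i: "(\<integral>t. cnj (g t * zeta t powi (- n)) \<partial>\<mu>) = (\<integral>t. zeta t powi n * cnj (g t) \<partial>\<mu>)"
      by (simp only: complex_cnj_mult cnj_zeta_powi minus_minus mult.commute)
    have "Re \<langle>u n, z\<rangle> = Re (\<integral>t. zeta t powi n * cnj (g t) \<partial>\<mu>)" using F_R[OF R_u, of n] z by (simp add: Re_cip)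
    \<comment> \<open>\<open>F\<close> yields real parts only; testing on
      \<open>\<i> \<odot> u n\<close> recovers the imaginary part.\<close>
    moreover have "Re (\<i> * \<langle>u n, z\<rangle>) = Re (\<i> * (\<integral>t. zeta t powi n * cnj (g t) \<partial>\<mu>))"
      using F_R[OF R_csc[OF R_u[of n], of \<i>]] z[of "\<i> \<odot> u n"] by (simp add: Re_cip[symmetric] cip_csc_left mult.assoc)
    ultimately have "\<langle>u n, z\<rangle> = (\<integral>t. zeta t powi n * cnj (g t) \<partial>\<mu>)" by (simp add: complex_eq_iff)
    then show ?thesis by (simp only: cnj_cip Bochner_Integration.integral_cnj[symmetric] i)
  qed
  then have "R z g" using g by (simp add: R_def)
  then have "R p g" using p(2) by (simp add: R_def cip_diff_left)
  then show ?thesis using that p(1) by blast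
qed

end

section \<open>Normalized distribution functions\<close>

locale locally_finite_borel =
  fixes N :: "real measure"
  assumes sets_N[simp, measurable_cong]: "sets N = sets borel"
    and finite_Icc: "emeasure N {a..b} < \<infinity>"
begin

lemma finite_bounded: "A \<subseteq> {a..b} \<Longrightarrow> emeasure N A \<noteq> \<infinity>"
  using emeasure_mono[of A "{a..b}" N] finite_Icc[of a b] by (auto simp: top_unique)

lemma measure_mono_bounded: "A \<subseteq> B \<Longrightarrow> B \<subseteq> {a..b} \<Longrightarrow> B \<in> sets borel \<Longrightarrow> measure N A \<le> measure N B"
  using finite_bounded[of B a b] emeasure_mono[of A B N] unfolding measure_def by (auto intro!: enn2real_mono simp: less_top)

lemma measure_singleton_le: assumes "s < t" shows "measure N {t} \<le> measure N {s<..t}"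
proof -
  have "{s<..t} \<subseteq> {s..t}" by auto
  from measure_mono_bounded[OF _ this] show ?thesis using assms by simp
qed

lemma measure_Un_bounded: "A \<inter> B = {} \<Longrightarrow> A \<union> B \<subseteq> {a..b} \<Longrightarrow> A \<in> sets borel \<Longrightarrow> B \<in> sets borel \<Longrightarrow>
    measure N (A \<union> B) = measure N A + measure N B"
  by (rule measure_Union) (use finite_bounded[of A a b] finite_bounded[of B a b] in auto)

definition F where "F t = (if 0 \<le> t then measure N {0<..t} else - measure N {t<..0})" for t :: real

lemma F_diff: assumes "a \<le> b" shows "F b - F a = measure N {a<..b}"
proof -
  have *: "measure N {x<..z} = measure N {x<..y} + measure N {y<..z}" if "x \<le> y" "y \<le> z" for x y z
  proof -
    have "{x<..z} = {x<..y} \<union> {y<..z}" using that by auto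
    then show ?thesis using that by (simp only:) (rule measure_Un_bounded[of _ _ x z], auto)
  qed
  show ?thesis using *[of 0 a b] *[of a 0 b] *[of a b 0] assms by (auto simp: F_def)
qed

lemma measure_tendsto_right: "((\<lambda>s. measure N {t<..s}) \<longlongrightarrow> 0) (at_right t)"
proof (rule tendsto_at_right_sequentially)
  show "t < t + 1" by simp
  fix S :: "nat \<Rightarrow> real" assume S: "\<And>n. t < S n" "\<And>n. S n < t + 1" "decseq S" "S \<longlonglongrightarrow> t"
  have "(\<Inter>n. {t<..S n}) = {}"
    using LIMSEQ_le_const[OF S(4)] by (auto, metis not_le)
  moreover have "(\<lambda>n. measure N {t<..S n}) \<longlonglongrightarrow> measure N (\<Inter>n. {t<..S n})"
  proof (rule Lim_measure_decseq)
    show "decseq (\<lambda>n. {t<..S n})" using S(3) by (auto simp: decseq_def) (meson order_trans)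
    show "emeasure N {t<..S n} \<noteq> \<infinity>" for n by (rule finite_bounded[of _ t "S n"]) auto
  qed auto
  ultimately show "(\<lambda>n. measure N {t<..S n}) \<longlonglongrightarrow> 0" by simp
qed

lemma measure_tendsto_left: "((\<lambda>s. measure N {s..<t}) \<longlongrightarrow> 0) (at_left t)"
proof (rule tendsto_at_left_sequentially)
  show "t - 1 < t" by simp
  fix S :: "nat \<Rightarrow> real" assume S: "\<And>n. S n < t" "\<And>n. t - 1 < S n" "incseq S" "S \<longlonglongrightarrow> t"
  have "(\<Inter>n. {S n..<t}) = {}"
    using LIMSEQ_le_const2[OF S(4)] by (auto, metis not_le)
  moreover have "(\<lambda>n. measure N {S n..<t}) \<longlonglongrightarrow> measure N (\<Inter>n. {S n..<t})"
  proof (rule Lim_measure_decseq)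
    show "decseq (\<lambda>n. {S n..<t})" using S(3) by (auto simp: decseq_def incseq_def)
    show "emeasure N {S n..<t} \<noteq> \<infinity>" for n by (rule finite_bounded[of _ "S n" t]) auto
  qed auto
  ultimately show "(\<lambda>n. measure N {S n..<t}) \<longlonglongrightarrow> 0" by simp
qed

text \<open>Removing half of the atom at t reaches the midpoint of the jump of \<open>F\<close>;
  adding half of the atom at 0 makes the value at 0 equal to 0.\<close>

definition Sigma where "Sigma t = F t - measure N {t} / 2 + measure N {0} / 2"

text \<open>The atom at s is part of the mass between t and s, so its half disappears in the
  limit.\<close>

lemma Sigma_right: "(Sigma \<longlongrightarrow> F t + measure N {0} / 2) (at_right t)"
proof (rule tendsto_sandwich)
  have *: "F t \<le> F s - measure N {s} / 2 \<and> F s - measure N {s} / 2 \<le> F t + measure N {t<..s}" if "t < s" for s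
    using F_diff[of t s] that measure_singleton_le[OF that] measure_nonneg[of N "{s}"] by (intro conjI; linarith)
  show "\<forall>\<^sub>F s in at_right t. F t + measure N {0} / 2 \<le> Sigma s"
    using eventually_at_right_less[of t] by eventually_elim (use * in \<open>auto simp: Sigma_def\<close>)
  show "\<forall>\<^sub>F s in at_right t. Sigma s \<le> (F t + measure N {0} / 2) + measure N {t<..s}"
    using eventually_at_right_less[of t] by eventually_elim (use * in \<open>auto simp: Sigma_def\<close>)
  show "((\<lambda>s. (F t + measure N {0} / 2) + measure N {t<..s}) \<longlongrightarrow> F t + measure N {0} / 2) (at_right t)"
    using tendsto_add[OF tendsto_const measure_tendsto_right] by simp
qed simp

lemma Sigma_left: "(Sigma \<longlongrightarrow> F t - measure N {t} + measure N {0} / 2) (at_left t)"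
proof (rule tendsto_sandwich)
  have *: "F t - measure N {t} - measure N {s..<t} \<le> F s - measure N {s} / 2 \<and> F s - measure N {s} / 2 \<le> F t - measure N {t}"
    if "s < t" for s
  proof -
    have "{s<..t} = {s<..<t} \<union> {t}" "{s..<t} = {s<..<t} \<union> {s}" using that by auto
    moreover have "measure N ({s<..<t} \<union> {t}) = measure N {s<..<t} + measure N {t}"
      "measure N ({s<..<t} \<union> {s}) = measure N {s<..<t} + measure N {s}"
      using that by (intro measure_Un_bounded[of _ _ s t]; auto)+
    ultimately have "measure N {s<..t} = measure N {s<..<t} + measure N {t}" "measure N {s..<t} = measure N {s<..<t} + measure N {s}"
      by (simp_all only:)
    then show ?thesis using F_diff[of s t] that measure_nonneg[of N "{s}"] measure_nonneg[of N "{s<..<t}"] by (intro conjI; linarith)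
  qed
  have ev: "\<forall>\<^sub>F s in at_left t. s < t" by (simp add: eventually_at_filter)
  show "\<forall>\<^sub>F s in at_left t. (F t - measure N {t} + measure N {0} / 2) - measure N {s..<t} \<le> Sigma s"
    using ev by eventually_elim (use * in \<open>force simp: Sigma_def\<close>)
  show "\<forall>\<^sub>F s in at_left t. Sigma s \<le> F t - measure N {t} + measure N {0} / 2"
    using ev by eventually_elim (use * in \<open>force simp: Sigma_def\<close>)
  show "((\<lambda>s. (F t - measure N {t} + measure N {0} / 2) - measure N {s..<t}) \<longlongrightarrow> F t - measure N {t} + measure N {0} / 2) (at_left t)"
    using tendsto_diff[OF tendsto_const measure_tendsto_left] by simp
qed simp

lemma right_lim_Sigma: "right_lim Sigma = (\<lambda>t. F t + measure N {0} / 2)"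
  unfolding right_lim_def by (intro ext tendsto_Lim Sigma_right) simp

lemma left_lim_Sigma: "left_lim Sigma t = F t - measure N {t} + measure N {0} / 2"
  unfolding left_lim_def by (intro tendsto_Lim Sigma_left) simp

lemma mono_Sigma: "mono Sigma"
proof (rule monoI)
  fix s t :: real assume "s \<le> t"
  show "Sigma s \<le> Sigma t"
  proof (cases "s = t")
    case False
    then have "s < t" using \<open>s \<le> t\<close> by simp
    then have "measure N {t} \<le> F t - F s"
      using F_diff[OF \<open>s \<le> t\<close>] measure_singleton_le[OF \<open>s < t\<close>] by simp
    then show ?thesis
      using measure_nonneg[of N "{s}"] measure_nonneg[of N "{t}"] unfolding Sigma_def by linarith
  qed simp
qed

text \<open>The right limits of \<open>Sigma\<close> differ from \<open>F\<close> by a constant, so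
  increments over half-open intervals, which generate the Borel sets, are unchanged.\<close>

lemma LS_measure_Sigma: "LS_measure Sigma = N"
proof -
  let ?G = "\<lambda>t. F t + measure N {0} / 2"
  have G: "?G x \<le> ?G y" if "x \<le> y" for x y using F_diff[OF that] measure_nonneg[of N "{x<..y}"] by linarith
  have cont: "continuous (at_right a) ?G" for a
  proof -
    have "((\<lambda>s. F a + measure N {a<..s} + measure N {0} / 2) \<longlongrightarrow> F a + 0 + measure N {0} / 2) (at_right a)"
      by (intro tendsto_intros measure_tendsto_right)
    moreover have "\<forall>\<^sub>F s in at_right a. F a + measure N {a<..s} + measure N {0} / 2 = ?G s"
      using eventually_at_right_less[of a]
    proof eventually_elim
      case (elim s)
      then show ?case using F_diff[of a s] by simp
    qed
    ultimately show ?thesis unfolding continuous_within by (simp add: tendsto_cong)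
  qed
  have "interval_measure ?G = N"
  proof (rule measure_eqI_generator_eq[of "range (\<lambda>(a, b). {a<..b::real})" UNIV _ _ "\<lambda>n. {- real n<..real n}"])
    show "Int_stable (range (\<lambda>(a, b). {a<..b::real}))"
      by (auto simp: Int_stable_def)
    show "emeasure (interval_measure ?G) X = emeasure N X" if Xr: "X \<in> range (\<lambda>(a, b). {a<..b::real})" for X
    proof -
      obtain a b where X: "X = {a<..b}" using Xr by auto
      show ?thesis
      proof (cases "a \<le> b")
        case True
        have "emeasure N {a<..b} \<noteq> \<infinity>" by (rule finite_bounded[of _ a b]) auto
        then have "emeasure N {a<..b} = ennreal (measure N {a<..b})" by (simp add: emeasure_eq_ennreal_measure)
        then show ?thesis unfolding X using emeasure_interval_measure_Ioc[OF True G cont] F_diff[OF True] by simp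
      qed (simp add: X)
    qed
    show "sets (interval_measure ?G) = sigma_sets UNIV (range (\<lambda>(a, b). {a<..b}))"
      "sets N = sigma_sets UNIV (range (\<lambda>(a, b). {a<..b}))"
      by (simp_all add: borel_sigma_sets_Ioc)
    show "(\<Union>n. {- real n<..real n}) = UNIV"
    proof (intro equalityI subsetI UNIV_I)
      fix x :: real
      obtain n where "\<bar>x\<bar> < real n" using reals_Archimedean2 by blast
      then show "x \<in> (\<Union>n. {- real n<..real n})" by (auto intro!: exI[of _ n])
    qed
    show "emeasure (interval_measure ?G) {- real n<..real n} \<noteq> \<infinity>" for n
      by (subst emeasure_interval_measure_Ioc[OF _ G cont]) auto
  qed auto
  then show ?thesis unfolding LS_measure_def right_lim_Sigma .
qed

lemma normalized_Sigma: "Sigma t = (left_lim Sigma t + right_lim Sigma t) / 2" "Sigma 0 = 0"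
  unfolding left_lim_Sigma right_lim_Sigma by (simp_all add: Sigma_def F_def)

end

section \<open>The model operator\<close>

lemma (in finite_borel) sqint_affine:
  "sqint (\<lambda>t. of_real t * g t) \<Longrightarrow> sqint g \<Longrightarrow> sqint (\<lambda>t. (of_real t + c) * g t)"
  using sqint_add[of "\<lambda>t. t * g t" "\<lambda>t. c * g t"] sqint_cmult by (simp add: distrib_right)

lemma of_real_neq_i[simp]: "complex_of_real t \<noteq> \<i>" "complex_of_real t \<noteq> - \<i>"
  by (auto simp: complex_eq_iff)

lemma t_minus_i_times_plus_i: "(of_real t - \<i>) * (of_real t + \<i>) = complex_of_real (t\<^sup>2 + 1)"
  by (simp add: complex_eq_iff power2_eq_square)

section \<open>Transfer of the representation to the weighted measure\<close>

context spectral
begin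

text \<open>The weight is the squared modulus of t - \<i>, so division by t - \<i> becomes an
  isometry; integrability of 1 / (1 + t^2) then amounts to finiteness of
  \<open>\<mu>\<close>.\<close>

definition weighted where "weighted = density \<mu> (\<lambda>t. ennreal (1 + t\<^sup>2))"

sublocale sig: locally_finite_borel weighted
proof
  show "sets weighted = sets borel" by (simp add: weighted_def)
  show "emeasure weighted {a..b} < \<infinity>" for a b
  proof -
    have "emeasure weighted {a..b} = (\<integral>\<^sup>+t. ennreal (1 + t\<^sup>2) * indicator {a..b} t \<partial>\<mu>)"
      unfolding weighted_def by (rule emeasure_density) auto
    also have "\<dots> \<le> (\<integral>\<^sup>+t. ennreal (1 + (\<bar>a\<bar> + \<bar>b\<bar>)\<^sup>2) \<partial>\<mu>)"
    proof (intro nn_integral_mono)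
      fix t
      have "t\<^sup>2 \<le> (\<bar>a\<bar> + \<bar>b\<bar>)\<^sup>2" if "t \<in> {a..b}"
        unfolding abs_le_square_iff[symmetric] using that by auto
      then show "ennreal (1 + t\<^sup>2) * indicator {a..b} t \<le> ennreal (1 + (\<bar>a\<bar> + \<bar>b\<bar>)\<^sup>2)"
        by (auto simp: indicator_def intro!: ennreal_leI)
    qed
    also have "\<dots> < \<infinity>" by (simp add: ennreal_mult_less_top emeasure_eq_measure)
    finally show ?thesis .
  qed
qed

abbreviation \<Sigma> where "\<Sigma> \<equiv> sig.Sigma"

lemma measurable_LS[simp]: "f \<in> borel_measurable (LS_measure \<Sigma>) \<longleftrightarrow> f \<in> borel_measurable borel"
  unfolding sig.LS_measure_Sigma by (simp add: measurable_cong_sets[OF sig.sets_N refl])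

lemma AE_LS: "(AE t in LS_measure \<Sigma>. P t) \<longleftrightarrow> (AE t in \<mu>. P t)"
proof -
  have "0 < ennreal (1 + t\<^sup>2)" for t by (simp add: add_pos_nonneg)
  then show ?thesis unfolding sig.LS_measure_Sigma unfolding weighted_def by (subst AE_density) auto
qed

lemma LS_integral:
  fixes f :: "real \<Rightarrow> 'b::{banach, second_countable_topology}"
  assumes "f \<in> borel_measurable borel"
  shows "integrable (LS_measure \<Sigma>) f \<longleftrightarrow> integrable \<mu> (\<lambda>t. (1 + t\<^sup>2) *\<^sub>R f t)"
    "integral\<^sup>L (LS_measure \<Sigma>) f = (\<integral>t. (1 + t\<^sup>2) *\<^sub>R f t \<partial>\<mu>)"
  unfolding sig.LS_measure_Sigma unfolding weighted_def
  by (rule integrable_density; use assms in simp) (rule integral_density; use assms in simp)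

lemma L2_iff_sqint: "L2 \<Sigma> f \<longleftrightarrow> sqint (\<lambda>t. (of_real t - \<i>) * f t)"
proof -
  have meas: "f \<in> borel_measurable borel \<longleftrightarrow> (\<lambda>t. (of_real t - \<i>) * f t) \<in> borel_measurable borel"
  proof
    assume "(\<lambda>t. (of_real t - \<i>) * f t) \<in> borel_measurable borel"
    then have "(\<lambda>t. (of_real t - \<i>) * f t / (of_real t - \<i>)) \<in> borel_measurable borel" by measurable
    then show "f \<in> borel_measurable borel" by simp
  qed measurable
  have "(1 + t\<^sup>2) *\<^sub>R (cmod (f t))\<^sup>2 = (cmod ((of_real t - \<i>) * f t))\<^sup>2" for t
    by (simp add: norm_mult power_mult_distrib cmod_power2 add.commute)
  then show ?thesis unfolding L2_def sqint_def measurable_LS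
    using meas LS_integral(1)[of "\<lambda>t. (cmod (f t))\<^sup>2"] by auto
qed

definition V where "V x t = \<phi> x t / (of_real t - \<i>)"

lemma \<phi>_V: "(of_real t - \<i>) * V x t = \<phi> x t"
  by (simp add: V_def)

lemma L2_V: "L2 \<Sigma> (V x)"
  unfolding L2_iff_sqint \<phi>_V using R_\<phi> by (rule R_sqint)

lemma L2_inner_V: "L2_inner \<Sigma> (V x) (V y) = (\<integral>t. \<phi> x t * cnj (\<phi> y t) \<partial>\<mu>)"
proof -
  have [measurable]: "V x \<in> borel_measurable borel" "V y \<in> borel_measurable borel"
    using L2_V by (auto simp: L2_def)
  have "(\<lambda>t. cnj (V y t)) \<in> borel_measurable borel"
    by (rule measurable_compose[OF _ borel_measurable_continuous_onI[OF continuous_on_cnj[OF continuous_on_id]]]) simp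
  then have "L2_inner \<Sigma> (V x) (V y) = (\<integral>t. (1 + t\<^sup>2) *\<^sub>R (V x t * cnj (V y t)) \<partial>\<mu>)"
    unfolding L2_inner_def by (subst LS_integral(2)) auto
  also have "\<dots> = (\<integral>t. \<phi> x t * cnj (\<phi> y t) \<partial>\<mu>)"
  proof (intro Bochner_Integration.integral_cong refl)
    fix t
    have "\<phi> x t * cnj (\<phi> y t) = ((of_real t - \<i>) * (of_real t + \<i>)) * (V x t * cnj (V y t))"
      unfolding \<phi>_V[symmetric] by (simp add: mult_ac)
    then show "(1 + t\<^sup>2) *\<^sub>R (V x t * cnj (V y t)) = \<phi> x t * cnj (\<phi> y t)"
      unfolding t_minus_i_times_plus_i by (simp add: scaleR_conv_of_real add.commute)
  qed
  finally show ?thesis .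
qed

lemma cip_e_integral: "R x f \<Longrightarrow> \<langle>x, e\<rangle> = (\<integral>t. f t \<partial>\<mu>)"
  unfolding R_def using u_0 by (auto dest: spec[of _ 0])

lemma one_minus_zeta: "1 - zeta t = 2 * \<i> / (of_real t + \<i>)" and one_plus_zeta: "1 + zeta t = 2 * of_real t / (of_real t + \<i>)"
  unfolding zeta_def using real_plus_i[of t] by (simp_all add: divide_simps)

text \<open>If dSigma were finite, t - \<i> would be square-integrable for \<open>\<mu>\<close>.
  Conjugating 1 - zeta cancels this factor, so its vector pairs with x - W x to a multiple of the
  conjugate of the product of x with \<open>e\<close>, which is 0. Density makes the vector zero,
  although its function vanishes nowhere.\<close>

lemma admissible_\<Sigma>:
  assumes e: "e \<noteq> 0"
    and dense: "\<And>z. (\<And>x. \<langle>x, e\<rangle> = 0 \<Longrightarrow> \<langle>z, x - W x\<rangle> = 0) \<Longrightarrow> z = 0"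
  shows "admissible_Sigma \<Sigma>"
  unfolding admissible_Sigma_def
proof (intro conjI allI)
  show "mono \<Sigma>" by (rule sig.mono_Sigma)
  show "\<Sigma> t = (left_lim \<Sigma> t + right_lim \<Sigma> t) / 2" "\<Sigma> 0 = 0" for t by (rule sig.normalized_Sigma)+
  have "(\<integral>\<^sup>+ t. ennreal (1 / (1 + t\<^sup>2)) \<partial>LS_measure \<Sigma>) = (\<integral>\<^sup>+ t. ennreal (1 + t\<^sup>2) * ennreal (1 / (1 + t\<^sup>2)) \<partial>\<mu>)"
    unfolding sig.LS_measure_Sigma unfolding weighted_def by (rule nn_integral_density) auto
  also have "\<dots> = (\<integral>\<^sup>+ t. 1 \<partial>\<mu>)"
  proof (intro nn_integral_cong)
    fix t :: real
    have "1 + t\<^sup>2 \<noteq> 0" by (smt (verit) zero_le_power2)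
    moreover have "ennreal (1 + t\<^sup>2) * ennreal (1 / (1 + t\<^sup>2)) = ennreal ((1 + t\<^sup>2) * (1 / (1 + t\<^sup>2)))"
      by (rule ennreal_mult[symmetric]) auto
    ultimately show "ennreal (1 + t\<^sup>2) * ennreal (1 / (1 + t\<^sup>2)) = 1" by simp
  qed
  also have "\<dots> < \<infinity>" by (simp add: emeasure_eq_measure)
  finally show "(\<integral>\<^sup>+ t. ennreal (1 / (1 + t\<^sup>2)) \<partial>LS_measure \<Sigma>) < \<infinity>" .
  show "emeasure (LS_measure \<Sigma>) UNIV = \<infinity>"
  proof (rule ccontr)
    assume fin: "emeasure (LS_measure \<Sigma>) UNIV \<noteq> \<infinity>"
    have "finite_measure (LS_measure \<Sigma>)"
      by (rule finite_measureI) (use fin in \<open>simp add: LS_measure_def\<close>)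
    then have "integrable (LS_measure \<Sigma>) (\<lambda>t. (cmod 1)\<^sup>2)" by (intro finite_measure.integrable_const)
    then have "L2 \<Sigma> (\<lambda>_. 1)" by (simp add: L2_def)
    then have sq: "sqint (\<lambda>t. of_real t - \<i>)" by (simp add: L2_iff_sqint)
    obtain z where z: "z \<in> K" "R z (\<lambda>t. of_real t - \<i>)" using R_onto[OF sq] by blast
    have "z = 0"
    proof (rule dense)
      fix x assume x: "\<langle>x, e\<rangle> = 0"
      have "\<langle>z, x - W x\<rangle> = (\<integral>t. (of_real t - \<i>) * cnj (\<phi> x t - zeta t * \<phi> x t) \<partial>\<mu>)"
        by (rule R_cip[OF z R_diff[OF R_\<phi> R_W[OF R_\<phi>]]])
      also have "\<dots> = (\<integral>t. (- 2 * \<i>) * cnj (\<phi> x t) \<partial>\<mu>)"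
      proof (intro Bochner_Integration.integral_cong refl)
        fix t
        have "\<phi> x t - zeta t * \<phi> x t = 2 * \<i> / (of_real t + \<i>) * \<phi> x t"
          unfolding one_minus_zeta[symmetric] by (simp add: left_diff_distrib)
        then show "(of_real t - \<i>) * cnj (\<phi> x t - zeta t * \<phi> x t) = (- 2 * \<i>) * cnj (\<phi> x t)" by simp
      qed
      also have "\<dots> = (- 2 * \<i>) * cnj (\<integral>t. \<phi> x t \<partial>\<mu>)"
        by (simp only: Bochner_Integration.integral_cnj integral_mult_right_zero)
      also have "\<dots> = 0" using cip_e_integral[OF R_\<phi>, of x] x by simp
      finally show "\<langle>z, x - W x\<rangle> = 0" .
    qed
    then have "AE t in \<mu>. complex_of_real t - \<i> = 0" using R_zero_unique[OF z(2)] \<open>z = 0\<close> by simp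
    then have "AE t in \<mu>. False" by simp
    \<comment> \<open>The zeroth moment is the squared norm of \<open>e\<close>, so
      \<open>\<mu>\<close> cannot be the zero measure.\<close>
    then have "(\<integral>t. zeta t ^ 0 \<partial>\<mu>) = (\<integral>t. 0 \<partial>\<mu>)" by (intro integral_cong_AE) auto
    then show False using moments[of 0] e by simp
  qed
qed

text \<open>This undoes the Cayley coordinates on the function side. The choice of \<open>a\<close>
  turns the constant function of \<open>e\<close> into c t / (t + \<i>) and - c / (t + \<i>), the
  singular terms of the model; \<open>h\<close> stands for the other defect vector, which has no
  moments along this orbit.\<close>

lemma R_model:
  fixes c :: complex
  assumes w: "R w f" and h: "\<And>n. \<langle>h, u n\<rangle> = 0"
  defines "a \<equiv> - \<i> * c"
  shows "R (- ((\<i> / 2) \<odot> ((w - a \<odot> (e + h)) - W (w + a \<odot> (e + h))))) (\<lambda>t. (f t + c * of_real t) / (of_real t + \<i>))"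
    and "R ((1 / 2) \<odot> ((w - a \<odot> (e + h)) + W (w + a \<odot> (e + h)))) (\<lambda>t. (of_real t * f t - c) / (of_real t + \<i>))"
proof -
  have Re: "R e (\<lambda>_. 1)" using R_u[of 0] by (simp add: u_0)
  have "R h (\<lambda>_. 0)" using R_zero h by (simp add: R_def)
  then have Reh: "R (a \<odot> (e + h)) (\<lambda>t. a * (1 + 0))" by (intro R_csc R_add Re)
  note R = R_diff[OF w Reh] R_W[OF R_add[OF w Reh]]
  have nz: "\<i> * 2 + complex_of_real t * 2 \<noteq> 0" for t by (simp add: complex_eq_iff)
  have eq: "(f t - a) - zeta t * (f t + a) = (1 - zeta t) * f t - a * (1 + zeta t)"
    "(f t - a) + zeta t * (f t + a) = (1 + zeta t) * f t - a * (1 - zeta t)" for t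
    by (simp_all add: algebra_simps)
  have "(\<lambda>t. - (\<i> / 2 * ((f t - a * (1 + 0)) - zeta t * (f t + a * (1 + 0))))) = (\<lambda>t. (f t + c * of_real t) / (of_real t + \<i>))"
    by (intro ext) (simp only: mult_1_right add_0_right eq, simp only: one_minus_zeta one_plus_zeta a_def,
        simp add: divide_simps, simp add: algebra_simps nz)
  then show "R (- ((\<i> / 2) \<odot> ((w - a \<odot> (e + h)) - W (w + a \<odot> (e + h))))) (\<lambda>t. (f t + c * of_real t) / (of_real t + \<i>))"
    using R_minus[OF R_csc[OF R_diff[OF R], of "\<i> / 2"]] by simp
  have "(\<lambda>t. 1 / 2 * ((f t - a * (1 + 0)) + zeta t * (f t + a * (1 + 0)))) = (\<lambda>t. (of_real t * f t - c) / (of_real t + \<i>))"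
    by (intro ext) (simp only: mult_1_right add_0_right eq, simp only: one_minus_zeta one_plus_zeta a_def,
        simp add: divide_simps, simp add: algebra_simps nz)
  then show "R ((1 / 2) \<odot> ((w - a \<odot> (e + h)) + W (w + a \<odot> (e + h)))) (\<lambda>t. (of_real t * f t - c) / (of_real t + \<i>))"
    using R_csc[OF R_add[OF R], of "1 / 2"] by simp
qed

text \<open>Here \<open>q\<close> is the regular part of the model element. Its integral against
  dSigma cancels the weight and becomes the integral of \<open>f\<close>, which
  \<open>cip_e_integral\<close> identifies with a product with \<open>e\<close>.\<close>

lemma model_domain:
  assumes f: "sqint f"
  defines "q \<equiv> \<lambda>t. f t / of_real (t\<^sup>2 + 1)"
  shows "domQ \<Sigma> q" and "(\<integral>t. q t \<partial>LS_measure \<Sigma>) = (\<integral>t. f t \<partial>\<mu>)"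
    and "(f t + c * of_real t) / (of_real t + \<i>) = (of_real t - \<i>) * (q t + c * of_real (t / (t\<^sup>2 + 1)))"
    and "(of_real t * f t - c) / (of_real t + \<i>) = (of_real t - \<i>) * (of_real t * q t - c * of_real (1 / (t\<^sup>2 + 1)))"
proof -
  have nz: "complex_of_real (t\<^sup>2 + 1) \<noteq> 0" for t
    unfolding t_minus_i_times_plus_i[symmetric] by simp
  have q: "q t = f t / ((of_real t - \<i>) * (of_real t + \<i>))" for t
    unfolding q_def t_minus_i_times_plus_i ..
  have [measurable]: "f \<in> borel_measurable borel" using f by (rule sqint_measurable)
  have [measurable]: "q \<in> borel_measurable borel" unfolding q_def by measurable
  have le: "cmod (1 / (of_real t + \<i>)) \<le> 1" "cmod (of_real t / (of_real t + \<i>)) \<le> 1" for t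
    using abs_Re_le_cmod[of "of_real t + \<i>"] abs_Im_le_cmod[of "of_real t + \<i>"]
    by (simp_all add: norm_divide divide_le_eq_1)
  have "sqint (\<lambda>t. 1 / (of_real t + \<i>) * f t)" "sqint (\<lambda>t. of_real t / (of_real t + \<i>) * f t)"
    by (rule sqint_mult_bounded[OF f _ le(1)], measurable) (rule sqint_mult_bounded[OF f _ le(2)], measurable)
  moreover have "1 / (of_real t + \<i>) * f t = (of_real t - \<i>) * q t"
    "of_real t / (of_real t + \<i>) * f t = (of_real t - \<i>) * (of_real t * q t)" for t
    by (simp_all add: q)
  ultimately show "domQ \<Sigma> q" unfolding domQ_def L2_iff_sqint by simp
  have "(\<integral>t. q t \<partial>LS_measure \<Sigma>) = (\<integral>t. (1 + t\<^sup>2) *\<^sub>R q t \<partial>\<mu>)" by (rule LS_integral(2)) simp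
  also have "\<dots> = (\<integral>t. f t \<partial>\<mu>)"
    using nz by (intro Bochner_Integration.integral_cong refl) (simp add: q_def scaleR_conv_of_real add.commute)
  finally show "(\<integral>t. q t \<partial>LS_measure \<Sigma>) = (\<integral>t. f t \<partial>\<mu>)" .
  have gen: "p \<noteq> 0 \<Longrightarrow> d \<noteq> 0 \<Longrightarrow> (g + k * s) / d = p * (g / (p * d) + k * (s / (p * d)))"
    "p \<noteq> 0 \<Longrightarrow> d \<noteq> 0 \<Longrightarrow> (s * g - k) / d = p * (s * (g / (p * d)) - k * (1 / (p * d)))" for p d g k s :: complex
    by (simp_all add: divide_simps)
  have "complex_of_real (t / (t\<^sup>2 + 1)) = of_real t / ((of_real t - \<i>) * (of_real t + \<i>))"
    "complex_of_real (1 / (t\<^sup>2 + 1)) = 1 / ((of_real t - \<i>) * (of_real t + \<i>))"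
    unfolding t_minus_i_times_plus_i by simp_all
  then show "(f t + c * of_real t) / (of_real t + \<i>) = (of_real t - \<i>) * (q t + c * of_real (t / (t\<^sup>2 + 1)))"
    "(of_real t * f t - c) / (of_real t + \<i>) = (of_real t - \<i>) * (of_real t * q t - c * of_real (1 / (t\<^sup>2 + 1)))"
    using gen[OF real_plus_i(2)[of t] real_plus_i(1)[of t], where g="f t" and k=c and s="of_real t"] by (simp_all only: q)
qed

lemma domQ_sqint:
  assumes "domQ \<Sigma> q" shows "sqint (\<lambda>t. of_real (t\<^sup>2 + 1) * q t)"
proof -
  have "sqint (\<lambda>t. (of_real t - \<i>) * q t)" "sqint (\<lambda>t. of_real t * ((of_real t - \<i>) * q t))"
    using assms by (auto simp: domQ_def L2_iff_sqint mult_ac)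
  from sqint_affine[OF this(2,1), of \<i>] show ?thesis
    unfolding t_minus_i_times_plus_i[symmetric] by (simp only: mult_ac)
qed

end

section \<open>Unitary equivalence\<close>

locale spectral_pair = E: spectral I W \<mu> e + H: spectral I W \<nu> f
  for I W :: "'h::{real_inner, complete_space} \<Rightarrow> 'h" and \<mu> \<nu> e f +
  assumes orthogonal: "cinner I (E.u m) (H.u n) = 0"
    and cyclic: "(\<And>n. cinner I x (E.u n) = 0) \<Longrightarrow> (\<And>n. cinner I x (H.u n) = 0) \<Longrightarrow> x = 0"
begin

lemma orthogonal': "\<langle>H.u n, E.u m\<rangle> = 0"
  using orthogonal E.cip_eq_0_commute by blast

lemma K_orthogonal: "x \<in> E.K \<Longrightarrow> \<langle>x, H.u n\<rangle> = 0" "x \<in> H.K \<Longrightarrow> \<langle>x, E.u n\<rangle> = 0"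
  using E.K_orthogonal[OF _ orthogonal] H.K_orthogonal[OF _ orthogonal'] by blast+

text \<open>What the two projections leave over is orthogonal to both orbits and vanishes by
  cyclicity.\<close>

lemma decompose:
  obtains p q where "x = p + q" "p \<in> E.K" "q \<in> H.K"
    "\<And>g. E.R x g \<Longrightarrow> E.R p g" "\<And>g. H.R x g \<Longrightarrow> H.R q g"
proof -
  obtain p where p: "p \<in> E.K" "\<And>n. \<langle>x - p, E.u n\<rangle> = 0" using E.K_projection[of x] by blast
  obtain q where q: "q \<in> H.K" "\<And>n. \<langle>x - q, H.u n\<rangle> = 0" using H.K_projection[of x] by blast
  have "x - p - q = 0"
    by (rule cyclic) (use p q K_orthogonal in \<open>simp_all add: E.cip_diff_left\<close>)
  then have "x = p + q" by (simp add: algebra_simps)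
  moreover have "E.R p g" if "E.R x g" for g using that p(2) by (simp add: E.R_def E.cip_diff_left)
  moreover have "H.R q g" if "H.R x g" for g using that q(2) by (simp add: H.R_def E.cip_diff_left)
  ultimately show ?thesis using that p(1) q(1) by blast
qed

lemma combine:
  assumes "E.sqint g" "H.sqint h"
  obtains x where "E.R x g" "H.R x h"
proof -
  obtain p where p: "p \<in> E.K" "E.R p g" using E.R_onto[OF assms(1)] by blast
  obtain q where q: "q \<in> H.K" "H.R q h" using H.R_onto[OF assms(2)] by blast
  have "E.R (p + q) g" "H.R (p + q) h"
    using p q K_orthogonal by (simp_all add: E.R_def H.R_def E.cip_add_left)
  with that show ?thesis by blast
qed

lemma R_determines: "E.R x g \<Longrightarrow> E.R y g \<Longrightarrow> H.R x h \<Longrightarrow> H.R y h \<Longrightarrow> x = y"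
  using cyclic[of "x - y"] by (simp add: E.R_def H.R_def E.cip_diff_left)

definition U where "U x = (E.V x, H.V x)"

lemma unitary_U: "unitary_to_L2 I E.\<Sigma> H.\<Sigma> U"
  unfolding unitary_to_L2_def
proof (intro conjI allI impI)
  show "L2 E.\<Sigma> (fst (U x))" "L2 H.\<Sigma> (snd (U x))" for x
    by (simp_all add: U_def E.L2_V H.L2_V)
  show "\<langle>x, y\<rangle> = L2_inner E.\<Sigma> (fst (U x)) (fst (U y)) + L2_inner H.\<Sigma> (snd (U x)) (snd (U y))" for x y
  proof -
    obtain p q where *: "x = p + q" "p \<in> E.K" "q \<in> H.K"
      "\<And>g. E.R x g \<Longrightarrow> E.R p g" "\<And>g. H.R x g \<Longrightarrow> H.R q g" using decompose[of x] by blast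
    have "\<langle>x, y\<rangle> = \<langle>p, y\<rangle> + \<langle>q, y\<rangle>" using *(1) by (simp add: E.cip_add_left)
    also have "\<langle>p, y\<rangle> = (\<integral>t. E.\<phi> x t * cnj (E.\<phi> y t) \<partial>\<mu>)" by (rule E.R_cip[OF *(2) *(4)[OF E.R_\<phi>] E.R_\<phi>])
    also have "\<langle>q, y\<rangle> = (\<integral>t. H.\<phi> x t * cnj (H.\<phi> y t) \<partial>\<nu>)" by (rule H.R_cip[OF *(3) *(5)[OF H.R_\<phi>] H.R_\<phi>])
    finally show ?thesis by (simp add: U_def E.L2_inner_V H.L2_inner_V)
  qed
  fix fp fm assume L: "L2 E.\<Sigma> fp \<and> L2 H.\<Sigma> fm"
  obtain x where x: "E.R x (\<lambda>t. (of_real t - \<i>) * fp t)" "H.R x (\<lambda>t. (of_real t - \<i>) * fm t)"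
    by (rule combine[of "\<lambda>t. (of_real t - \<i>) * fp t" "\<lambda>t. (of_real t - \<i>) * fm t"])
      (use L in \<open>simp_all add: E.L2_iff_sqint H.L2_iff_sqint\<close>)
  have "AE t in \<mu>. fst (U x) t = fp t"
    using E.R_unique[OF E.R_\<phi> x(1)] by eventually_elim (simp add: U_def E.V_def)
  moreover have "AE t in \<nu>. snd (U x) t = fm t"
    using H.R_unique[OF H.R_\<phi> x(2)] by eventually_elim (simp add: U_def H.V_def)
  ultimately show "\<exists>x. (AE t in LS_measure E.\<Sigma>. fst (U x) t = fp t) \<and> (AE t in LS_measure H.\<Sigma>. snd (U x) t = fm t)"
    unfolding E.AE_LS H.AE_LS by blast
qed

text \<open>\<open>modelx\<close> and \<open>modely\<close> recover x and y from the Cayley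
  coordinates of the boundary parametrisation, with c scaled to be the coefficient of the singular
  part in the model.\<close>

definition modelx where
  "modelx w c = - (cscale I (\<i> / 2) ((w - cscale I (- \<i> * c) (e + f)) - W (w + cscale I (- \<i> * c) (e + f))))"
definition modely where
  "modely w c = cscale I (1 / 2) ((w - cscale I (- \<i> * c) (e + f)) + W (w + cscale I (- \<i> * c) (e + f)))"

lemma R_modelx: "E.R w g \<Longrightarrow> E.R (modelx w c) (\<lambda>t. (g t + c * of_real t) / (of_real t + \<i>))"
    "H.R w h \<Longrightarrow> H.R (modelx w c) (\<lambda>t. (h t + c * of_real t) / (of_real t + \<i>))"
  and R_modely: "E.R w g \<Longrightarrow> E.R (modely w c) (\<lambda>t. (of_real t * g t - c) / (of_real t + \<i>))"
    "H.R w h \<Longrightarrow> H.R (modely w c) (\<lambda>t. (of_real t * h t - c) / (of_real t + \<i>))"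
proof -
  have "\<langle>f, E.u n\<rangle> = 0" "\<langle>e, H.u n\<rangle> = 0" for n
    using orthogonal'[of 0 n] orthogonal[of 0 n] by (simp_all add: E.u_0 H.u_0)
  note 1 = E.R_model[OF _ this(1)] and 2 = H.R_model[OF _ this(2)]
  show "E.R w g \<Longrightarrow> E.R (modelx w c) (\<lambda>t. (g t + c * of_real t) / (of_real t + \<i>))"
    "E.R w g \<Longrightarrow> E.R (modely w c) (\<lambda>t. (of_real t * g t - c) / (of_real t + \<i>))"
    unfolding modelx_def modely_def by (rule 1, assumption)+
  show "H.R w h \<Longrightarrow> H.R (modelx w c) (\<lambda>t. (h t + c * of_real t) / (of_real t + \<i>))"
    "H.R w h \<Longrightarrow> H.R (modely w c) (\<lambda>t. (of_real t * h t - c) / (of_real t + \<i>))"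
    unfolding modelx_def modely_def add.commute[of e f] by (rule 2, assumption)+
qed

text \<open>The two regular parts, multiplied by t^2 + 1, are the functions of one vector
  \<open>w\<close>, and the integrals in the boundary condition are its products with
  \<open>e\<close> and \<open>f\<close>. The first constant is 0 because only the difference of the
  constants enters.\<close>

lemma Ahat_U_iff:
  "(U x, U y) \<in> Ahat E.\<Sigma> 0 H.\<Sigma> D \<longleftrightarrow>
    (\<exists>w c. x = modelx w c \<and> y = modely w c \<and> \<langle>w, e\<rangle> = c * of_real D + \<langle>w, f\<rangle>)"
proof
  assume "\<exists>w c. x = modelx w c \<and> y = modely w c \<and> \<langle>w, e\<rangle> = c * of_real D + \<langle>w, f\<rangle>"
  then obtain w c where w: "x = modelx w c" "y = modely w c" "\<langle>w, e\<rangle> = c * of_real D + \<langle>w, f\<rangle>" by blast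
  define qp where "qp t = E.\<phi> w t / of_real (t\<^sup>2 + 1)" for t
  define qm where "qm t = H.\<phi> w t / of_real (t\<^sup>2 + 1)" for t
  note p = E.model_domain[OF E.R_sqint[OF E.R_\<phi>[of w]], folded qp_def]
  note m = H.model_domain[OF H.R_sqint[OF H.R_\<phi>[of w]], folded qm_def]
  show "(U x, U y) \<in> Ahat E.\<Sigma> 0 H.\<Sigma> D"
    unfolding Ahat_def U_def mem_Collect_eq prod.case
  proof (rule exI[of _ qp], rule exI[of _ qm], rule exI[of _ c], intro conjI, unfold E.AE_LS H.AE_LS)
    show "domQ E.\<Sigma> qp" "domQ H.\<Sigma> qm" using p(1) m(1) .
    show "AE t in \<mu>. E.V x t = qp t + c * complex_of_real (t / (t\<^sup>2 + 1))"
      using E.R_unique[OF E.R_\<phi> R_modelx(1)[OF E.R_\<phi>[of w], of c, folded w(1), unfolded p(3)]]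
      by eventually_elim (simp add: E.V_def)
    show "AE t in \<nu>. H.V x t = qm t + c * complex_of_real (t / (t\<^sup>2 + 1))"
      using H.R_unique[OF H.R_\<phi> R_modelx(2)[OF H.R_\<phi>[of w], of c, folded w(1), unfolded m(3)]]
      by eventually_elim (simp add: H.V_def)
    show "AE t in \<mu>. E.V y t = complex_of_real t * qp t - c * complex_of_real (1 / (t\<^sup>2 + 1))"
      using E.R_unique[OF E.R_\<phi> R_modely(1)[OF E.R_\<phi>[of w], of c, folded w(2), unfolded p(4)]]
      by eventually_elim (simp add: E.V_def)
    show "AE t in \<nu>. H.V y t = complex_of_real t * qm t - c * complex_of_real (1 / (t\<^sup>2 + 1))"
      using H.R_unique[OF H.R_\<phi> R_modely(2)[OF H.R_\<phi>[of w], of c, folded w(2), unfolded m(4)]]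
      by eventually_elim (simp add: H.V_def)
    show "c * complex_of_real 0 + integral\<^sup>L (LS_measure E.\<Sigma>) qp = c * complex_of_real D + integral\<^sup>L (LS_measure H.\<Sigma>) qm"
      using w(3) p(2) m(2) E.cip_e_integral[OF E.R_\<phi>, of w] H.cip_e_integral[OF H.R_\<phi>, of w] by simp
  qed
next
  assume "(U x, U y) \<in> Ahat E.\<Sigma> 0 H.\<Sigma> D"
  then obtain qp qm c where dom: "domQ E.\<Sigma> qp" "domQ H.\<Sigma> qm"
    and ae: "AE t in \<mu>. E.V x t = qp t + c * complex_of_real (t / (t\<^sup>2 + 1))"
      "AE t in \<nu>. H.V x t = qm t + c * complex_of_real (t / (t\<^sup>2 + 1))"
      "AE t in \<mu>. E.V y t = complex_of_real t * qp t - c * complex_of_real (1 / (t\<^sup>2 + 1))"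
      "AE t in \<nu>. H.V y t = complex_of_real t * qm t - c * complex_of_real (1 / (t\<^sup>2 + 1))"
    and eq: "integral\<^sup>L (LS_measure E.\<Sigma>) qp = c * complex_of_real D + integral\<^sup>L (LS_measure H.\<Sigma>) qm"
    unfolding Ahat_def U_def mem_Collect_eq prod.case E.AE_LS H.AE_LS by auto
  define g where "g t = of_real (t\<^sup>2 + 1) * qp t" for t
  define h where "h t = of_real (t\<^sup>2 + 1) * qm t" for t
  have sq: "E.sqint g" "H.sqint h" unfolding g_def h_def by (rule E.domQ_sqint[OF dom(1)], rule H.domQ_sqint[OF dom(2)])
  obtain w where w: "E.R w g" "H.R w h" by (rule combine[OF sq])
  have nz: "complex_of_real (t\<^sup>2 + 1) \<noteq> 0" for t unfolding t_minus_i_times_plus_i[symmetric] by simp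
  have q: "g t / of_real (t\<^sup>2 + 1) = qp t" "h t / of_real (t\<^sup>2 + 1) = qm t" for t
    using nz[of t] by (simp_all add: g_def h_def)
  note p = E.model_domain[OF sq(1), unfolded q] and m = H.model_domain[OF sq(2), unfolded q]
  have "E.R (modelx w c) (E.\<phi> x)"
    by (rule E.R_cong[OF R_modelx(1)[OF w(1)] E.sqint_measurable[OF E.R_sqint[OF E.R_\<phi>]]])
      (use ae(1) in eventually_elim, simp add: p(3) flip: E.\<phi>_V)
  moreover have "H.R (modelx w c) (H.\<phi> x)"
    by (rule H.R_cong[OF R_modelx(2)[OF w(2)] H.sqint_measurable[OF H.R_sqint[OF H.R_\<phi>]]])
      (use ae(2) in eventually_elim, simp add: m(3) flip: H.\<phi>_V)
  ultimately have "x = modelx w c" using R_determines E.R_\<phi> H.R_\<phi> by blast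
  moreover have "E.R (modely w c) (E.\<phi> y)"
    by (rule E.R_cong[OF R_modely(1)[OF w(1)] E.sqint_measurable[OF E.R_sqint[OF E.R_\<phi>]]])
      (use ae(3) in eventually_elim, simp add: p(4) flip: E.\<phi>_V)
  moreover have "H.R (modely w c) (H.\<phi> y)"
    by (rule H.R_cong[OF R_modely(2)[OF w(2)] H.sqint_measurable[OF H.R_sqint[OF H.R_\<phi>]]])
      (use ae(4) in eventually_elim, simp add: m(4) flip: H.\<phi>_V)
  ultimately have "y = modely w c" using R_determines E.R_\<phi> H.R_\<phi> by blast
  moreover have "\<langle>w, e\<rangle> = c * of_real D + \<langle>w, f\<rangle>"
    using eq p(2) m(2) E.cip_e_integral[OF w(1)] H.cip_e_integral[OF w(2)] by simp
  ultimately show "\<exists>w c. x = modelx w c \<and> y = modely w c \<and> \<langle>w, e\<rangle> = c * of_real D + \<langle>w, f\<rangle>"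
    using \<open>x = modelx w c\<close> by blast
qed

end

text \<open>Commuting with \<open>W\<close> propagates the eigenvalue along the orbit, backwards by
  injectivity of \<open>W\<close>. Opposite eigenvalues will make the two orbits orthogonal.\<close>

lemma (in spectral) eigenvector_u:
  fixes s :: real
  assumes J: "\<And>x. W (J x) = J (W x)" "J e = s *\<^sub>R e"
  shows "J (u n) = s *\<^sub>R u n"
proof (induction n rule: int_induct[where k = 0])
  case base
  show ?case using J(2) by (simp add: u_0)
next
  case (step1 i)
  then show ?case using J(1)[of "u i"] W_u[of i] by simp
next
  case (step2 i)
  have "W (J (u (i - 1))) = W (s *\<^sub>R u (i - 1))" using J(1)[of "u (i - 1)"] W_u[of "i - 1"] step2 by simp
  then show ?case using inj_W by (simp only: inj_eq)
qed

context signature_problem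
begin

theorem unitarily_equivalent_to_model:
  "\<exists>Sp Sm Cp Cm. admissible_Sigma Sp \<and> admissible_Sigma Sm \<and> unitarily_equivalent_to_Ahat I T Sp Cp Sm Cm"
proof -
  obtain W e f and C :: real where W: "cunitary I W" and ef: "e \<noteq> 0" "f \<noteq> 0" "J e = e" "J f = - f"
    and WJ: "\<And>x. W (J x) = J (W x)"
    and core_W: "\<And>u v. (u, v) \<in> core \<longleftrightarrow> v = W u \<and> \<langle>u, e\<rangle> = 0 \<and> \<langle>u, f\<rangle> = 0"
    and \<sigma>_W: "\<And>u v. (u, v) \<in> \<sigma> \<longleftrightarrow> (\<exists>x c. u = x - (c / 2) \<odot> (e + f) \<and> v = W (x + (c / 2) \<odot> (e + f))
      \<and> \<langle>x, f\<rangle> - \<langle>x, e\<rangle> = \<i> * of_real C * c)"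
    by (rule reference_extension) blast
  interpret W: cunitary I W by (rule W)
  have dense: "z = 0" if z: "\<And>x. \<langle>x, e\<rangle> = 0 \<Longrightarrow> \<langle>x, f\<rangle> = 0 \<Longrightarrow> \<langle>z, x - W x\<rangle> = 0" for z
  proof (rule dense_dom)
    fix u v assume "(u, v) \<in> core"
    then have "\<langle>z, u - v\<rangle> = 0" using core_W z by simp
    then show "inner z (u - v) = 0" by (metis Re_cip zero_complex.sel(1))
  qed
  have dense': "z = 0" if "\<And>y. inner z (y - W y) = 0" for z
    by (rule dense_dom) (use that core_W in auto)
  obtain \<mu> where \<mu>: "finite_measure \<mu>" "sets \<mu> = sets borel" "\<And>k::nat. (\<integral>t. zeta t ^ k \<partial>\<mu>) = \<langle>(W ^^ k) e, e\<rangle>"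
    by (rule W.spectral_measure_exists[OF dense' ef(1)]) blast+
  obtain \<nu> where \<nu>: "finite_measure \<nu>" "sets \<nu> = sets borel" "\<And>k::nat. (\<integral>t. zeta t ^ k \<partial>\<nu>) = \<langle>(W ^^ k) f, f\<rangle>"
    by (rule W.spectral_measure_exists[OF dense' ef(2)]) blast+
  interpret E: spectral I W \<mu> e
    by (intro spectral.intro W finite_borel.intro finite_borel_axioms.intro spectral_axioms.intro \<mu>)
  interpret H: spectral I W \<nu> f
    by (intro spectral.intro W finite_borel.intro finite_borel_axioms.intro spectral_axioms.intro \<nu>)
  have orthogonal: "\<langle>E.u m, H.u n\<rangle> = 0" for m n
  proof -
    have "J (E.u m) = E.u m" "J (H.u n) = - H.u n"
      using E.eigenvector_u[of J 1 m] H.eigenvector_u[of J "-1" n] WJ ef by auto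
    then have "\<langle>E.u m, H.u n\<rangle> = - \<langle>E.u m, H.u n\<rangle>" using cip_J[of "E.u m" "H.u n"] by (simp add: cip_minus_right)
    then show ?thesis by simp
  qed
  \<comment> \<open>The complement of both cyclic subspaces is mapped by \<open>W\<close> onto
    itself and lies in the domain of \<open>core\<close>, so simplicity makes it trivial.\<close>
  define M where "M = {x. \<forall>n. \<langle>x, E.u n\<rangle> = 0 \<and> \<langle>x, H.u n\<rangle> = 0}"
  have "M = {0}"
  proof (rule simple_core)
    show "csubspace I M"
      by (auto simp: csubspace_def subspace_def M_def cip_add_left cip_scaleR_left cip_I_left)
    have "M = (\<Inter>n. {x. \<langle>x, E.u n\<rangle> = 0} \<inter> {x. \<langle>x, H.u n\<rangle> = 0})" by (auto simp: M_def)
    also have "closed \<dots>"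
      by (intro closed_INT ballI closed_Int closed_Collect_eq continuous_on_const
          bounded_linear.continuous_on[OF bounded_linear_cip_left] continuous_on_id)
    finally show "closed M" .
    have shift: "\<langle>W x, E.u (n + 1)\<rangle> = \<langle>x, E.u n\<rangle>" "\<langle>W x, H.u (n + 1)\<rangle> = \<langle>x, H.u n\<rangle>" for x n
      by (simp_all flip: E.W_u H.W_u)
    have M_W: "W x \<in> M \<longleftrightarrow> x \<in> M" for x
    proof
      assume x: "W x \<in> M"
      have "\<langle>x, E.u n\<rangle> = 0 \<and> \<langle>x, H.u n\<rangle> = 0" for n
        unfolding shift(1)[of x n, symmetric] shift(2)[of x n, symmetric] using x unfolding M_def by blast
      then show "x \<in> M" by (simp add: M_def)
    next
      assume x: "x \<in> M"
      have "\<langle>W x, E.u n\<rangle> = 0 \<and> \<langle>W x, H.u n\<rangle> = 0" for n using shift[of x "n - 1"] x by (simp add: M_def)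
      then show "W x \<in> M" by (simp add: M_def)
    qed
    have core_M: "(x, W x) \<in> core" if "x \<in> M" for x
    proof -
      have "\<langle>x, E.u 0\<rangle> = 0" "\<langle>x, H.u 0\<rangle> = 0" using that by (auto simp: M_def)
      then show ?thesis by (simp add: core_W E.u_0 H.u_0)
    qed
    show "\<exists>v\<in>M. (u, v) \<in> core" if "u \<in> M" for u using M_W core_M that by blast
    show "\<exists>u\<in>M. (u, v) \<in> core" if "v \<in> M" for v
    proof -
      obtain u where "v = W u" using W.surj_W by (meson surjD)
      then show ?thesis using M_W core_M that by blast
    qed
  qed
  then have cyclic: "x = 0" if "\<And>n. \<langle>x, E.u n\<rangle> = 0" "\<And>n. \<langle>x, H.u n\<rangle> = 0" for x
    using that by (auto simp: M_def)
  interpret P: spectral_pair I W \<mu> \<nu> e f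
    by (intro spectral_pair.intro E.spectral_axioms H.spectral_axioms spectral_pair_axioms.intro orthogonal cyclic)
  have "admissible_Sigma E.\<Sigma>" by (rule E.admissible_\<Sigma>[OF ef(1)]) (blast intro: dense)
  moreover have "admissible_Sigma H.\<Sigma>" by (rule H.admissible_\<Sigma>[OF ef(2)]) (blast intro: dense)
  \<comment> \<open>Matching the parametrisations puts -\<i> c in place of c / 2, so c is replaced
    by -2 \<i> c and \<i> C c by 2 C c; this is the origin of -2 * C.\<close>
  moreover have "(x, y) \<in> T \<longleftrightarrow> (P.U x, P.U y) \<in> Ahat E.\<Sigma> 0 H.\<Sigma> (- 2 * C)" for x y
  proof -
    have coords: "x = - ((\<i> / 2) \<odot> (u - v)) \<and> y = (1 / 2) \<odot> (u + v) \<longleftrightarrow> y + I x = u \<and> y - I x = v" for u v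
    proof
      assume "x = - ((\<i> / 2) \<odot> (u - v)) \<and> y = (1 / 2) \<odot> (u + v)"
      then have x: "x = - ((1 / 2) *\<^sub>R I (u - v))" and y: "y = (1 / 2) *\<^sub>R (u + v)" by (auto simp: cscale_def)
      have Ix: "I x = (1 / 2) *\<^sub>R (u - v)" unfolding x by (simp only: I_minus I_scale II) (simp add: algebra_simps)
      show "y + I x = u \<and> y - I x = v" unfolding y Ix by (simp add: algebra_simps flip: scaleR_add_left)
    next
      assume "y + I x = u \<and> y - I x = v"
      then have u: "u = y + I x" and v: "v = y - I x" by auto
      show "x = - ((\<i> / 2) \<odot> (u - v)) \<and> y = (1 / 2) \<odot> (u + v)"
        unfolding u v by (simp add: cscale_def algebra_simps flip: scaleR_add_left)
    qed
    have "(P.U x, P.U y) \<in> Ahat E.\<Sigma> 0 H.\<Sigma> (- 2 * C) \<longleftrightarrow>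
      (\<exists>w c. y + I x = w - (- \<i> * c) \<odot> (e + f) \<and> y - I x = W (w + (- \<i> * c) \<odot> (e + f))
        \<and> \<langle>w, e\<rangle> = c * of_real (- 2 * C) + \<langle>w, f\<rangle>)"
      unfolding P.Ahat_U_iff P.modelx_def P.modely_def using coords by blast
    also have "\<dots> \<longleftrightarrow> (\<exists>w c. y + I x = w - (c / 2) \<odot> (e + f) \<and> y - I x = W (w + (c / 2) \<odot> (e + f))
        \<and> \<langle>w, f\<rangle> - \<langle>w, e\<rangle> = \<i> * of_real C * c)" (is "?L \<longleftrightarrow> ?R")
    proof
      assume ?L
      then obtain w c where "y + I x = w - (- \<i> * c) \<odot> (e + f)" "y - I x = W (w + (- \<i> * c) \<odot> (e + f))"
        "\<langle>w, e\<rangle> = c * of_real (- 2 * C) + \<langle>w, f\<rangle>" by blast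
      then show ?R by (intro exI[of _ w] exI[of _ "- 2 * \<i> * c"]) simp
    next
      assume ?R
      then obtain w c where "y + I x = w - (c / 2) \<odot> (e + f)" "y - I x = W (w + (c / 2) \<odot> (e + f))"
        "\<langle>w, f\<rangle> - \<langle>w, e\<rangle> = \<i> * of_real C * c" by blast
      then show ?L by (intro exI[of _ w] exI[of _ "\<i> * c / 2"]) (simp add: algebra_simps)
    qed
    also have "\<dots> \<longleftrightarrow> (x, y) \<in> T" unfolding \<sigma>_W[symmetric] by (rule \<sigma>_Cayley)
    finally show ?thesis by blast
  qed
  ultimately show ?thesis using P.unitary_U unfolding unitarily_equivalent_to_Ahat_def by blast
qed

end

theorem theorem2p1:
  fixes I :: "'h::{real_inner, complete_space} \<Rightarrow> 'h"
    and J :: "'h \<Rightarrow> 'h"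
    and T :: "('h \<times> 'h) set"
  assumes "complex_structure I"
    and "separable_space (euclidean :: 'h topology)"
    and "signature_op I J"
    and "J_self_adjoint I J T"
    and "simple_symmetric I (T \<inter> adjoint I T)"
    and "densely_defined (T \<inter> adjoint I T)"
    and "deficiency_indices I (T \<inter> adjoint I T) 2 2"
  shows "\<exists>Sp Sm Cp Cm. admissible_Sigma Sp \<and> admissible_Sigma Sm \<and>
           unitarily_equivalent_to_Ahat I T Sp Cp Sm Cm"
proof -
  interpret signature_problem I J T
    by unfold_locales (fact assms)+
  show ?thesis by (rule unitarily_equivalent_to_model)
qed

end
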